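(* Let $d,s\in\mathbb{N}$, $1\le p<\infty$, and $r>0$ (with $r>1$ if $p=1$), and set $r_*:=r-1$ if $p=1$ and $r_*:=r$ if $p>1$. Let $F^s_p$ be the set of probability density functions in $W^s_p(r)$ when $p\ge2$, and let $F^s_p=W^s_p(r,R)$, for some $R>0$, when $1\le p<2$. Then $$\liminf_{n\to\infty}\Big(\frac{r_*^{d/s}}{n}\Big)^{-\frac{sp}{2s+d}}\inf_{\tilde f}\sup_{f\in F^s_p}\mathbb{E}\|\tilde f-f\|_p^p\ge c,$$ where the infimum is taken over all possible estimators $\tilde f$ and the constant $c>0$ is independent of $R$ and $r_*$.
   Context: $\mathbb{N}$ denotes the positive integers. For a multi-index $\alpha$ of non-negative integers, $|\alpha|$ denotes the sum of its entries. Norms $\|\cdot\|_p$ are $L^p$ norms with respect to Lebesgue measure. Classical Sobolev space: $f\in L^p(\mathbb{R}^d)$ belongs to $W^s_p=W^s_p(\mathbb{R}^d)$ when $\|f\|_{W^s_p}:=\sum_{|\alpha|\le s}\|\partial^\alpha f\|_p<\infty$. $W^s_p(r)$ is the closed ball $\{f\in W^s_p:\|f\|_{W^s_p}\le r\}$. $W^s_p(r,R)$ is the set of all probability density functions $f\in W^s_p(r)$ such that $\operatorname{supp} f\subset\{x\in\mathbb{R}^d:|x-x_0|\le R\}$ for some $x_0\in\mathbb{R}^d$. An estimator $\tilde f$ is a measurable function of the sample, i.e. of $n$ i.i.d. random variables in $\mathbb{R}^d$ with density $f$; $\mathbb{E}$ denotes expectation when the sample is i.i.d. with density $f$.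
   Formalization: For p>2 a constant c valid for all r>0 is impossible (kernel estimators make the normalised risk tend to 0 as r→0), so there c is uniform only over r≥r0, for each r0>0; for p<2, "for some R>0" is read as all R≥R0(r), with c independent of R. *)

theory Defs
  imports "HOL-Probability.Probability"
begin

section \<open>Multi-index derivatives\<close>

definition partial_deriv :: "'d::finite \<Rightarrow> (real^'d \<Rightarrow> real) \<Rightarrow> real^'d \<Rightarrow> real"
  where "partial_deriv i \<phi> x = deriv (\<lambda>t. \<phi> (x + t *\<^sub>R axis i 1)) 0"

text \<open>A multi-index is a function \<open>\<alpha> :: 'd \<Rightarrow> nat\<close>.  The index type carries no order, so the iterated
  partial derivatives are taken along an arbitrary fixed enumeration of the coordinates.  The
  operator \<open>multi_deriv\<close> is only applied to smooth functions, where the order is irrelevant.\<close>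

definition coords :: "'d::finite list"
  where "coords = (SOME xs. distinct xs \<and> set xs = UNIV)"

definition multi_deriv :: "('d::finite \<Rightarrow> nat) \<Rightarrow> (real^'d \<Rightarrow> real) \<Rightarrow> real^'d \<Rightarrow> real"
  where "multi_deriv \<alpha> \<phi> = foldr (\<lambda>i. partial_deriv i ^^ \<alpha> i) coords \<phi>"

definition order_of :: "('d::finite \<Rightarrow> nat) \<Rightarrow> nat"
  where "order_of \<alpha> = (\<Sum>i\<in>UNIV. \<alpha> i)"

primrec C_k :: "nat \<Rightarrow> (real^'d::finite \<Rightarrow> real) \<Rightarrow> bool"
  where
    "C_k 0 \<phi> \<longleftrightarrow> continuous_on UNIV \<phi>"
  | "C_k (Suc k) \<phi> \<longleftrightarrow> \<phi> differentiable_on UNIV \<and> (\<forall>i. C_k k (partial_deriv i \<phi>))"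

definition test_function :: "(real^'d::finite \<Rightarrow> real) \<Rightarrow> bool"
  where "test_function \<phi> \<longleftrightarrow> (\<forall>k. C_k k \<phi>) \<and> compact (closure {x. \<phi> x \<noteq> 0})"

section \<open>Sobolev spaces\<close>

definition in_Lp :: "real \<Rightarrow> (real^'d::finite \<Rightarrow> real) \<Rightarrow> bool"
  where "in_Lp p f \<longleftrightarrow>
    f \<in> borel_measurable lborel \<and> integrable lborel (\<lambda>x. \<bar>f x\<bar> powr p)"

definition Lp_norm :: "real \<Rightarrow> (real^'d::finite \<Rightarrow> real) \<Rightarrow> real"
  where "Lp_norm p f = (\<integral>x. \<bar>f x\<bar> powr p \<partial>lborel) powr (1 / p)"

definition locally_integrable :: "(real^'d::finite \<Rightarrow> real) \<Rightarrow> bool"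
  where "locally_integrable f \<longleftrightarrow>
    f \<in> borel_measurable lborel \<and> (\<forall>K. compact K \<longrightarrow> set_integrable lborel K f)"

definition is_weak_deriv ::
    "('d::finite \<Rightarrow> nat) \<Rightarrow> (real^'d \<Rightarrow> real) \<Rightarrow> (real^'d \<Rightarrow> real) \<Rightarrow> bool"
  where "is_weak_deriv \<alpha> f g \<longleftrightarrow>
    locally_integrable f \<and> locally_integrable g \<and>
    (\<forall>\<phi>. test_function \<phi> \<longrightarrow>
      (\<integral>x. f x * multi_deriv \<alpha> \<phi> x \<partial>lborel) = (-1) ^ order_of \<alpha> * (\<integral>x. g x * \<phi> x \<partial>lborel))"

text \<open>Weak derivatives are unique almost everywhere; the choice of the representative affects neither
  membership in \<open>L\<^sup>p\<close> nor the norm.\<close>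

definition weak_deriv :: "('d::finite \<Rightarrow> nat) \<Rightarrow> (real^'d \<Rightarrow> real) \<Rightarrow> real^'d \<Rightarrow> real"
  where "weak_deriv \<alpha> f = (SOME g. is_weak_deriv \<alpha> f g)"

definition sobolev_space :: "nat \<Rightarrow> real \<Rightarrow> (real^'d::finite \<Rightarrow> real) set"
  where "sobolev_space s p = {f. in_Lp p f \<and>
    (\<forall>\<alpha>. order_of \<alpha> \<le> s \<longrightarrow>
      (\<exists>g. is_weak_deriv \<alpha> f g) \<and> in_Lp p (weak_deriv \<alpha> f))}"

definition sobolev_norm :: "nat \<Rightarrow> real \<Rightarrow> (real^'d::finite \<Rightarrow> real) \<Rightarrow> real"
  where "sobolev_norm s p f = (\<Sum>\<alpha> | order_of \<alpha> \<le> s. Lp_norm p (weak_deriv \<alpha> f))"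

definition sobolev_ball :: "nat \<Rightarrow> real \<Rightarrow> real \<Rightarrow> (real^'d::finite \<Rightarrow> real) set"
  where "sobolev_ball s p r = {f \<in> sobolev_space s p. sobolev_norm s p f \<le> r}"

section \<open>Density classes\<close>

text \<open>Functions represent classes in \<open>L\<^sup>p\<close>, so nonnegativity and the support condition are imposed
  almost everywhere.\<close>

definition prob_density :: "(real^'d::finite \<Rightarrow> real) \<Rightarrow> bool"
  where "prob_density f \<longleftrightarrow>
    f \<in> borel_measurable lborel \<and> (AE x in lborel. 0 \<le> f x) \<and>
    (\<integral>\<^sup>+x. ennreal (f x) \<partial>lborel) = 1"

definition sobolev_densities :: "nat \<Rightarrow> real \<Rightarrow> real \<Rightarrow> (real^'d::finite \<Rightarrow> real) set"
  where "sobolev_densities s p r = {f \<in> sobolev_ball s p r. prob_density f}"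

definition sobolev_densities_supp ::
    "nat \<Rightarrow> real \<Rightarrow> real \<Rightarrow> real \<Rightarrow> (real^'d::finite \<Rightarrow> real) set"
  where "sobolev_densities_supp s p r R =
    {f \<in> sobolev_densities s p r. \<exists>x0. AE x in lborel. x \<notin> cball x0 R \<longrightarrow> f x = 0}"

definition density_class :: "nat \<Rightarrow> real \<Rightarrow> real \<Rightarrow> real \<Rightarrow> (real^'d::finite \<Rightarrow> real) set"
  where "density_class s p r R =
    (if p \<ge> 2 then sobolev_densities s p r else sobolev_densities_supp s p r R)"

section \<open>Minimax risk\<close>

definition sample_measure :: "nat \<Rightarrow> (real^'d::finite \<Rightarrow> real) \<Rightarrow> (nat \<Rightarrow> real^'d) measure"
  where "sample_measure n f = (\<Pi>\<^sub>M i\<in>{..<n}. density lborel (\<lambda>x. ennreal (f x)))"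

text \<open>An estimator maps a sample \<open>\<omega>\<close> to a function of \<open>x\<close>, jointly measurably in \<open>(\<omega>, x)\<close>.\<close>

definition estimators :: "nat \<Rightarrow> ((nat \<Rightarrow> real^'d::finite) \<Rightarrow> real^'d \<Rightarrow> real) set"
  where "estimators n = {T. (\<lambda>(\<omega>, x). T \<omega> x)
    \<in> borel_measurable ((\<Pi>\<^sub>M i\<in>{..<n}. lborel) \<Otimes>\<^sub>M lborel)}"

text \<open>The risk takes values in \<open>[0,\<infinity>]\<close>; it is infinite if the estimation error is not in \<open>L\<^sup>p\<close> with
  positive probability.\<close>

definition Lp_risk :: "nat \<Rightarrow> real \<Rightarrow> ((nat \<Rightarrow> real^'d::finite) \<Rightarrow> real^'d \<Rightarrow> real)
    \<Rightarrow> (real^'d \<Rightarrow> real) \<Rightarrow> ennreal"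
  where "Lp_risk n p T f =
    (\<integral>\<^sup>+\<omega>. (\<integral>\<^sup>+x. ennreal (\<bar>T \<omega> x - f x\<bar> powr p) \<partial>lborel) \<partial>sample_measure n f)"

definition minimax_risk :: "nat \<Rightarrow> real \<Rightarrow> (real^'d::finite \<Rightarrow> real) set \<Rightarrow> ennreal"
  where "minimax_risk n p F = (INF T\<in>estimators n. SUP f\<in>F. Lp_risk n p T f)"

definition r_star :: "real \<Rightarrow> real \<Rightarrow> real"
  where "r_star p r = (if p = 1 then r - 1 else r)"

end

theory Submission
  imports Defs
begin

text \<open>The bound is an instance of Assouad's method.  The centre is a smooth density
  \<open>f\<^sub>0(x) = L\<^bsup>-d\<^esup> G(x/L)\<close>, flat enough that its Sobolev norm leaves room of order \<open>r\<^sub>*\<close> in the ball; for \<open>p = 1\<close> the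
  mass 1 of \<open>f\<^sub>0\<close> is part of its norm, which is why \<open>r - 1\<close> appears.  Divide \<open>[0,L]\<^sup>d\<close> into cubes of side \<open>h\<close>
  and add to \<open>f\<^sub>0\<close>, on an arbitrary set of these cubes, a copy of height \<open>\<gamma> \<approx> r\<^sub>* h\<^sup>s L\<^bsup>-d/p\<^esup>\<close> of a fixed profile of mean zero.
  All these functions stay in the class, and with \<open>n \<gamma>\<^sup>2 h\<^sup>d L\<^sup>d \<approx> 1\<close> two of them that differ on a single
  cube cannot be told apart from \<open>n\<close> observations.  Hence every estimator errs on a constant fraction of the cubes, and its risk
  is at least of order \<open>L\<^sup>d \<gamma>\<^sup>p\<close>, which is \<open>(r\<^sub>*\<^bsup>d/s\<^esup>/n)\<^bsup>sp/(2s+d)\<^esup>\<close> times \<open>L\<close> to the power \<open>(2/p - 1) d s p / (2s + d)\<close>.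

  For \<open>p \<le> 2\<close> this last exponent is nonnegative, so \<open>L \<ge> 1\<close> may depend on \<open>r\<close>; for \<open>p > 2\<close> it is negative, and \<open>L\<close> has
  to be chosen once for all \<open>r \<ge> r\<^sub>0\<close>.\<close>

section \<open>Smooth functions of compact support\<close>

text \<open>The Sobolev norm is computed from \<open>weak_deriv\<close>, an arbitrary choice among
  the weak derivatives. All hypotheses are therefore built from test functions, for which
  integration by parts and the uniqueness of weak derivatives show that the choice agrees almost
  everywhere with a classical derivative.

  The powers of \<open>L\<close> have two origins. The perturbation fills a volume of order
  \<open>L^d\<close>, so its norm is about \<gamma> \<open>h^(-s) L^(d/p)\<close>, and this has to
  fit into the room of order \<open>r_star\<close>. The chi-square distance of neighbouring
  hypotheses is about \<gamma>\<open>^2 h^d\<close> divided by the density underneath, which is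
  about \<open>L^(-d)\<close>; hence the factor \<open>L^d\<close> in the condition on
  \<open>n\<close>.

  A threshold on \<open>R\<close> cannot be avoided for \<open>p < 2\<close>: a density supported in
  a small ball has a large Sobolev norm (by Hoelder's inequality if \<open>p > 1\<close>, by
  Poincare's if \<open>p = 1\<close>), so for small \<open>R\<close> the class is empty and the
  minimax risk over it is 0. The threshold may depend on \<open>r\<close>, whereas \<open>c\<close>
  is fixed before \<open>r\<close> and \<open>R\<close>.\<close>

lemma has_derivative_along_axis:
  fixes f :: "real^'d::finite \<Rightarrow> real"
  assumes "f differentiable (at (x + t *\<^sub>R axis i 1))"
  shows "((\<lambda>t. f (x + t *\<^sub>R axis i 1)) has_real_derivative partial_deriv i f (x + t *\<^sub>R axis i 1)) (at t)"
proof -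
  let ?e = "axis i 1 :: real^'d"
  \<comment> \<open>The base point \<open>y\<close> is free because the fact serves twice: at
    \<open>u = 0\<close> with the base point moved along the axis, which identifies
    \<open>partial_deriv\<close>, and at \<open>u = t\<close> from \<open>x\<close> itself.\<close>
  have *: "((\<lambda>u. f (y + u *\<^sub>R ?e)) has_real_derivative f' ?e) (at u)"
    if "(f has_derivative f') (at (y + u *\<^sub>R ?e))" for f' y u
  proof -
    interpret bounded_linear f' using that by (rule has_derivative_bounded_linear)
    have "((\<lambda>u. y + u *\<^sub>R ?e) has_derivative (\<lambda>h. h *\<^sub>R ?e)) (at u)"
      by (auto intro!: derivative_eq_intros)
    then have "((\<lambda>u. f (y + u *\<^sub>R ?e)) has_derivative (\<lambda>h. f' (h *\<^sub>R ?e))) (at u)"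
      using that by (rule has_derivative_compose)
    then show ?thesis
      by (simp add: has_field_derivative_def scale mult.commute[of "f' ?e"] mult_commute_abs)
  qed
  obtain f' where f': "(f has_derivative f') (at (x + t *\<^sub>R ?e))"
    using assms by (auto simp: differentiable_def)
  have "((\<lambda>u. f ((x + t *\<^sub>R ?e) + u *\<^sub>R ?e)) has_real_derivative f' ?e) (at 0)"
    by (rule *) (simp add: f')
  then have "partial_deriv i f (x + t *\<^sub>R ?e) = f' ?e"
    unfolding partial_deriv_def by (rule DERIV_imp_deriv)
  with *[OF f'] show ?thesis by simp
qed

lemma has_partial_deriv:
  fixes f :: "real^'d::finite \<Rightarrow> real"
  assumes "f differentiable (at x)"
  shows "((\<lambda>t. f (x + t *\<^sub>R axis i 1)) has_real_derivative partial_deriv i f x) (at 0)"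
  using has_derivative_along_axis[of f x 0 i] assms by simp

lemma partial_deriv_eqI:
  assumes "((\<lambda>t. f (x + t *\<^sub>R axis i 1)) has_real_derivative D) (at 0)"
  shows "partial_deriv i f x = D"
  unfolding partial_deriv_def using assms by (rule DERIV_imp_deriv)

lemma differentiable_on_UNIV_at: "f differentiable_on UNIV \<Longrightarrow> f differentiable (at x)"
  by (simp add: differentiable_on_def)

section \<open>Rules for partial derivatives\<close>

lemma partial_deriv_const: "partial_deriv i (\<lambda>x. c) = (\<lambda>x. 0)"
  by (rule ext, rule partial_deriv_eqI) (auto intro!: derivative_eq_intros)

lemma partial_deriv_add:
  fixes f g :: "real^'d::finite \<Rightarrow> real"
  assumes "f differentiable_on UNIV" "g differentiable_on UNIV"
  shows "partial_deriv i (\<lambda>x. f x + g x) = (\<lambda>x. partial_deriv i f x + partial_deriv i g x)"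
  by (rule ext, rule partial_deriv_eqI)
    (intro DERIV_add has_partial_deriv assms differentiable_on_UNIV_at)

lemma partial_deriv_cmult:
  fixes f :: "real^'d::finite \<Rightarrow> real"
  assumes "f differentiable_on UNIV"
  shows "partial_deriv i (\<lambda>x. c * f x) = (\<lambda>x. c * partial_deriv i f x)"
  by (rule ext, rule partial_deriv_eqI)
    (intro DERIV_cmult has_partial_deriv assms differentiable_on_UNIV_at)

lemma partial_deriv_mult:
  fixes f g :: "real^'d::finite \<Rightarrow> real"
  assumes "f differentiable_on UNIV" "g differentiable_on UNIV"
  shows "partial_deriv i (\<lambda>x. f x * g x) = (\<lambda>x. partial_deriv i f x * g x + f x * partial_deriv i g x)"
proof (rule ext, rule partial_deriv_eqI)
  fix x
  show "((\<lambda>t. f (x + t *\<^sub>R axis i 1) * g (x + t *\<^sub>R axis i 1)) has_real_derivative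
      partial_deriv i f x * g x + f x * partial_deriv i g x) (at 0)"
    using DERIV_mult[OF has_partial_deriv[of f x i] has_partial_deriv[of g x i]] assms
    by (simp add: differentiable_on_UNIV_at algebra_simps)
qed

lemma partial_deriv_affine:
  fixes f :: "real^'d::finite \<Rightarrow> real"
  assumes "f differentiable_on UNIV"
  shows "partial_deriv i (\<lambda>x. f (c *\<^sub>R x + a)) = (\<lambda>x. c * partial_deriv i f (c *\<^sub>R x + a))"
proof (rule ext, rule partial_deriv_eqI)
  fix x
  \<comment> \<open>Writing the point as \<open>c * 0\<close> matches the value at 0 of the inner
    map \<open>t\<close> to \<open>c * t\<close> in the chain rule.\<close>
  have 1: "((\<lambda>t. f ((c *\<^sub>R x + a) + t *\<^sub>R axis i 1)) has_real_derivative partial_deriv i f (c *\<^sub>R x + a)) (at (c * 0))"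
    using has_partial_deriv[of f "c *\<^sub>R x + a" i] assms by (simp add: differentiable_on_UNIV_at)
  have 2: "((\<lambda>t. c * t) has_real_derivative c) (at 0)"
    by (auto intro!: derivative_eq_intros)
  have "((\<lambda>t. f ((c *\<^sub>R x + a) + (c * t) *\<^sub>R axis i 1)) has_real_derivative partial_deriv i f (c *\<^sub>R x + a) * c) (at 0)"
    using DERIV_chain2[OF 1 2] .
  then show "((\<lambda>t. f (c *\<^sub>R (x + t *\<^sub>R axis i 1) + a)) has_real_derivative c * partial_deriv i f (c *\<^sub>R x + a)) (at 0)"
    by (simp add: algebra_simps)
qed

section \<open>Functions of class C^k\<close>

lemma C_k_Suc_mono: "C_k (Suc k) f \<Longrightarrow> C_k k f"
proof (induction k arbitrary: f)
  case 0 then show ?case by (auto simp: differentiable_imp_continuous_on)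
next
  case (Suc k) then show ?case by (simp only: C_k.simps) blast
qed

lemma C_k_const: "C_k k (\<lambda>x. c)"
proof (induction k arbitrary: c)
  case (Suc k) then show ?case by (simp add: partial_deriv_const)
qed simp

lemma C_k_add: "C_k k f \<Longrightarrow> C_k k g \<Longrightarrow> C_k k (\<lambda>x. f x + g x)"
proof (induction k arbitrary: f g)
  case 0 then show ?case by (auto intro: continuous_intros)
next
  case (Suc k) then show ?case
    by (auto simp: partial_deriv_add intro: differentiable_on_add)
qed

lemma C_k_cmult: "C_k k f \<Longrightarrow> C_k k (\<lambda>x. c * f x)"
proof (induction k arbitrary: f)
  case 0 then show ?case by (auto intro: continuous_intros)
next
  case (Suc k) then show ?case
    by (auto simp: partial_deriv_cmult intro: differentiable_on_mult differentiable_on_const)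
qed

lemma C_k_mult: "C_k k f \<Longrightarrow> C_k k g \<Longrightarrow> C_k k (\<lambda>x. f x * g x)"
proof (induction k arbitrary: f g)
  case 0 then show ?case by (auto intro: continuous_intros)
next
  case (Suc k)
  \<comment> \<open>The product rule multiplies a derivative, which is of class \<open>k\<close>, by
    the other factor undifferentiated, whose class has to be lowered from
    \<open>Suc k\<close>.\<close>
  have "C_k k f" "C_k k g" using Suc.prems by (blast intro: C_k_Suc_mono)+
  then show ?case using Suc
    by (auto simp: partial_deriv_mult intro!: differentiable_on_mult C_k_add)
qed

lemma C_k_prod:
  assumes "\<And>j. j \<in> J \<Longrightarrow> C_k k (f j)"
  shows "C_k k (\<lambda>x. \<Prod>j\<in>J. f j x)"
proof (cases "finite J")
  case True then show ?thesis using assms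
    by (induction J rule: finite_induct) (auto intro: C_k_mult C_k_const)
qed (simp add: C_k_const)

lemma C_k_affine: "C_k k f \<Longrightarrow> C_k k (\<lambda>x. f (c *\<^sub>R x + a))"
proof (induction k arbitrary: f)
  case 0 then show ?case
    by (auto intro!: continuous_intros intro: continuous_on_compose2[of UNIV f])
next
  case (Suc k)
  have "(\<lambda>x. f (c *\<^sub>R x + a)) differentiable (at x)" for x
  proof -
    have "(f \<circ> (\<lambda>x. c *\<^sub>R x + a)) differentiable (at x)"
      using Suc.prems by (intro differentiable_chain_at) (auto simp: differentiable_on_def intro!: derivative_intros)
    then show ?thesis by (simp add: o_def)
  qed
  then show ?case using Suc by (auto simp: partial_deriv_affine differentiable_on_def intro: C_k_cmult)
qed

text \<open>The polynomial parameter makes the family closed under differentiation.\<close>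

definition exp_tail :: "real poly \<Rightarrow> real \<Rightarrow> real"
  where "exp_tail P t = (if t > 0 then poly P (1 / t) * exp (- (1 / t)) else 0)"

lemma tendsto_poly_mult_exp_uminus:
  "((\<lambda>u::real. poly P u * exp (- u)) \<longlongrightarrow> 0) at_top"
proof -
  have "((\<lambda>u::real. \<Sum>i\<le>degree P. coeff P i * (u ^ i / exp u)) \<longlongrightarrow> (\<Sum>i\<le>degree P. coeff P i * 0)) at_top"
    by (intro tendsto_intros tendsto_power_div_exp_0)
  then show ?thesis
    by (simp add: poly_altdef sum_distrib_right exp_minus divide_inverse mult.assoc)
qed

text \<open>With \<open>u = 1/t\<close> the chain rule turns \<open>P(u) exp(-u)\<close> into
  \<open>u^2 (P(u) - P'(u)) exp(-u)\<close>, which explains the polynomial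
  \<open>[:0, 0, 1:]\<close>, that is \<open>u^2\<close>. At 0 the difference quotient is again a
  polynomial in \<open>u\<close> times \<open>exp(-u)\<close>, which tends to 0 as \<open>u\<close>
  grows.\<close>

lemma exp_tail_has_derivative:
  "(exp_tail P has_real_derivative exp_tail ([:0, 0, 1:] * (P - pderiv P)) t) (at t)"
proof -
  consider "t > 0" | "t < 0" | "t = 0" by linarith
  then show ?thesis
  proof cases
    case 1
    have "((\<lambda>t. poly P (1 / t) * exp (- (1 / t))) has_real_derivative
        exp_tail ([:0, 0, 1:] * (P - pderiv P)) t) (at t)"
      unfolding exp_tail_def using 1
      by (auto intro!: derivative_eq_intros simp: field_simps power2_eq_square)
    moreover have "eventually (\<lambda>u. u > 0) (nhds t)"
      using 1 by (simp add: eventually_nhds_in_open[of "{0<..}", simplified])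
    ultimately show ?thesis
      by (subst DERIV_cong_ev[OF refl _ refl]) (auto simp: exp_tail_def elim: eventually_mono)
  next
    case 2
    have "((\<lambda>t. 0) has_real_derivative exp_tail ([:0, 0, 1:] * (P - pderiv P)) t) (at t)"
      unfolding exp_tail_def using 2 by (auto intro!: derivative_eq_intros)
    moreover have "eventually (\<lambda>u. u < 0) (nhds t)"
      using 2 by (simp add: eventually_nhds_in_open[of "{..<0}", simplified])
    ultimately show ?thesis
      by (subst DERIV_cong_ev[OF refl _ refl]) (auto simp: exp_tail_def elim: eventually_mono)
  next
    case 3
    \<comment> \<open>\<open>pCons 0 P\<close> is the polynomial \<open>u P(u)\<close>: it absorbs
      the division by \<open>t\<close> in the difference quotient.\<close>
    have "((\<lambda>t::real. poly (pCons 0 P) (inverse t) * exp (- inverse t)) \<longlongrightarrow> 0) (at_right 0)"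
      by (rule filterlim_compose[OF tendsto_poly_mult_exp_uminus filterlim_inverse_at_top_right])
    then have "((\<lambda>t. exp_tail P t / t) \<longlongrightarrow> 0) (at_right 0)"
      by (rule Lim_transform_eventually)
        (auto simp: exp_tail_def eventually_at_filter field_simps)
    moreover have "((\<lambda>t. exp_tail P t / t) \<longlongrightarrow> 0) (at_left 0)"
      by (rule Lim_transform_eventually[OF tendsto_const])
        (auto simp: exp_tail_def eventually_at_filter)
    ultimately have "((\<lambda>t. exp_tail P t / t) \<longlongrightarrow> 0) (at 0)"
      by (simp add: filterlim_split_at)
    then show ?thesis using 3 by (simp add: has_field_derivative_iff exp_tail_def)
  qed
qed

lemma exp_tail_nonneg: "0 \<le> exp_tail 1 t"
  by (simp add: exp_tail_def)

lemma exp_tail_le_1: "exp_tail 1 t \<le> 1"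
  by (simp add: exp_tail_def)

lemma exp_tail_eq_0_iff: "exp_tail 1 t = 0 \<longleftrightarrow> t \<le> 0"
  by (simp add: exp_tail_def)

lemma tendsto_exp_tail: "((\<lambda>n. exp_tail 1 (real n * t)) \<longlongrightarrow> (if t > 0 then 1 else 0)) sequentially"
proof (cases "t > 0")
  case True
  have "(\<lambda>n. exp (- (1 / t) * (1 / real n))) \<longlonglongrightarrow> exp (- (1 / t) * 0)"
    by (intro tendsto_intros lim_1_over_n)
  then have "(\<lambda>n. exp (- (1 / t) * (1 / real n))) \<longlonglongrightarrow> 1" by simp
  moreover have "eventually (\<lambda>n. exp (- (1 / t) * (1 / real n)) = exp_tail 1 (real n * t)) sequentially"
    using eventually_gt_at_top[of 0] by eventually_elim (use True in \<open>simp add: exp_tail_def field_simps\<close>)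
  ultimately show ?thesis using True by (auto intro: Lim_transform_eventually)
next
  case False
  then have "exp_tail 1 (real n * t) = 0" for n
    by (simp add: exp_tail_eq_0_iff mult_nonneg_nonpos)
  then show ?thesis using False by simp
qed

text \<open>A derivative along axis \<open>j\<close> multiplies the factor \<open>b\<close> by
  \<open>c\<close> or by 0 and replaces \<open>P\<close>, so the induction has to leave both
  free.\<close>

lemma C_k_exp_tail: "C_k k (\<lambda>x::real^'d::finite. b * exp_tail P (c * x $ i + a))"
proof (induction k arbitrary: b P)
  case 0
  have "continuous_on UNIV (exp_tail P)"
    by (rule DERIV_continuous_on) (rule has_field_derivative_at_within[OF exp_tail_has_derivative])
  then show ?case
    by (auto intro!: continuous_intros intro: continuous_on_compose2[of UNIV "exp_tail P"])
next
  case (Suc k)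
  let ?Q = "[:0, 0, 1:] * (P - pderiv P)"
  have d: "((\<lambda>x::real^'d. b * exp_tail P (c * x $ i + a)) has_derivative
     (\<lambda>h. b * (exp_tail ?Q (c * x $ i + a) * (c * h $ i)))) (at x)" for x
  proof -
    have 1: "(exp_tail P has_derivative (\<lambda>h. exp_tail ?Q (c * x $ i + a) * h)) (at (c * x $ i + a))"
      using exp_tail_has_derivative[of P "c * x $ i + a"] by (simp add: has_field_derivative_def)
    have 2: "((\<lambda>x::real^'d. c * x $ i + a) has_derivative (\<lambda>h. c * h $ i)) (at x)"
      by (auto intro!: derivative_eq_intros bounded_linear_imp_has_derivative bounded_linear_vec_nth)
    have "((\<lambda>x::real^'d. exp_tail P (c * x $ i + a)) has_derivative
      (\<lambda>h. exp_tail ?Q (c * x $ i + a) * (c * h $ i))) (at x)"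
      using has_derivative_compose[OF 2 1] .
    then show ?thesis by (rule has_derivative_mult_right)
  qed
  have "partial_deriv j (\<lambda>x::real^'d. b * exp_tail P (c * x $ i + a)) =
      (\<lambda>x. (if i = j then b * c else 0) * exp_tail ?Q (c * x $ i + a))" for j
  proof (rule ext, rule partial_deriv_eqI)
    fix x :: "real^'d"
    have "((\<lambda>t. c * (x $ i + t * (axis j 1 :: real^'d) $ i) + a) has_real_derivative c * (axis j 1 :: real^'d) $ i) (at 0)"
      by (auto intro!: derivative_eq_intros)
    from DERIV_cmult[OF DERIV_chain2[OF exp_tail_has_derivative this], of b P]
    have "((\<lambda>t. b * exp_tail P (c * (x + t *\<^sub>R axis j 1) $ i + a)) has_real_derivative
       b * (exp_tail ?Q (c * x $ i + a) * (c * (axis j 1 :: real^'d) $ i))) (at 0)"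
      by simp
    then show "((\<lambda>t. b * exp_tail P (c * (x + t *\<^sub>R axis j 1) $ i + a)) has_real_derivative
       (if i = j then b * c else 0) * exp_tail ?Q (c * x $ i + a)) (at 0)"
      by (rule DERIV_cong) (simp add: axis_def)
  qed
  moreover have "(\<lambda>x::real^'d. b * exp_tail P (c * x $ i + a)) differentiable_on UNIV"
    using d by (auto simp: differentiable_on_def differentiable_def)
  ultimately show ?case using Suc by simp
qed

section \<open>Test functions and their closure properties\<close>

lemma test_functionD:
  assumes "test_function f"
  shows "C_k k f" "continuous_on UNIV f" "f differentiable_on UNIV" "bounded {x. f x \<noteq> 0}"
proof -
  show k: "C_k k f" for k using assms by (simp add: test_function_def)
  show "continuous_on UNIV f" using k[of 0] by simp
  show "f differentiable_on UNIV" using k[of 1] by simp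
  show "bounded {x. f x \<noteq> 0}" using assms by (simp add: test_function_def compact_closure)
qed

lemma test_functionI:
  assumes "\<And>k. C_k k f" "bounded {x. f x \<noteq> 0}"
  shows "test_function f"
  using assms by (simp add: test_function_def compact_closure)

lemma test_function_zero: "test_function (\<lambda>x. 0)"
  by (rule test_functionI) (simp_all add: C_k_const)

lemma test_function_add:
  assumes "test_function f" "test_function g"
  shows "test_function (\<lambda>x. f x + g x)"
proof (rule test_functionI)
  show "bounded {x. f x + g x \<noteq> 0}"
    by (rule bounded_subset[of "{x. f x \<noteq> 0} \<union> {x. g x \<noteq> 0}"]) (use assms in \<open>auto dest: test_functionD\<close>)
qed (intro C_k_add test_functionD(1)[OF assms(1)] test_functionD(1)[OF assms(2)])

lemma test_function_cmult:
  assumes "test_function f"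
  shows "test_function (\<lambda>x. c * f x)"
proof (rule test_functionI)
  show "bounded {x. c * f x \<noteq> 0}"
    by (rule bounded_subset[of "{x. f x \<noteq> 0}"]) (use assms in \<open>auto dest: test_functionD\<close>)
qed (intro C_k_cmult test_functionD(1)[OF assms])

lemma test_function_mult:
  assumes "test_function f" "test_function g"
  shows "test_function (\<lambda>x. f x * g x)"
proof (rule test_functionI)
  show "bounded {x. f x * g x \<noteq> 0}"
    by (rule bounded_subset[of "{x. f x \<noteq> 0}"]) (use assms in \<open>auto dest: test_functionD\<close>)
qed (intro C_k_mult test_functionD(1)[OF assms(1)] test_functionD(1)[OF assms(2)])

lemma test_function_sum:
  assumes "\<And>j. j \<in> J \<Longrightarrow> test_function (f j)"
  shows "test_function (\<lambda>x. \<Sum>j\<in>J. f j x)"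
proof (cases "finite J")
  case True then show ?thesis using assms
    by (induction J rule: finite_induct) (auto intro: test_function_add test_function_zero)
qed (simp add: test_function_zero)

lemma test_function_affine:
  fixes f :: "real^'d::finite \<Rightarrow> real"
  assumes "test_function f" "c \<noteq> 0"
  shows "test_function (\<lambda>x. f (c *\<^sub>R x + a))"
proof (rule test_functionI)
  have "bounded ((\<lambda>z. - (1 / c) *\<^sub>R a + z) ` (\<lambda>y. (1 / c) *\<^sub>R y) ` {x. f x \<noteq> 0})"
    using test_functionD(4)[OF assms(1)]
    by (intro bounded_translation bounded_scaling)
  then have "bounded ((\<lambda>y. (1 / c) *\<^sub>R y + - (1 / c) *\<^sub>R a) ` {x. f x \<noteq> 0})"
    by (simp add: image_image add.commute)
  moreover have "x \<in> (\<lambda>y. (1 / c) *\<^sub>R y + - (1 / c) *\<^sub>R a) ` {x. f x \<noteq> 0}" if "f (c *\<^sub>R x + a) \<noteq> 0" for x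
    by (rule image_eqI[of _ _ "c *\<^sub>R x + a"]) (use that assms(2) in \<open>auto simp: algebra_simps\<close>)
  then have "{x. f (c *\<^sub>R x + a) \<noteq> 0} \<subseteq> (\<lambda>y. (1 / c) *\<^sub>R y + - (1 / c) *\<^sub>R a) ` {x. f x \<noteq> 0}"
    by blast
  ultimately show "bounded {x. f (c *\<^sub>R x + a) \<noteq> 0}"
    by (rule bounded_subset)
qed (intro C_k_affine test_functionD(1)[OF assms(1)])

lemma partial_deriv_eq_0:
  assumes "closed S" "\<And>y. y \<notin> S \<Longrightarrow> f y = 0" "x \<notin> S"
  shows "partial_deriv i f x = 0"
proof (rule partial_deriv_eqI)
  let ?l = "\<lambda>t::real. x + t *\<^sub>R axis i 1"
  have "open (?l -` (- S))"
    using assms(1) by (intro open_vimage) (auto intro!: continuous_intros)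
  moreover have "0 \<in> ?l -` (- S)" using assms(3) by simp
  ultimately have "eventually (\<lambda>t. t \<in> ?l -` (- S)) (nhds 0)"
    by (rule eventually_nhds_in_open)
  then have ev: "eventually (\<lambda>t. f (x + t *\<^sub>R axis i 1) = 0) (nhds 0)"
    by (rule eventually_mono) (use assms(2) in auto)
  show "((\<lambda>t. f (x + t *\<^sub>R axis i 1)) has_real_derivative 0) (at 0)"
    by (subst DERIV_cong_ev[OF refl ev refl]) simp
qed

lemma test_function_partial_deriv:
  assumes "test_function f"
  shows "test_function (partial_deriv i f)"
proof (rule test_functionI)
  show "C_k k (partial_deriv i f)" for k
    using test_functionD(1)[OF assms, of "Suc k"] by simp
  have "{x. partial_deriv i f x \<noteq> 0} \<subseteq> closure {x. f x \<noteq> 0}"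
  proof (rule ccontr)
    assume "\<not> ?thesis"
    then obtain x where "partial_deriv i f x \<noteq> 0" "x \<notin> closure {x. f x \<noteq> 0}" by blast
    with partial_deriv_eq_0[of "closure {x. f x \<noteq> 0}" f x i] closure_subset[of "{x. f x \<noteq> 0}"]
    show False by blast
  qed
  then show "bounded {x. partial_deriv i f x \<noteq> 0}"
    by (rule bounded_subset[OF bounded_closure[OF test_functionD(4)[OF assms]]])
qed

text \<open>The parameter \<open>m\<close> is a steepness: the bump is positive exactly on the open
  box, and it tends to the indicator of the box as \<open>m\<close> grows. The limit serves to prove
  uniqueness of weak derivatives; the densities use \<open>m = 1\<close>.\<close>

definition bump :: "real \<Rightarrow> real^'d::finite \<Rightarrow> real^'d \<Rightarrow> real^'d \<Rightarrow> real"
  where "bump m a b x = (\<Prod>i\<in>UNIV. exp_tail 1 (m * (x $ i - a $ i)) * exp_tail 1 (m * (b $ i - x $ i)))"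

lemma bump_nonneg: "0 \<le> bump m a b x"
  by (simp add: bump_def prod_nonneg exp_tail_nonneg)

lemma bump_le_1: "bump m a b x \<le> 1"
  unfolding bump_def by (intro prod_le_1) (auto simp: exp_tail_nonneg exp_tail_le_1 mult_le_one)

lemma bump_neq_0_iff:
  fixes a :: "real^'d::finite"
  assumes "m > 0" shows "bump m a b x \<noteq> 0 \<longleftrightarrow> x \<in> box a b"
  using assms by (auto simp: bump_def mem_box_cart exp_tail_eq_0_iff mult_le_0_iff not_le)

lemma bump_pos_iff:
  fixes a :: "real^'d::finite"
  assumes "m > 0" shows "bump m a b x > 0 \<longleftrightarrow> x \<in> box a b"
  using bump_neq_0_iff[OF assms, of a b x] bump_nonneg[of m a b x] by linarith

lemma test_function_bump:
  fixes a :: "real^'d::finite"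
  assumes "m > 0" shows "test_function (bump m a b)"
proof (rule test_functionI)
  show "bounded {x. bump m a b x \<noteq> 0}"
    using assms by (simp add: bump_neq_0_iff bounded_box)
  show "C_k k (bump m a b)" for k
  proof -
    have "C_k k (\<lambda>x::real^'d. \<Prod>i\<in>UNIV. (1 * exp_tail 1 (m * x $ i + - m * a $ i)) * (1 * exp_tail 1 ((- m) * x $ i + m * b $ i)))"
      by (intro C_k_prod C_k_mult C_k_exp_tail)
    then show ?thesis by (simp add: bump_def[abs_def] algebra_simps)
  qed
qed

lemma tendsto_bump:
  fixes a :: "real^'d::finite"
  shows "(\<lambda>m. bump (real m) a b x) \<longlonglongrightarrow> indicator (box a b) x"
proof -
  have "(\<lambda>m. bump (real m) a b x) \<longlonglongrightarrow>
     (\<Prod>i\<in>UNIV. (if x $ i - a $ i > 0 then 1 else 0) * (if b $ i - x $ i > 0 then 1 else 0))"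
    unfolding bump_def by (intro tendsto_prod tendsto_mult tendsto_exp_tail)
  also have "(\<Prod>i\<in>UNIV. (if x $ i - a $ i > 0 then 1 else 0) * (if b $ i - x $ i > 0 then 1 else 0)) = (indicator (box a b) x :: real)"
    by (auto simp: indicator_def mem_box_cart)
  finally show ?thesis .
qed

section \<open>Weak derivatives of test functions\<close>

lemma lborel_integral_affine:
  fixes f :: "'a::euclidean_space \<Rightarrow> real"
  assumes "c \<noteq> 0" and [measurable]: "f \<in> borel_measurable borel"
  shows "(\<integral>x. f (c *\<^sub>R x + a) \<partial>lborel) = (\<integral>x. f x \<partial>lborel) / \<bar>c\<bar> ^ DIM('a)"
proof -
  have "(\<integral>x. f x \<partial>lborel) = (\<integral>x. \<bar>c\<bar> ^ DIM('a) *\<^sub>R f x \<partial>distr lborel borel (\<lambda>x. a + c *\<^sub>R x))"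
    by (subst lborel_affine[OF assms(1), of a]) (simp add: integral_density)
  also have "\<dots> = (\<integral>x. \<bar>c\<bar> ^ DIM('a) *\<^sub>R f (a + c *\<^sub>R x) \<partial>lborel)"
    by (rule integral_distr) auto
  finally show ?thesis using assms(1) by (simp add: add.commute field_simps)
qed

lemma integrable_continuous_bounded_support:
  fixes f :: "'a::euclidean_space \<Rightarrow> real"
  assumes "continuous_on UNIV f" "bounded {x. f x \<noteq> 0}"
  shows "integrable lborel f"
proof -
  obtain R where R: "{x. f x \<noteq> 0} \<subseteq> cball 0 R"
    using bounded_subset_ballD[OF assms(2), of 0] ball_subset_cball by blast
  have "integrable lborel (\<lambda>x. indicator (cball 0 R) x *\<^sub>R f x)"
    by (rule borel_integrable_compact) (auto intro: continuous_on_subset[OF assms(1)])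
  also have "(\<lambda>x. indicator (cball 0 R) x *\<^sub>R f x) = f"
    using R by (auto simp: indicator_def fun_eq_iff)
  finally show ?thesis .
qed

lemma test_function_integrable: "test_function f \<Longrightarrow> integrable lborel f"
  by (intro integrable_continuous_bounded_support test_functionD)

lemma test_function_measurable: "test_function f \<Longrightarrow> f \<in> borel_measurable borel"
  by (intro borel_measurable_continuous_onI test_functionD)

lemma test_function_bounded_support:
  assumes "test_function f"
  obtains R where "R > 0" "\<And>x. x \<notin> cball 0 R \<Longrightarrow> f x = 0"
proof -
  obtain R where R: "R > 0" "{x. f x \<noteq> 0} \<subseteq> cball 0 R"
    using bounded_subset_ballD[OF test_functionD(4)[OF assms], of 0] ball_subset_cball by blast
  then show ?thesis using that[of R] by blast
qed

lemma test_function_bounded: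
  assumes "test_function f"
  obtains B where "B > 0" "\<And>x. \<bar>f x\<bar> \<le> B"
proof -
  obtain R where R: "R > 0" "\<And>x. x \<notin> cball 0 R \<Longrightarrow> f x = 0"
    using assms by (rule test_function_bounded_support) blast
  have "compact (f ` cball 0 R)"
    using test_functionD(2)[OF assms] by (intro compact_continuous_image) (auto intro: continuous_on_subset)
  then obtain B where B: "B > 0" "\<And>x. x \<in> cball 0 R \<Longrightarrow> \<bar>f x\<bar> \<le> B"
    using compact_imp_bounded bounded_pos[of "f ` cball 0 R"] by (metis imageI real_norm_def)
  then show ?thesis using R(2) that[of B] by (metis abs_zero less_imp_le)
qed

lemma test_function_integrable_powr:
  assumes "test_function f" "p > 0"
  shows "integrable lborel (\<lambda>x. \<bar>f x\<bar> powr p)"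
proof (rule integrable_continuous_bounded_support)
  show "continuous_on UNIV (\<lambda>x. \<bar>f x\<bar> powr p)"
    using assms(2) by (intro continuous_on_powr' continuous_intros test_functionD(2)[OF assms(1)]) auto
  show "bounded {x. \<bar>f x\<bar> powr p \<noteq> 0}" using test_functionD(4)[OF assms(1)] by simp
qed

text \<open>Difference quotients of a test function integrate to zero by translation invariance.\<close>

lemma integral_partial_deriv:
  fixes f :: "real^'d::finite \<Rightarrow> real"
  assumes f: "test_function f"
  shows "(\<integral>x. partial_deriv i f x \<partial>lborel) = 0"
proof -
  let ?e = "axis i 1 :: real^'d"
  let ?q = "\<lambda>n x. real (Suc n) * (f (x + (1 / real (Suc n)) *\<^sub>R ?e) - f x)"
  have df: "test_function (partial_deriv i f)" using f by (rule test_function_partial_deriv)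
  have meas [measurable]: "f \<in> borel_measurable borel" "partial_deriv i f \<in> borel_measurable borel"
    using f df by (simp_all add: test_function_measurable)
  obtain R where R: "R > 0" "\<And>x. x \<notin> cball 0 R \<Longrightarrow> f x = 0"
    using f by (rule test_function_bounded_support) blast
  obtain B where B: "B > 0" "\<And>x. \<bar>partial_deriv i f x\<bar> \<le> B"
    using df by (rule test_function_bounded) blast
  have D: "((\<lambda>t. f (x + t *\<^sub>R ?e)) has_real_derivative partial_deriv i f (x + t *\<^sub>R ?e)) (at t)" for x t
    by (intro has_derivative_along_axis differentiable_on_UNIV_at test_functionD f)
  have lip: "\<bar>?q n x\<bar> \<le> B" for n x
  proof -
    have "\<exists>z>0. z < 1 / real (Suc n) \<and> f (x + (1 / real (Suc n)) *\<^sub>R ?e) - f (x + 0 *\<^sub>R ?e)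
        = (1 / real (Suc n) - 0) * partial_deriv i f (x + z *\<^sub>R ?e)"
      by (rule MVT2) (auto intro: D)
    then obtain z where "f (x + (1 / real (Suc n)) *\<^sub>R ?e) - f x = (1 / real (Suc n)) * partial_deriv i f (x + z *\<^sub>R ?e)"
      by auto
    then show ?thesis using B(2) by simp
  qed
  \<comment> \<open>The shift has length at most 1, so outside the ball of radius
    \<open>R + 1\<close> both values of \<open>f\<close> vanish; inside, the mean value theorem
    bounds the quotient.\<close>
  have dom: "norm (?q n x) \<le> B * indicator (cball 0 (R + 1)) x" for n x
  proof (cases "x \<in> cball 0 (R + 1)")
    case True then show ?thesis using lip[of n x] by simp
  next
    case False
    have "norm x \<le> norm (x + (1 / real (Suc n)) *\<^sub>R ?e) + norm ((1 / real (Suc n)) *\<^sub>R ?e)"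
      using norm_triangle_ineq4[of "x + (1 / real (Suc n)) *\<^sub>R ?e" "(1 / real (Suc n)) *\<^sub>R ?e"] by simp
    moreover have "norm ((1 / real (Suc n)) *\<^sub>R ?e) \<le> 1" by simp
    moreover have "norm x > R + 1" using False by simp
    ultimately have "norm (x + (1 / real (Suc n)) *\<^sub>R ?e) > R" "norm x > R" by linarith+
    then have "f (x + (1 / real (Suc n)) *\<^sub>R ?e) = 0" "f x = 0"
      by (auto intro!: R(2))
    then show ?thesis using False by simp
  qed
  have lim: "(\<lambda>n. ?q n x) \<longlonglongrightarrow> partial_deriv i f x" for x
  proof -
    have "((\<lambda>h. (f (x + h *\<^sub>R ?e) - f x) / h) \<longlongrightarrow> partial_deriv i f x) (at 0)"
      using D[of x 0] by (simp add: has_field_derivative_iff)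
    moreover have "filterlim (\<lambda>n. 1 / real (Suc n)) (at 0) sequentially"
      using LIMSEQ_Suc[OF lim_1_over_n] by (simp add: filterlim_at)
    ultimately have "(\<lambda>n. (f (x + (1 / real (Suc n)) *\<^sub>R ?e) - f x) / (1 / real (Suc n))) \<longlonglongrightarrow> partial_deriv i f x"
      by (rule filterlim_compose)
    then show ?thesis by (simp add: mult.commute)
  qed
  have "(\<lambda>n. \<integral>x. ?q n x \<partial>lborel) \<longlonglongrightarrow> (\<integral>x. partial_deriv i f x \<partial>lborel)"
  proof (rule integral_dominated_convergence)
    show "integrable lborel (\<lambda>x::real^'d. B * indicator (cball 0 (R + 1)) x)"
      by (intro integrable_mult_right integrable_real_indicator) (simp_all add: emeasure_bounded_finite[OF bounded_cball, simplified])
  qed (use dom lim in auto)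
  moreover have "(\<integral>x. ?q n x \<partial>lborel) = 0" for n
  proof -
    have "integrable lborel (\<lambda>x. f (1 *\<^sub>R x + (1 / real (Suc n)) *\<^sub>R ?e))"
      by (intro test_function_integrable test_function_affine f) simp
    moreover have "(\<integral>x. f (1 *\<^sub>R x + (1 / real (Suc n)) *\<^sub>R ?e) \<partial>lborel) = (\<integral>x. f x \<partial>lborel)"
      by (subst lborel_integral_affine) auto
    ultimately show ?thesis using test_function_integrable[OF f] by simp
  qed
  ultimately show ?thesis using LIMSEQ_unique[OF _ tendsto_const] by force
qed

lemma integral_by_parts:
  assumes f: "test_function f" and g: "test_function g"
  shows "(\<integral>x. f x * partial_deriv i g x \<partial>lborel) = - (\<integral>x. partial_deriv i f x * g x \<partial>lborel)"
proof -
  have "integrable lborel (\<lambda>x. f x * partial_deriv i g x)" "integrable lborel (\<lambda>x. partial_deriv i f x * g x)"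
    by (intro test_function_integrable test_function_mult test_function_partial_deriv f g)+
  moreover have "(\<integral>x. partial_deriv i f x * g x + f x * partial_deriv i g x \<partial>lborel) = 0"
    using integral_partial_deriv[OF test_function_mult[OF f g], of i]
    by (simp add: partial_deriv_mult test_functionD f g)
  ultimately show ?thesis by simp
qed

text \<open>The classical derivative along the multi-index, taken in the reverse of the order of
  \<^const>\<open>multi_deriv\<close>.  This is the order which integration by parts produces, so that no appeal to the
  symmetry of second derivatives is needed.\<close>

definition derivs_along :: "'d::finite list \<Rightarrow> ('d \<Rightarrow> nat) \<Rightarrow> (real^'d \<Rightarrow> real) \<Rightarrow> real^'d \<Rightarrow> real"
  where "derivs_along xs \<alpha> f = fold (\<lambda>i. partial_deriv i ^^ \<alpha> i) xs f"

definition rev_deriv :: "('d::finite \<Rightarrow> nat) \<Rightarrow> (real^'d \<Rightarrow> real) \<Rightarrow> real^'d \<Rightarrow> real"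
  where "rev_deriv \<alpha> = derivs_along coords \<alpha>"

lemma derivs_along_simps:
  "derivs_along [] \<alpha> f = f"
  "derivs_along (i # xs) \<alpha> f = derivs_along xs \<alpha> ((partial_deriv i ^^ \<alpha> i) f)"
  by (simp_all add: derivs_along_def)

lemma test_function_partial_deriv_pow: "test_function f \<Longrightarrow> test_function ((partial_deriv i ^^ n) f)"
  by (induction n) (auto intro: test_function_partial_deriv)

lemma test_function_derivs_along: "test_function f \<Longrightarrow> test_function (derivs_along xs \<alpha> f)"
  by (induction xs arbitrary: f) (auto simp: derivs_along_simps intro: test_function_partial_deriv_pow)

lemma test_function_rev_deriv: "test_function f \<Longrightarrow> test_function (rev_deriv \<alpha> f)"
  unfolding rev_deriv_def by (rule test_function_derivs_along)

lemma test_function_foldr_partial_deriv: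
  "test_function f \<Longrightarrow> test_function (foldr (\<lambda>i. partial_deriv i ^^ \<alpha> i) xs f)"
  by (induction xs) (auto intro: test_function_partial_deriv_pow)

lemma coords_props: "distinct (coords :: 'd::finite list)" "set (coords :: 'd list) = UNIV"
proof -
  have "\<exists>xs :: 'd list. distinct xs \<and> set xs = UNIV" using finite_distinct_list[of "UNIV :: 'd set"] by auto
  from someI_ex[OF this] show "distinct (coords :: 'd list)" "set (coords :: 'd list) = UNIV"
    by (simp_all add: coords_def)
qed

lemma order_of_eq_sum_list: "order_of \<alpha> = sum_list (map \<alpha> coords)"
  by (simp add: order_of_def sum_list_distinct_conv_sum_set coords_props)

section \<open>Linearity, scaling and support of iterated derivatives\<close>

lemma partial_deriv_pow_add:
  assumes "test_function f" "test_function g"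
  shows "(partial_deriv i ^^ n) (\<lambda>x. f x + g x) = (\<lambda>x. (partial_deriv i ^^ n) f x + (partial_deriv i ^^ n) g x)"
  by (induction n) (simp_all add: partial_deriv_add test_functionD test_function_partial_deriv_pow assms)

lemma rev_deriv_add:
  assumes "test_function f" "test_function g"
  shows "rev_deriv \<alpha> (\<lambda>x. f x + g x) = (\<lambda>x. rev_deriv \<alpha> f x + rev_deriv \<alpha> g x)"
proof -
  have "derivs_along xs \<alpha> (\<lambda>x. f x + g x) = (\<lambda>x. derivs_along xs \<alpha> f x + derivs_along xs \<alpha> g x)" for xs
    using assms by (induction xs arbitrary: f g)
      (simp_all add: derivs_along_simps partial_deriv_pow_add test_function_partial_deriv_pow)
  then show ?thesis by (simp add: rev_deriv_def)
qed

lemma partial_deriv_pow_cmult: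
  assumes "test_function f"
  shows "(partial_deriv i ^^ n) (\<lambda>x. c * f x) = (\<lambda>x. c * (partial_deriv i ^^ n) f x)"
  by (induction n) (simp_all add: partial_deriv_cmult test_functionD test_function_partial_deriv_pow assms)

lemma rev_deriv_cmult:
  assumes "test_function f"
  shows "rev_deriv \<alpha> (\<lambda>x. c * f x) = (\<lambda>x. c * rev_deriv \<alpha> f x)"
proof -
  have "derivs_along xs \<alpha> (\<lambda>x. c * f x) = (\<lambda>x. c * derivs_along xs \<alpha> f x)" for xs
    using assms by (induction xs arbitrary: f)
      (simp_all add: derivs_along_simps partial_deriv_pow_cmult test_function_partial_deriv_pow)
  then show ?thesis by (simp add: rev_deriv_def)
qed

lemma rev_deriv_zero: "rev_deriv \<alpha> (\<lambda>x. 0) = (\<lambda>x. 0)"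
  using rev_deriv_cmult[OF test_function_zero, of \<alpha> 0] by simp

lemma rev_deriv_sum:
  assumes "\<And>j. j \<in> J \<Longrightarrow> test_function (f j)"
  shows "rev_deriv \<alpha> (\<lambda>x. \<Sum>j\<in>J. f j x) = (\<lambda>x. \<Sum>j\<in>J. rev_deriv \<alpha> (f j) x)"
proof (cases "finite J")
  case True then show ?thesis using assms
    by (induction J rule: finite_induct) (simp_all add: rev_deriv_zero rev_deriv_add test_function_sum)
qed (simp add: rev_deriv_zero)

lemma partial_deriv_pow_affine:
  assumes "test_function f"
  shows "(partial_deriv i ^^ n) (\<lambda>x. f (c *\<^sub>R x + a)) = (\<lambda>x. c ^ n * (partial_deriv i ^^ n) f (c *\<^sub>R x + a))"
proof (induction n)
  case (Suc n)
  let ?g = "(partial_deriv i ^^ n) f"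
  have g: "?g differentiable_on UNIV" by (intro test_functionD test_function_partial_deriv_pow assms)
  have "C_k (Suc 0) (\<lambda>x. ?g (c *\<^sub>R x + a))"
    by (intro C_k_affine test_functionD(1) test_function_partial_deriv_pow assms)
  then have "(\<lambda>x. ?g (c *\<^sub>R x + a)) differentiable_on UNIV" by simp
  then show ?case using Suc by (simp add: partial_deriv_cmult partial_deriv_affine[OF g] mult.assoc mult.left_commute)
qed simp

lemma rev_deriv_affine:
  assumes "test_function f" "c \<noteq> 0"
  shows "rev_deriv \<alpha> (\<lambda>x. f (c *\<^sub>R x + a)) = (\<lambda>x. c ^ order_of \<alpha> * rev_deriv \<alpha> f (c *\<^sub>R x + a))"
proof -
  \<comment> \<open>The induction over the list of coordinates pulls the factor \<open>c ^ n\<close>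
    of the first coordinate through the remaining ones, so homogeneity is required for every list
    and not only for \<open>coords\<close>.\<close>
  have cm: "derivs_along xs \<alpha> (\<lambda>x. d * f x) = (\<lambda>x. d * derivs_along xs \<alpha> f x)" if "test_function f" for xs d f
    using that by (induction xs arbitrary: f)
      (simp_all add: derivs_along_simps partial_deriv_pow_cmult test_function_partial_deriv_pow)
  have "derivs_along xs \<alpha> (\<lambda>x. f (c *\<^sub>R x + a)) = (\<lambda>x. c ^ sum_list (map \<alpha> xs) * derivs_along xs \<alpha> f (c *\<^sub>R x + a))" for xs
    using assms(1)
  proof (induction xs arbitrary: f)
    case (Cons i xs)
    then show ?case using assms(2)
      by (simp add: derivs_along_simps partial_deriv_pow_affine cm test_function_partial_deriv_pow
          test_function_affine power_add mult.assoc)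
  qed (simp add: derivs_along_simps)
  then show ?thesis by (simp add: rev_deriv_def order_of_eq_sum_list)
qed

lemma rev_deriv_eq_0:
  assumes "closed S" "\<And>y. y \<notin> S \<Longrightarrow> f y = 0" "x \<notin> S"
  shows "rev_deriv \<alpha> f x = 0"
proof -
  have pow: "(partial_deriv i ^^ n) f y = 0" if "\<And>y. y \<notin> S \<Longrightarrow> f y = 0" "y \<notin> S" for i n f y
    using that by (induction n arbitrary: y) (auto intro!: partial_deriv_eq_0[OF assms(1)])
  have "derivs_along xs \<alpha> f x = 0" for xs
    using assms(2) by (induction xs arbitrary: f) (auto simp: derivs_along_simps assms(3) pow)
  then show ?thesis by (simp add: rev_deriv_def)
qed

lemma integral_mult_multi_deriv:
  assumes f: "test_function f" and g: "test_function g"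
  shows "(\<integral>x. f x * multi_deriv \<alpha> g x \<partial>lborel) = (-1) ^ order_of \<alpha> * (\<integral>x. rev_deriv \<alpha> f x * g x \<partial>lborel)"
proof -
  have pow: "(\<integral>x. f x * (partial_deriv i ^^ n) g x \<partial>lborel) = (-1) ^ n * (\<integral>x. (partial_deriv i ^^ n) f x * g x \<partial>lborel)"
    if "test_function f" "test_function g" for i n f g
    using that
  proof (induction n arbitrary: f)
    case (Suc n)
    have "(\<integral>x. f x * (partial_deriv i ^^ Suc n) g x \<partial>lborel) = - (\<integral>x. partial_deriv i f x * (partial_deriv i ^^ n) g x \<partial>lborel)"
      using Suc.prems by (simp add: integral_by_parts test_function_partial_deriv_pow)
    also have "\<dots> = - ((-1) ^ n * (\<integral>x. (partial_deriv i ^^ n) (partial_deriv i f) x * g x \<partial>lborel))"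
      using Suc.prems by (subst Suc.IH) (auto intro: test_function_partial_deriv)
    finally show ?case by (simp add: funpow_swap1)
  qed simp
  have "(\<integral>x. f x * foldr (\<lambda>i. partial_deriv i ^^ \<alpha> i) xs g x \<partial>lborel) =
      (-1) ^ sum_list (map \<alpha> xs) * (\<integral>x. derivs_along xs \<alpha> f x * g x \<partial>lborel)" for xs
    using f
  proof (induction xs arbitrary: f)
    case (Cons i xs)
    have "(\<integral>x. f x * foldr (\<lambda>i. partial_deriv i ^^ \<alpha> i) (i # xs) g x \<partial>lborel) =
      (-1) ^ \<alpha> i * (\<integral>x. (partial_deriv i ^^ \<alpha> i) f x * foldr (\<lambda>i. partial_deriv i ^^ \<alpha> i) xs g x \<partial>lborel)"
      using Cons.prems g by (simp add: pow test_function_foldr_partial_deriv)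
    then show ?case
      by (simp add: Cons.IH Cons.prems test_function_partial_deriv_pow derivs_along_simps power_add)
  qed (simp add: derivs_along_simps)
  then show ?thesis by (simp add: rev_deriv_def order_of_eq_sum_list multi_deriv_def)
qed

section \<open>Weak derivatives and Sobolev norms of test functions\<close>

lemma test_function_locally_integrable:
  assumes "test_function f" shows "locally_integrable f"
  unfolding locally_integrable_def
proof (intro conjI allI impI)
  show "f \<in> borel_measurable lborel" using assms by (simp add: test_function_measurable)
  show "set_integrable lborel K f" if "compact K" for K
    unfolding set_integrable_def using that
    by (intro integrable_mult_indicator test_function_integrable assms) (auto simp: borel_compact)
qed

lemma is_weak_deriv_rev_deriv: "test_function f \<Longrightarrow> is_weak_deriv \<alpha> f (rev_deriv \<alpha> f)"
  by (simp add: is_weak_deriv_def test_function_locally_integrable test_function_rev_deriv integral_mult_multi_deriv)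

text \<open>Test functions approximate the indicators of open boxes, which generate the Borel sets.\<close>

lemma AE_eq_0_if_orthogonal_test_functions:
  fixes u :: "real^'d::finite \<Rightarrow> real"
  assumes u: "locally_integrable u" and orth: "\<And>\<phi>. test_function \<phi> \<Longrightarrow> (\<integral>x. u x * \<phi> x \<partial>lborel) = 0"
  shows "AE x in lborel. u x = 0"
proof -
  have [measurable]: "u \<in> borel_measurable borel" using u by (simp add: locally_integrable_def)
  have int: "integrable lborel (\<lambda>x. u x * indicator (box a b) x)" for a b
  proof -
    have "set_integrable lborel (cbox a b) u" using u by (simp add: locally_integrable_def)
    then have "set_integrable lborel (box a b) u"
      by (rule set_integrable_subset) (auto simp: box_subset_cbox)
    then show ?thesis by (simp add: set_integrable_def mult.commute)
  qed
  have zero: "(\<integral>x. u x * indicator (box a b) x \<partial>lborel) = 0" for a b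
  proof -
    \<comment> \<open>\<open>Suc m\<close> keeps the steepness positive. The bumps lie between 0 and
      the indicator of the box, so \<open>u\<close> restricted to the box dominates.\<close>
    have "(\<lambda>m. \<integral>x. u x * bump (real (Suc m)) a b x \<partial>lborel) \<longlonglongrightarrow> (\<integral>x. u x * indicator (box a b) x \<partial>lborel)"
    proof (rule integral_dominated_convergence)
      show "integrable lborel (\<lambda>x. \<bar>u x * indicator (box a b) x\<bar>)" using int by (rule integrable_abs)
      show "(\<lambda>x. u x * bump (real (Suc m)) a b x) \<in> borel_measurable lborel" for m
        using test_function_measurable[OF test_function_bump[of "real (Suc m)" a b]] by simp
      show "AE x in lborel. (\<lambda>m. u x * bump (real (Suc m)) a b x) \<longlonglongrightarrow> u x * indicator (box a b) x"
        by (intro AE_I2 tendsto_mult tendsto_const LIMSEQ_Suc[OF tendsto_bump])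
      show "AE x in lborel. norm (u x * bump (real (Suc m)) a b x) \<le> \<bar>u x * indicator (box a b) x\<bar>" for m
      proof (rule AE_I2)
        fix x
        show "norm (u x * bump (real (Suc m)) a b x) \<le> \<bar>u x * indicator (box a b) x\<bar>"
          using bump_nonneg[of "real (Suc m)" a b x] bump_le_1[of "real (Suc m)" a b x]
            bump_neq_0_iff[of "real (Suc m)" a b x]
          by (cases "x \<in> box a b") (simp_all add: abs_mult mult_left_le)
      qed
    qed auto
    moreover have "(\<integral>x. u x * bump (real (Suc m)) a b x \<partial>lborel) = 0" for m
      by (intro orth test_function_bump) simp
    ultimately show ?thesis using LIMSEQ_unique[OF _ tendsto_const] by force
  qed
  \<comment> \<open>Since \<open>ennreal\<close> sends negative reals to 0, these are the measures
    with densities the positive and the negative part of \<open>u\<close>. A vanishing integral of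
    \<open>u\<close> over a box says that both give it the same finite mass; once the measures
    coincide, the two parts agree almost everywhere, which forces \<open>u = 0\<close>.\<close>
  let ?P = "density lborel (\<lambda>x. ennreal (u x))" and ?N = "density lborel (\<lambda>x. ennreal (- u x))"
  have em: "emeasure (density lborel (\<lambda>x. ennreal (w x))) (box a b) = (\<integral>\<^sup>+x. ennreal (w x * indicator (box a b) x) \<partial>lborel)"
    if [measurable]: "w \<in> borel_measurable borel" for w a b
  proof (subst emeasure_density)
    show "(\<integral>\<^sup>+x. ennreal (w x) * indicator (box a b) x \<partial>lborel) = (\<integral>\<^sup>+x. ennreal (w x * indicator (box a b) x) \<partial>lborel)"
      by (intro nn_integral_cong) (simp split: split_indicator)
  qed simp_all
  have fin: "(\<integral>\<^sup>+x. ennreal (u x * indicator (box a b) x) \<partial>lborel) \<noteq> \<infinity>"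
      "(\<integral>\<^sup>+x. ennreal (- u x * indicator (box a b) x) \<partial>lborel) \<noteq> \<infinity>" for a b
    using int[of a b] by (simp_all add: real_integrable_def)
  have box_eq: "emeasure ?P (box a b) = emeasure ?N (box a b)" for a b
  proof -
    have "enn2real (\<integral>\<^sup>+x. ennreal (u x * indicator (box a b) x) \<partial>lborel) =
        enn2real (\<integral>\<^sup>+x. ennreal (- u x * indicator (box a b) x) \<partial>lborel)"
      using zero[of a b] real_lebesgue_integral_def[OF int[of a b]] by simp
    then have "(\<integral>\<^sup>+x. ennreal (u x * indicator (box a b) x) \<partial>lborel) = (\<integral>\<^sup>+x. ennreal (- u x * indicator (box a b) x) \<partial>lborel)"
      using arg_cong[of "enn2real _" "enn2real _" ennreal] ennreal_enn2real[OF fin(1)[of a b, unfolded infinity_ennreal_def less_top]]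
        ennreal_enn2real[OF fin(2)[of a b, unfolded infinity_ennreal_def less_top]]
      by simp
    then show ?thesis by (simp add: em)
  qed
  have "?P = ?N"
  proof (rule measure_eqI_generator_eq)
    let ?E = "range (\<lambda>(a, b). box a b :: (real^'d) set)"
    show "Int_stable ?E"
    proof (rule Int_stableI)
      fix X Y assume "X \<in> ?E" "Y \<in> ?E"
      then obtain a b c d where "X = box a b" "Y = box c d" by auto
      then show "X \<inter> Y \<in> ?E" by (auto simp only: box_Int_box intro!: range_eqI[of _ _ "(_, _)"])
    qed
    have "sets (borel :: (real^'d) measure) = sigma_sets UNIV ?E"
      by (subst borel_eq_box) (rule sets_measure_of, simp)
    then show "sets ?P = sigma_sets UNIV ?E" "sets ?N = sigma_sets UNIV ?E" by simp_all
    show "?E \<subseteq> Pow UNIV" by simp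
    let ?A = "\<lambda>n::nat. box (- (real n *\<^sub>R One)) (real n *\<^sub>R One) :: (real^'d) set"
    show "range ?A \<subseteq> ?E" by auto
    show "(\<Union>i. ?A i) = UNIV" by (rule UN_box_eq_UNIV)
    show "emeasure ?P (?A i) \<noteq> \<infinity>" for i using fin by (simp add: em)
    show "\<And>X. X \<in> ?E \<Longrightarrow> emeasure ?P X = emeasure ?N X" using box_eq by auto
  qed
  then have "AE x in lborel. ennreal (u x) = ennreal (- u x)"
    by (rule sigma_finite_measure.density_unique[OF sigma_finite_lborel, rotated 2]) measurable
  then show ?thesis
  proof (rule AE_mp, intro AE_I2 impI)
    fix x assume "ennreal (u x) = ennreal (- u x)"
    then show "u x = 0"
      using ennreal_neg[of "u x"] ennreal_neg[of "- u x"] ennreal_eq_0_iff[of "u x"] ennreal_eq_0_iff[of "- u x"]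
      by (cases "u x \<le> 0") auto
  qed
qed

lemma is_weak_deriv_unique:
  assumes "is_weak_deriv \<alpha> f g" "is_weak_deriv \<alpha> f h"
  shows "AE x in lborel. g x = h x"
proof -
  have g: "locally_integrable g" and h: "locally_integrable h" using assms by (auto simp: is_weak_deriv_def)
  \<comment> \<open>Without integrability of both products the integral of \<open>(g - h)\<close>
    \<phi> could not be split into the two integrals that the hypotheses equate.\<close>
  have i: "integrable lborel (\<lambda>x. u x * \<phi> x)" if phi: "test_function \<phi>" and lu: "locally_integrable u" for u \<phi>
  proof -
    obtain R where R: "\<And>x. x \<notin> cball 0 R \<Longrightarrow> \<phi> x = 0"
      by (rule test_function_bounded_support[OF phi]) blast
    obtain B where B: "\<And>x. \<bar>\<phi> x\<bar> \<le> B"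
      by (rule test_function_bounded[OF phi]) blast
    have "integrable lborel (\<lambda>x. B * \<bar>indicator (cball 0 R) x *\<^sub>R u x\<bar>)"
      using lu by (intro integrable_mult_right integrable_abs) (simp add: locally_integrable_def set_integrable_def)
    moreover have "norm (u x * \<phi> x) \<le> norm (B * \<bar>indicator (cball 0 R) x *\<^sub>R u x\<bar>)" for x
    proof (cases "x \<in> cball 0 R")
      case True
      have "\<bar>u x\<bar> * \<bar>\<phi> x\<bar> \<le> \<bar>u x\<bar> * B" by (intro mult_left_mono B) simp
      moreover have "B \<ge> 0" using B[of x] by linarith
      ultimately show ?thesis using True by (simp add: abs_mult mult.commute)
    qed (simp add: R)
    moreover have "u \<in> borel_measurable lborel" using lu by (simp add: locally_integrable_def)
    then have "(\<lambda>x. u x * \<phi> x) \<in> borel_measurable lborel" using test_function_measurable[OF phi] by simp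
    ultimately show ?thesis
      by (blast intro: Bochner_Integration.integrable_bound AE_I2)
  qed
  have "AE x in lborel. g x - h x = 0"
  proof (rule AE_eq_0_if_orthogonal_test_functions)
    show "locally_integrable (\<lambda>x. g x - h x)"
      using g h by (auto simp: locally_integrable_def intro!: set_integral_diff)
    fix \<phi> :: "real^'a \<Rightarrow> real" assume \<phi>: "test_function \<phi>"
    have "(-1) ^ order_of \<alpha> * (\<integral>x. g x * \<phi> x \<partial>lborel) = (-1) ^ order_of \<alpha> * (\<integral>x. h x * \<phi> x \<partial>lborel)"
      using assms \<phi> by (simp add: is_weak_deriv_def)
    then show "(\<integral>x. (g x - h x) * \<phi> x \<partial>lborel) = 0"
      using i[OF \<phi> g] i[OF \<phi> h] by (simp add: left_diff_distrib)
  qed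
  then show ?thesis by simp
qed

text \<open>\<open>weak_deriv\<close> is picked by \<open>SOME\<close>, so only uniqueness ties it
  to the classical derivative. From here on Sobolev norms of test functions can be computed
  classically.\<close>

lemma AE_weak_deriv:
  assumes "test_function f"
  shows "AE x in lborel. weak_deriv \<alpha> f x = rev_deriv \<alpha> f x"
    and "weak_deriv \<alpha> f \<in> borel_measurable borel"
proof -
  have w: "is_weak_deriv \<alpha> f (weak_deriv \<alpha> f)"
    unfolding weak_deriv_def by (rule someI[where P = "is_weak_deriv \<alpha> f", OF is_weak_deriv_rev_deriv[OF assms]])
  show "AE x in lborel. weak_deriv \<alpha> f x = rev_deriv \<alpha> f x"
    by (rule is_weak_deriv_unique[OF w is_weak_deriv_rev_deriv[OF assms]])
  show "weak_deriv \<alpha> f \<in> borel_measurable borel"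
    using w by (simp add: is_weak_deriv_def locally_integrable_def)
qed

lemma test_function_in_Lp: "test_function f \<Longrightarrow> p > 0 \<Longrightarrow> in_Lp p f"
  by (simp add: in_Lp_def test_function_measurable test_function_integrable_powr)

lemma Lp_norm_weak_deriv:
  assumes "test_function f"
  shows "Lp_norm p (weak_deriv \<alpha> f) = Lp_norm p (rev_deriv \<alpha> f)"
proof -
  note [measurable] = AE_weak_deriv(2)[OF assms, of \<alpha>]
    test_function_measurable[OF test_function_rev_deriv[OF assms], of \<alpha>]
  have "(\<integral>x. \<bar>weak_deriv \<alpha> f x\<bar> powr p \<partial>lborel) = (\<integral>x. \<bar>rev_deriv \<alpha> f x\<bar> powr p \<partial>lborel)"
    by (rule integral_cong_AE) (use AE_weak_deriv(1)[OF assms, of \<alpha>] in auto)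
  then show ?thesis by (simp add: Lp_norm_def)
qed

lemma test_function_in_sobolev_space:
  assumes "test_function f" "p > 0"
  shows "f \<in> sobolev_space s p"
proof -
  have "in_Lp p (weak_deriv \<alpha> f)" for \<alpha>
  proof -
    note [measurable] = AE_weak_deriv(2)[OF assms(1), of \<alpha>]
    have "integrable lborel (\<lambda>x. \<bar>rev_deriv \<alpha> f x\<bar> powr p)"
      by (intro test_function_integrable_powr test_function_rev_deriv assms)
    then have "integrable lborel (\<lambda>x. \<bar>weak_deriv \<alpha> f x\<bar> powr p)"
      by (rule integrable_cong_AE_imp) (use AE_weak_deriv(1)[OF assms(1), of \<alpha>] in auto)
    then show ?thesis by (simp add: in_Lp_def)
  qed
  then show ?thesis
    using assms is_weak_deriv_rev_deriv[OF assms(1)] by (auto simp: sobolev_space_def test_function_in_Lp)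
qed

lemma sobolev_norm_test_function:
  assumes "test_function f"
  shows "sobolev_norm s p f = (\<Sum>\<alpha> | order_of \<alpha> \<le> s. Lp_norm p (rev_deriv \<alpha> f))"
  by (simp add: sobolev_norm_def Lp_norm_weak_deriv assms)

lemma finite_order_le: "finite {\<alpha> :: 'd::finite \<Rightarrow> nat. order_of \<alpha> \<le> s}"
proof (rule finite_subset)
  show "{\<alpha> :: 'd \<Rightarrow> nat. order_of \<alpha> \<le> s} \<subseteq> Pi\<^sub>E UNIV (\<lambda>_. {..s})"
    by (auto simp: order_of_def intro: order_trans[OF member_le_sum[of _ UNIV]])
  show "finite (Pi\<^sub>E (UNIV :: 'd set) (\<lambda>_. {..s}))" by (intro finite_PiE) auto
qed

section \<open>Testing two hypotheses\<close>

text \<open>Both measures give a rectangle the same mass, because the integral of a product of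
  functions of one coordinate each factors. With \<open>M\<close> the law of one observation and
  \<open>g\<close> a likelihood ratio, it yields the likelihood ratio of the whole sample.\<close>

lemma PiM_density:
  assumes "finite I" "prob_space M" and [measurable]: "g \<in> borel_measurable M" and "prob_space (density M g)"
  shows "PiM I (\<lambda>_. density M g) = density (PiM I (\<lambda>_. M)) (\<lambda>\<omega>. \<Prod>i\<in>I. g (\<omega> i))"
proof -
  interpret M: product_prob_space "\<lambda>_. M" I
    using assms(2) by (simp add: product_prob_space_def product_prob_space_axioms_def product_sigma_finite_def prob_space_imp_sigma_finite)
  interpret D: product_prob_space "\<lambda>_. density M g" I
    using assms(4) by (simp add: product_prob_space_def product_prob_space_axioms_def product_sigma_finite_def prob_space_imp_sigma_finite)
  show ?thesis
  proof (rule D.PiM_eqI[symmetric])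
    show "finite I" by fact
    show "sets (density (PiM I (\<lambda>_. M)) (\<lambda>\<omega>. \<Prod>i\<in>I. g (\<omega> i))) = sets (PiM I (\<lambda>_. density M g))"
      by (simp cong: sets_PiM_cong)
    fix A assume A: "\<And>i. i \<in> I \<Longrightarrow> A i \<in> sets (density M g)"
    have [measurable]: "Pi\<^sub>E I A \<in> sets (PiM I (\<lambda>_. M))"
      using A assms(1) by (intro sets_PiM_I_finite) auto
    have "emeasure (density (PiM I (\<lambda>_. M)) (\<lambda>\<omega>. \<Prod>i\<in>I. g (\<omega> i))) (Pi\<^sub>E I A) =
        (\<integral>\<^sup>+\<omega>. (\<Prod>i\<in>I. g (\<omega> i)) * indicator (Pi\<^sub>E I A) \<omega> \<partial>PiM I (\<lambda>_. M))"
      by (subst emeasure_density) auto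
    also have "\<dots> = (\<integral>\<^sup>+\<omega>. (\<Prod>i\<in>I. g (\<omega> i) * indicator (A i) (\<omega> i)) \<partial>PiM I (\<lambda>_. M))"
    proof (rule nn_integral_cong)
      fix \<omega> assume \<omega>: "\<omega> \<in> space (PiM I (\<lambda>_. M))"
      then have "\<omega> \<in> extensional I" by (auto simp: space_PiM PiE_def)
      \<comment> \<open>Membership in \<open>Pi\<^sub>E\<close> also asks for extensionality, which
        the product of indicators does not see; it comes from \<omega> being a point of the product
        space.\<close>
      then have "indicator (Pi\<^sub>E I A) \<omega> = (\<Prod>i\<in>I. indicator (A i) (\<omega> i) :: ennreal)"
        using assms(1) by (auto simp: indicator_def PiE_def Pi_def prod_zero_iff)
      then show "(\<Prod>i\<in>I. g (\<omega> i)) * indicator (Pi\<^sub>E I A) \<omega> = (\<Prod>i\<in>I. g (\<omega> i) * indicator (A i) (\<omega> i))"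
        by (simp add: prod.distrib)
    qed
    also have "\<dots> = (\<Prod>i\<in>I. \<integral>\<^sup>+x. g x * indicator (A i) x \<partial>M)"
      using A by (intro M.product_nn_integral_prod assms(1)) auto
    also have "\<dots> = (\<Prod>i\<in>I. emeasure (density M g) (A i))"
      using A by (intro prod.cong refl) (auto simp: emeasure_density)
    finally show "emeasure (density (PiM I (\<lambda>_. M)) (\<lambda>\<omega>. \<Prod>i\<in>I. g (\<omega> i))) (Pi\<^sub>E I A) =
        (\<Prod>i\<in>I. emeasure (density M g) (A i))" .
  qed
qed

text \<open>Le Cam's two-point bound.  It rests on \<open>min 1 L \<ge> L - L\<^sup>2/2\<close>.\<close>

lemma two_point:
  fixes L :: "'a \<Rightarrow> real" and a b :: "'a \<Rightarrow> ennreal"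
  assumes [measurable]: "L \<in> borel_measurable P" "a \<in> borel_measurable P" "b \<in> borel_measurable P"
    and L: "\<And>\<omega>. L \<omega> \<ge> 0" "(\<integral>\<^sup>+\<omega>. ennreal (L \<omega>) \<partial>P) = 1"
    and sq: "(\<integral>\<^sup>+\<omega>. ennreal ((L \<omega>)\<^sup>2) \<partial>P) \<le> ennreal (3 / 2)"
    and ab: "\<And>\<omega>. \<omega> \<in> space P \<Longrightarrow> \<delta> \<le> a \<omega> + b \<omega>"
  shows "\<delta> * ennreal (1 / 4) \<le> (\<integral>\<^sup>+\<omega>. a \<omega> \<partial>P) + (\<integral>\<^sup>+\<omega>. b \<omega> \<partial>density P (\<lambda>\<omega>. ennreal (L \<omega>)))"
proof -
  \<comment> \<open>\<open>m\<close> is the density with respect to \<open>P\<close> of the minimum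
    of the two laws. Its integral is their common mass, on which no procedure can tell them
    apart.\<close>
  define m where "m \<omega> = ennreal (min 1 (L \<omega>))" for \<omega>
  have [measurable]: "m \<in> borel_measurable P" unfolding m_def by measurable
  have pw: "ennreal (L \<omega>) \<le> m \<omega> + ennreal (1 / 2) * ennreal ((L \<omega>)\<^sup>2)" for \<omega>
  proof -
    have "L \<omega> \<le> min 1 (L \<omega>) + 1 / 2 * (L \<omega>)\<^sup>2"
      using zero_le_power2[of "L \<omega> - 1"] by (auto simp: min_def power2_diff)
    then have "ennreal (L \<omega>) \<le> ennreal (min 1 (L \<omega>) + 1 / 2 * (L \<omega>)\<^sup>2)"
      by (rule ennreal_leI)
    also have "\<dots> = m \<omega> + ennreal (1 / 2 * (L \<omega>)\<^sup>2)"
      unfolding m_def using L(1)[of \<omega>] by (intro ennreal_plus) auto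
    also have "ennreal (1 / 2 * (L \<omega>)\<^sup>2) = ennreal (1 / 2) * ennreal ((L \<omega>)\<^sup>2)"
      by (intro ennreal_mult) auto
    finally show ?thesis .
  qed
  have "1 \<le> (\<integral>\<^sup>+\<omega>. m \<omega> + ennreal (1 / 2) * ennreal ((L \<omega>)\<^sup>2) \<partial>P)"
    unfolding L(2)[symmetric] by (intro nn_integral_mono pw)
  also have "\<dots> = (\<integral>\<^sup>+\<omega>. m \<omega> \<partial>P) + ennreal (1 / 2) * (\<integral>\<^sup>+\<omega>. ennreal ((L \<omega>)\<^sup>2) \<partial>P)"
    by (subst nn_integral_add) (auto simp: nn_integral_cmult)
  also have "\<dots> \<le> (\<integral>\<^sup>+\<omega>. m \<omega> \<partial>P) + ennreal (1 / 2) * ennreal (3 / 2)"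
    by (intro add_left_mono mult_left_mono sq) simp
  also have "ennreal (1 / 2) * ennreal (3 / 2) = ennreal (3 / 4)"
    by (subst ennreal_mult[symmetric]) auto
  \<comment> \<open>The bound 3/2 on the second moment leaves a common mass of at least 1 - 3/4 =
    1/4.\<close>
  finally have *: "1 \<le> (\<integral>\<^sup>+\<omega>. m \<omega> \<partial>P) + ennreal (3 / 4)" .
  have "1 = ennreal (3 / 4) + ennreal (1 / 4)"
    by (subst ennreal_plus[symmetric]) auto
  with * have "ennreal (3 / 4) + ennreal (1 / 4) \<le> ennreal (3 / 4) + (\<integral>\<^sup>+\<omega>. m \<omega> \<partial>P)"
    by (simp only: add.commute)
  then have m: "ennreal (1 / 4) \<le> (\<integral>\<^sup>+\<omega>. m \<omega> \<partial>P)"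
    by (simp only: ennreal_add_left_cancel_le) simp
  have "\<delta> * ennreal (1 / 4) \<le> \<delta> * (\<integral>\<^sup>+\<omega>. m \<omega> \<partial>P)" by (intro mult_left_mono m) simp
  also have "\<dots> = (\<integral>\<^sup>+\<omega>. \<delta> * m \<omega> \<partial>P)" by (simp add: nn_integral_cmult)
  also have "\<dots> \<le> (\<integral>\<^sup>+\<omega>. a \<omega> + ennreal (L \<omega>) * b \<omega> \<partial>P)"
  proof (intro nn_integral_mono)
    fix \<omega> assume \<omega>: "\<omega> \<in> space P"
    have "m \<omega> \<le> 1" "m \<omega> \<le> ennreal (L \<omega>)" by (auto simp: m_def intro: ennreal_leI)
    then have "m \<omega> * a \<omega> + m \<omega> * b \<omega> \<le> 1 * a \<omega> + ennreal (L \<omega>) * b \<omega>"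
      by (intro add_mono mult_right_mono) auto
    moreover have "\<delta> * m \<omega> \<le> m \<omega> * (a \<omega> + b \<omega>)"
      using mult_left_mono[OF ab[OF \<omega>], of "m \<omega>"] by (simp add: mult.commute)
    ultimately show "\<delta> * m \<omega> \<le> a \<omega> + ennreal (L \<omega>) * b \<omega>"
      by (simp add: distrib_left)
  qed
  also have "\<dots> = (\<integral>\<^sup>+\<omega>. a \<omega> \<partial>P) + (\<integral>\<^sup>+\<omega>. b \<omega> \<partial>density P (\<lambda>\<omega>. ennreal (L \<omega>)))"
    by (simp add: nn_integral_add nn_integral_density)
  finally show ?thesis .
qed

section \<open>Likelihood ratios of samples\<close>

lemma prob_space_density_lborel:
  fixes f :: "'a::euclidean_space \<Rightarrow> real"
  assumes "integrable lborel f" "\<And>x. f x \<ge> 0" "(\<integral>x. f x \<partial>lborel) = 1"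
  shows "prob_space (density lborel (\<lambda>x. ennreal (f x)))"
  using assms by (intro prob_spaceI) (simp add: emeasure_density nn_integral_eq_integral)

lemma sets_sample_measure: "sets (sample_measure n f) = sets (\<Pi>\<^sub>M i\<in>{..<n}. lborel)"
  unfolding sample_measure_def by (rule sets_PiM_cong) auto

text \<open>The second moment of the likelihood ratio is \<open>(1 + \<chi>\<^sup>2)\<^sup>n\<close>, where \<open>\<chi>\<^sup>2 = \<integral>g\<^sup>2/f\<close>.\<close>

lemma sample_two_point:
  fixes f g :: "real^'d::finite \<Rightarrow> real"
  assumes f: "integrable lborel f" "\<And>x. f x \<ge> 0" "(\<integral>x. f x \<partial>lborel) = 1"
    and g: "integrable lborel g" "(\<integral>x. g x \<partial>lborel) = 0" "integrable lborel (\<lambda>x. (g x)\<^sup>2)"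
    and fg: "\<And>x. f x + g x \<ge> 0" and \<kappa>: "\<kappa> > 0" "\<And>x. g x \<noteq> 0 \<Longrightarrow> \<kappa> \<le> f x"
    and n: "real n * ((\<integral>x. (g x)\<^sup>2 \<partial>lborel) / \<kappa>) \<le> 1 / 4"
    and meas: "a \<in> borel_measurable (\<Pi>\<^sub>M i\<in>{..<n}. lborel)" "b \<in> borel_measurable (\<Pi>\<^sub>M i\<in>{..<n}. lborel)"
    and ab: "\<And>\<omega>. \<omega> \<in> space (\<Pi>\<^sub>M i\<in>{..<n}. lborel) \<Longrightarrow> \<delta> \<le> a \<omega> + b \<omega>"
  shows "\<delta> * ennreal (1 / 4) \<le> (\<integral>\<^sup>+\<omega>. a \<omega> \<partial>sample_measure n f) + (\<integral>\<^sup>+\<omega>. b \<omega> \<partial>sample_measure n (\<lambda>x. f x + g x))"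
proof -
  define l where "l x = (f x + g x) / f x" for x
  define L where "L \<omega> = (\<Prod>i<n. l (\<omega> i))" for \<omega> :: "nat \<Rightarrow> real^'d"
  define V where "V = (\<integral>x. (g x)\<^sup>2 \<partial>lborel) / \<kappa>"
  let ?M = "density lborel (\<lambda>x. ennreal (f x))"
  have [measurable]: "f \<in> borel_measurable borel" "g \<in> borel_measurable borel"
    using f(1) g(1) by auto
  have [measurable]: "l \<in> borel_measurable borel" unfolding l_def by measurable
  have l0: "l x \<ge> 0" for x unfolding l_def using f(2) fg by simp
  \<comment> \<open>Where \<open>f\<close> vanishes the quotient \<open>l\<close> has the default
    value 0. The floor \<kappa> makes \<open>g\<close> vanish there too, so that
    \<open>f * l = f + g\<close> holds everywhere.\<close>
  have g0: "g x = 0" if "f x = 0" for x using \<kappa>(2)[of x] \<kappa>(1) that by force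
  have fl: "f x * l x = f x + g x" for x using g0[of x] by (simp add: l_def)
  have pf: "prob_space ?M" by (rule prob_space_density_lborel) (fact f)+
  have pfg: "prob_space (density lborel (\<lambda>x. ennreal (f x + g x)))"
    using f g fg by (intro prob_space_density_lborel) auto
  have dens: "density lborel (\<lambda>x. ennreal (f x + g x)) = density ?M (\<lambda>x. ennreal (l x))"
    by (subst density_density_eq) (auto simp: fl[symmetric] ennreal_mult f(2) l0)
  have sample: "sample_measure n (\<lambda>x. f x + g x) = density (sample_measure n f) (\<lambda>\<omega>. ennreal (L \<omega>))"
    unfolding sample_measure_def dens L_def
    using PiM_density[OF _ pf, of "{..<n}" "\<lambda>x. ennreal (l x)"] pfg
    by (simp add: dens prod_ennreal l0)
  interpret M: product_prob_space "\<lambda>_. ?M" "{..<n}"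
    using pf by (simp add: product_prob_space_def product_prob_space_axioms_def product_sigma_finite_def prob_space_imp_sigma_finite)
  interpret S: prob_space "sample_measure n (\<lambda>x. f x + g x)"
    unfolding sample_measure_def using pfg by (intro prob_space_PiM)
  have Lm: "L \<in> borel_measurable (sample_measure n f)"
    unfolding L_def sample_measure_def by measurable
  have sets: "a \<in> borel_measurable (sample_measure n f)" "b \<in> borel_measurable (sample_measure n f)"
    using meas by (simp_all cong: measurable_cong_sets add: sets_sample_measure)
  have L0: "L \<omega> \<ge> 0" for \<omega> unfolding L_def by (intro prod_nonneg l0 ballI)
  have L1: "(\<integral>\<^sup>+\<omega>. ennreal (L \<omega>) \<partial>sample_measure n f) = 1"
  proof -
    have "emeasure (sample_measure n (\<lambda>x. f x + g x)) (space (sample_measure n f)) = 1"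
      using S.emeasure_space_1 by (simp add: sample)
    then show ?thesis using Lm by (simp add: sample emeasure_density nn_integral_set_ennreal cong: nn_integral_cong)
  qed
  have V0: "V \<ge> 0" using \<kappa>(1) by (simp add: V_def)
  \<comment> \<open>Expand \<open>f * l^2\<close> as \<open>f + 2 g + g^2 / f\<close>. The first two
    terms integrate to 1 and 0, and the floor \<kappa> under \<open>f\<close> where \<open>g\<close>
    is nonzero bounds the chi-square term by \<open>V\<close>.\<close>
  have one: "(\<integral>\<^sup>+x. ennreal ((l x)\<^sup>2) \<partial>?M) \<le> ennreal (1 + V)"
  proof -
    have "(\<integral>\<^sup>+x. ennreal ((l x)\<^sup>2) \<partial>?M) = (\<integral>\<^sup>+x. ennreal (f x * (l x)\<^sup>2) \<partial>lborel)"
      by (simp add: nn_integral_density ennreal_mult f(2))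
    also have "\<dots> \<le> (\<integral>\<^sup>+x. ennreal (f x + 2 * g x + (g x)\<^sup>2 / \<kappa>) \<partial>lborel)"
    proof (intro nn_integral_mono ennreal_leI)
      fix x
      show "f x * (l x)\<^sup>2 \<le> f x + 2 * g x + (g x)\<^sup>2 / \<kappa>"
      proof (cases "g x = 0")
        case True then show ?thesis by (auto simp: l_def f(2))
      next
        case False
        then have fx: "\<kappa> \<le> f x" "f x > 0" using \<kappa> by (auto intro: less_le_trans)
        have "f x * (l x)\<^sup>2 = f x + 2 * g x + (g x)\<^sup>2 / f x"
          using fx by (simp add: l_def field_simps power2_eq_square)
        moreover have "(g x)\<^sup>2 / f x \<le> (g x)\<^sup>2 / \<kappa>"
          using fx \<kappa>(1) by (intro divide_left_mono) auto
        ultimately show ?thesis by simp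
      qed
    qed
    also have "\<dots> = ennreal (\<integral>x. f x + 2 * g x + (g x)\<^sup>2 / \<kappa> \<partial>lborel)"
    proof (rule nn_integral_eq_integral)
      show "integrable lborel (\<lambda>x. f x + 2 * g x + (g x)\<^sup>2 / \<kappa>)"
        using f g by auto
      \<comment> \<open>Completing the square: with \<open>f\<close> replaced by its floor \<kappa>,
        the expression is \<open>(\<kappa> + g)^2 / \<kappa>\<close>.\<close>
      have "0 \<le> f x + 2 * g x + (g x)\<^sup>2 / \<kappa>" for x
      proof (cases "g x = 0")
        case False
        then have fx: "\<kappa> \<le> f x" using \<kappa> by auto
        have "0 \<le> (\<kappa> + g x)\<^sup>2 / \<kappa>" using \<kappa>(1) by simp
        also have "\<dots> = \<kappa> + 2 * g x + (g x)\<^sup>2 / \<kappa>" using \<kappa>(1) by (simp add: field_simps power2_eq_square)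
        finally show ?thesis using fx by simp
      qed (simp add: f(2))
      then show "AE x in lborel. 0 \<le> f x + 2 * g x + (g x)\<^sup>2 / \<kappa>" by simp
    qed
    also have "(\<integral>x. f x + 2 * g x + (g x)\<^sup>2 / \<kappa> \<partial>lborel) = 1 + V"
      using f g by (simp add: V_def)
    finally show ?thesis .
  qed
  have sq: "(\<integral>\<^sup>+\<omega>. ennreal ((L \<omega>)\<^sup>2) \<partial>sample_measure n f) \<le> ennreal (3 / 2)"
  proof -
    have "(\<integral>\<^sup>+\<omega>. ennreal ((L \<omega>)\<^sup>2) \<partial>sample_measure n f) = (\<integral>\<^sup>+\<omega>. (\<Prod>i<n. ennreal ((l (\<omega> i))\<^sup>2)) \<partial>sample_measure n f)"
      by (simp add: L_def prod_power_distrib prod_ennreal)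
    also have "\<dots> = (\<Prod>i<n. \<integral>\<^sup>+x. ennreal ((l x)\<^sup>2) \<partial>?M)"
      unfolding sample_measure_def by (intro M.product_nn_integral_prod) auto
    also have "\<dots> \<le> ennreal (1 + V) ^ n"
      using one by (simp add: power_mono)
    also have "\<dots> = ennreal ((1 + V) ^ n)" using V0 by (intro ennreal_power) simp
    also have "\<dots> \<le> ennreal (exp V ^ n)"
      using V0 by (intro ennreal_leI power_mono exp_ge_add_one_self) auto
    also have "exp V ^ n = exp (real n * V)" by (simp add: exp_of_nat_mult)
    also have "\<dots> \<le> ennreal (3 / 2)"
    proof (rule ennreal_leI)
      \<comment> \<open>The origin of the threshold 1/4: it gives \<open>exp (1/4)\<close> at most 1
        + 1/4 + 1/16, which is below the 3/2 that the two-point bound tolerates.\<close>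
      have nV: "0 \<le> real n * V" "real n * V \<le> 1 / 4" using V0 n[folded V_def] by simp_all
      then have "exp (real n * V) \<le> 1 + real n * V + (real n * V)\<^sup>2" by (intro exp_bound) auto
      also have "(real n * V)\<^sup>2 \<le> (1 / 4)\<^sup>2" using nV by (intro power_mono)
      finally show "exp (real n * V) \<le> 3 / 2" using nV by (simp add: power2_eq_square)
    qed
    finally show ?thesis .
  qed
  have "\<delta> \<le> a \<omega> + b \<omega>" if "\<omega> \<in> space (sample_measure n f)" for \<omega>
    using that ab by (simp add: sets_eq_imp_space_eq[OF sets_sample_measure])
  then show ?thesis unfolding sample by (rule two_point[OF Lm sets L0 L1 sq])
qed

text \<open>Convexity of the power function at the midpoint of \<open>\<bar>a\<bar>\<close> and
  \<open>\<bar>b\<bar>\<close>; if one of them is 0, it is enough that \<open>2 powr (p - 1)\<close>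
  is at least 1.\<close>

lemma abs_add_powr_le:
  fixes a b p :: real
  assumes "p \<ge> 1"
  shows "\<bar>a + b\<bar> powr p \<le> 2 powr (p - 1) * (\<bar>a\<bar> powr p + \<bar>b\<bar> powr p)"
proof (cases "a = 0 \<or> b = 0")
  case True
  have "x \<le> 2 powr (p - 1) * x" if "x \<ge> 0" for x :: real
    using mult_right_mono[of 1 "2 powr (p - 1)" x] that assms ge_one_powr_ge_zero[of 2 "p - 1"] by simp
  with True assms show ?thesis by auto
next
  case False
  have "\<bar>a + b\<bar> powr p \<le> (\<bar>a\<bar> + \<bar>b\<bar>) powr p"
    using assms by (intro powr_mono2) auto
  also have "\<bar>a\<bar> + \<bar>b\<bar> = 2 * ((1 - 1 / 2) *\<^sub>R \<bar>a\<bar> + (1 / 2) *\<^sub>R \<bar>b\<bar>)" by simp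
  also have "\<dots> powr p = 2 powr p * ((1 - 1 / 2) *\<^sub>R \<bar>a\<bar> + (1 / 2) *\<^sub>R \<bar>b\<bar>) powr p"
    by (rule powr_mult)
  also have "\<dots> \<le> 2 powr p * ((1 - 1 / 2) * \<bar>a\<bar> powr p + (1 / 2) * \<bar>b\<bar> powr p)"
    by (intro mult_left_mono convex_onD[OF powr_convex[OF assms]]) (use False in auto)
  finally show ?thesis by (simp add: powr_diff field_simps)
qed

section \<open>Assouad's lemma\<close>

text \<open>The pairing in Assouad's argument: each hypothesis without cell \<open>k\<close> is
  matched with the one that differs from it by switching on \<open>k\<close>.\<close>

lemma sum_Pow_split:
  fixes B :: "'k set \<Rightarrow> 'a::comm_monoid_add"
  assumes "finite K" "k \<in> K"
  shows "(\<Sum>e\<in>Pow K. B e) = (\<Sum>e\<in>Pow (K - {k}). B e + B (insert k e))"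
proof -
  have "Pow K = Pow (K - {k}) \<union> insert k ` Pow (K - {k})"
    using Pow_insert[of k "K - {k}"] assms(2) by (simp add: insert_absorb)
  moreover have "inj_on (insert k) (Pow (K - {k}))"
  proof (rule inj_onI)
    fix X Y assume "X \<in> Pow (K - {k})" "Y \<in> Pow (K - {k})" "insert k X = insert k Y"
    then show "X = Y" by blast
  qed
  moreover have "Pow (K - {k}) \<inter> insert k ` Pow (K - {k}) = {}" by blast
  moreover have "finite (Pow (K - {k}))" using assms(1) by simp
  ultimately show ?thesis
    by (simp add: sum.union_disjoint sum.reindex sum.distrib)
qed

text \<open>The supremum of the risk is bounded below by its average over all \<epsilon>. The loss
  splits over the disjoint supports of the \<open>g k\<close>, and for each \<open>k\<close> the
  hypotheses are paired so that only \<open>g k\<close> separates them. An estimator close to one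
  member of a pair on the support of \<open>g k\<close> is far from the other, and the two-point
  bound applies. In the constant, \<open>2 powr (1 - p)\<close> comes from convexity, 1/4 from the
  two-point bound, and a further 1/2 from there being half as many pairs as hypotheses.\<close>

lemma assouad:
  fixes f0 :: "real^'d::finite \<Rightarrow> real" and g :: "'k \<Rightarrow> real^'d \<Rightarrow> real"
  defines "f \<epsilon> x \<equiv> f0 x + (\<Sum>k\<in>\<epsilon>. g k x)"
  assumes K: "finite K" and p: "p \<ge> 1" and F: "\<And>\<epsilon>. \<epsilon> \<subseteq> K \<Longrightarrow> f \<epsilon> \<in> F"
    and f0: "integrable lborel f0" "(\<integral>x. f0 x \<partial>lborel) = 1"
    and g: "\<And>k. k \<in> K \<Longrightarrow> integrable lborel (g k)" "\<And>k. k \<in> K \<Longrightarrow> (\<integral>x. g k x \<partial>lborel) = 0"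
      "\<And>k. k \<in> K \<Longrightarrow> integrable lborel (\<lambda>x. (g k x)\<^sup>2)"
    and nonneg: "\<And>\<epsilon> x. \<epsilon> \<subseteq> K \<Longrightarrow> 0 \<le> f \<epsilon> x"
    and disj: "\<And>j k x. j \<in> K \<Longrightarrow> k \<in> K \<Longrightarrow> j \<noteq> k \<Longrightarrow> g j x \<noteq> 0 \<Longrightarrow> g k x = 0"
    and \<kappa>: "\<kappa> > 0" "\<And>k x. k \<in> K \<Longrightarrow> g k x \<noteq> 0 \<Longrightarrow> \<kappa> \<le> f0 x"
    and n: "\<And>k. k \<in> K \<Longrightarrow> real n * ((\<integral>x. (g k x)\<^sup>2 \<partial>lborel) / \<kappa>) \<le> 1 / 4"
    and \<Delta>: "\<Delta> \<ge> 0" "\<And>k. k \<in> K \<Longrightarrow> ennreal \<Delta> \<le> (\<integral>\<^sup>+x. ennreal (\<bar>g k x\<bar> powr p) \<partial>lborel)"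
  shows "ennreal (real (card K) * \<Delta> * 2 powr (- p) / 4) \<le> minimax_risk n p F"
  unfolding minimax_risk_def
proof (rule INF_greatest)
  fix T :: "(nat \<Rightarrow> real^'d) \<Rightarrow> real^'d \<Rightarrow> real" assume "T \<in> estimators n"
  then have T [measurable]: "(\<lambda>(\<omega>, x). T \<omega> x) \<in> borel_measurable ((\<Pi>\<^sub>M i\<in>{..<n}. lborel) \<Otimes>\<^sub>M lborel)"
    by (simp add: estimators_def)
  define S where "S = (SUP f\<in>F. Lp_risk n p T f)"
  \<comment> \<open>The loss is restricted to the support of \<open>g k\<close>, so that the losses
    of different cells can be added without counting any point twice.\<close>
  define a where "a k \<epsilon> \<omega> = (\<integral>\<^sup>+x. ennreal (\<bar>T \<omega> x - f \<epsilon> x\<bar> powr p) * indicator {x. g k x \<noteq> 0} x \<partial>lborel)" for k \<epsilon> \<omega>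
  define A where "A k \<epsilon> = (\<integral>\<^sup>+\<omega>. a k \<epsilon> \<omega> \<partial>sample_measure n (f \<epsilon>))" for k \<epsilon>
  define \<delta> where "\<delta> = ennreal (2 powr (1 - p) * \<Delta>)"
  have gm [measurable]: "g k \<in> borel_measurable borel" if "k \<in> K" for k using g(1)[OF that] by auto
  have fm [measurable]: "f \<epsilon> \<in> borel_measurable borel" if "\<epsilon> \<subseteq> K" for \<epsilon>
  proof -
    have "f0 \<in> borel_measurable borel" using f0(1) by auto
    moreover have "(\<lambda>x. \<Sum>k\<in>\<epsilon>. g k x) \<in> borel_measurable borel"
      using that by (intro borel_measurable_sum gm) auto
    ultimately show ?thesis unfolding f_def by simp
  qed
  have am: "a k \<epsilon> \<in> borel_measurable (\<Pi>\<^sub>M i\<in>{..<n}. lborel)" if k: "k \<in> K" and \<epsilon>: "\<epsilon> \<subseteq> K" for k \<epsilon>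
  proof -
    have [measurable]: "g k \<in> borel_measurable borel" "f \<epsilon> \<in> borel_measurable borel"
      using k \<epsilon> by (simp_all add: gm fm)
    have "(\<lambda>z. ennreal (\<bar>(case z of (\<omega>, x) \<Rightarrow> T \<omega> x) - f \<epsilon> (snd z)\<bar> powr p) * indicator {x. g k x \<noteq> 0} (snd z))
      \<in> borel_measurable ((\<Pi>\<^sub>M i\<in>{..<n}. lborel) \<Otimes>\<^sub>M lborel)"
      by measurable
    then have "(\<lambda>(\<omega>, x). ennreal (\<bar>T \<omega> x - f \<epsilon> x\<bar> powr p) * indicator {x. g k x \<noteq> 0} x)
      \<in> borel_measurable ((\<Pi>\<^sub>M i\<in>{..<n}. lborel) \<Otimes>\<^sub>M lborel)"
      by (simp add: case_prod_beta)
    then show ?thesis unfolding a_def by (rule lborel.borel_measurable_nn_integral)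
  qed
  have f_ins: "f (insert k \<epsilon>) x = f \<epsilon> x + g k x" if "\<epsilon> \<subseteq> K - {k}" for k \<epsilon> x
  proof -
    have "finite \<epsilon>" "k \<notin> \<epsilon>" using that K by (auto intro: finite_subset)
    then show ?thesis by (simp add: f_def)
  qed
  have sep: "\<delta> \<le> a k \<epsilon> \<omega> + a k (insert k \<epsilon>) \<omega>" if k: "k \<in> K" and \<epsilon>: "\<epsilon> \<subseteq> K - {k}" and \<omega>: "\<omega> \<in> space (\<Pi>\<^sub>M i\<in>{..<n}. lborel)" for k \<epsilon> \<omega>
  proof -
    have \<epsilon>': "\<epsilon> \<subseteq> K" "insert k \<epsilon> \<subseteq> K" using k \<epsilon> by auto
    have [measurable]: "g k \<in> borel_measurable borel" "f \<epsilon> \<in> borel_measurable borel" "f (insert k \<epsilon>) \<in> borel_measurable borel"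
      using k \<epsilon>' by (simp_all add: gm fm)
    have [measurable]: "T \<omega> \<in> borel_measurable borel"
      using measurable_Pair2[OF T \<omega>] by simp
    have "\<delta> \<le> ennreal (2 powr (1 - p)) * (\<integral>\<^sup>+x. ennreal (\<bar>g k x\<bar> powr p) \<partial>lborel)"
      unfolding \<delta>_def using \<Delta> k by (simp add: ennreal_mult mult_left_mono)
    also have "\<dots> = (\<integral>\<^sup>+x. ennreal (2 powr (1 - p)) * ennreal (\<bar>g k x\<bar> powr p) \<partial>lborel)"
      by (simp add: nn_integral_cmult)
    also have "\<dots> \<le> (\<integral>\<^sup>+x. ennreal (\<bar>T \<omega> x - f \<epsilon> x\<bar> powr p) * indicator {x. g k x \<noteq> 0} x
        + ennreal (\<bar>T \<omega> x - f (insert k \<epsilon>) x\<bar> powr p) * indicator {x. g k x \<noteq> 0} x \<partial>lborel)"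
    proof (intro nn_integral_mono)
      fix x
      show "ennreal (2 powr (1 - p)) * ennreal (\<bar>g k x\<bar> powr p) \<le>
          ennreal (\<bar>T \<omega> x - f \<epsilon> x\<bar> powr p) * indicator {x. g k x \<noteq> 0} x
        + ennreal (\<bar>T \<omega> x - f (insert k \<epsilon>) x\<bar> powr p) * indicator {x. g k x \<noteq> 0} x"
      proof (cases "g k x = 0")
        case True then show ?thesis using p by simp
      next
        case False
        let ?u = "T \<omega> x - f \<epsilon> x" and ?v = "T \<omega> x - f (insert k \<epsilon>) x"
        have "\<bar>g k x\<bar> powr p = \<bar>?u + - ?v\<bar> powr p" using f_ins[OF \<epsilon>, of x] by simp
        also have "\<dots> \<le> 2 powr (p - 1) * (\<bar>?u\<bar> powr p + \<bar>- ?v\<bar> powr p)" by (rule abs_add_powr_le[OF p])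
        finally have "\<bar>g k x\<bar> powr p \<le> 2 powr (p - 1) * (\<bar>?u\<bar> powr p + \<bar>?v\<bar> powr p)"
          by (simp only: abs_minus_cancel)
        then have "2 powr (1 - p) * \<bar>g k x\<bar> powr p \<le> 2 powr (1 - p) * (2 powr (p - 1) * (\<bar>?u\<bar> powr p + \<bar>?v\<bar> powr p))"
          by (intro mult_left_mono) auto
        also have "\<dots> = (2 powr (1 - p) * 2 powr (p - 1)) * (\<bar>?u\<bar> powr p + \<bar>?v\<bar> powr p)" by simp
        also have "2 powr (1 - p) * 2 powr (p - 1) = (1 :: real)" by (simp add: powr_add[symmetric])
        finally have "ennreal (2 powr (1 - p) * \<bar>g k x\<bar> powr p) \<le> ennreal (\<bar>?u\<bar> powr p + \<bar>?v\<bar> powr p)"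
          by (intro ennreal_leI) simp
        then show ?thesis using False by (simp add: ennreal_mult)
      qed
    qed
    also have "\<dots> = a k \<epsilon> \<omega> + a k (insert k \<epsilon>) \<omega>"
      unfolding a_def by (rule nn_integral_add) auto
    finally show ?thesis .
  qed
  have pair: "\<delta> * ennreal (1 / 4) \<le> A k \<epsilon> + A k (insert k \<epsilon>)" if k: "k \<in> K" and \<epsilon>: "\<epsilon> \<subseteq> K - {k}" for k \<epsilon>
  proof -
    have \<epsilon>': "\<epsilon> \<subseteq> K" "insert k \<epsilon> \<subseteq> K" using k \<epsilon> by auto
    have fins: "f (insert k \<epsilon>) = (\<lambda>x. f \<epsilon> x + g k x)" using f_ins[OF \<epsilon>] by blast
    have int: "integrable lborel (f \<epsilon>)" unfolding f_def
      using \<epsilon>' by (intro Bochner_Integration.integrable_add f0 Bochner_Integration.integrable_sum g) auto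
    have int1: "(\<integral>x. f \<epsilon> x \<partial>lborel) = 1"
    proof -
      have "(\<integral>x. f \<epsilon> x \<partial>lborel) = (\<integral>x. f0 x \<partial>lborel) + (\<Sum>j\<in>\<epsilon>. \<integral>x. g j x \<partial>lborel)"
        unfolding f_def using \<epsilon>'
        by (subst Bochner_Integration.integral_add)
          (auto intro!: f0 Bochner_Integration.integrable_sum Bochner_Integration.integral_sum g)
      also have "(\<Sum>j\<in>\<epsilon>. \<integral>x. g j x \<partial>lborel) = 0"
        using \<epsilon>' g(2) by (intro sum.neutral) auto
      finally show ?thesis using f0(2) by simp
    qed
    have "\<delta> * ennreal (1 / 4) \<le> (\<integral>\<^sup>+\<omega>. a k \<epsilon> \<omega> \<partial>sample_measure n (f \<epsilon>)) +
        (\<integral>\<^sup>+\<omega>. a k (insert k \<epsilon>) \<omega> \<partial>sample_measure n (\<lambda>x. f \<epsilon> x + g k x))"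
    proof (rule sample_two_point[OF int _ int1 g[OF k] _ \<kappa>(1) _ n[OF k] am[OF k \<epsilon>'(1)] am[OF k \<epsilon>'(2)]])
      show "f \<epsilon> x \<ge> 0" for x using nonneg \<epsilon>'(1) .
      show "f \<epsilon> x + g k x \<ge> 0" for x using nonneg[OF \<epsilon>'(2), of x] by (simp add: fins)
      \<comment> \<open>On the support of \<open>g k\<close> all other perturbations vanish and
        \<open>k\<close> is not in \<epsilon>, so the hypothesis equals \<open>f0\<close> there and
        inherits its floor.\<close>
      show "\<kappa> \<le> f \<epsilon> x" if "g k x \<noteq> 0" for x
      proof -
        have "g j x = 0" if "j \<in> \<epsilon>" for j
          using disj[of k j x] k \<epsilon> that \<open>g k x \<noteq> 0\<close> by auto
        then show ?thesis using \<kappa>(2)[OF k that] by (simp add: f_def)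
      qed
    qed (use sep[OF k \<epsilon>] in \<open>simp_all\<close>)
    then show ?thesis by (simp add: A_def fins)
  qed
  have risk: "(\<Sum>k\<in>K. A k \<epsilon>) \<le> S" if \<epsilon>: "\<epsilon> \<subseteq> K" for \<epsilon>
  proof -
    have "(\<Sum>k\<in>K. A k \<epsilon>) = (\<integral>\<^sup>+\<omega>. (\<Sum>k\<in>K. a k \<epsilon> \<omega>) \<partial>sample_measure n (f \<epsilon>))"
      unfolding A_def using am \<epsilon>
      by (intro nn_integral_sum[symmetric]) (simp cong: measurable_cong_sets add: sets_sample_measure)
    also have "\<dots> \<le> (\<integral>\<^sup>+\<omega>. (\<integral>\<^sup>+x. ennreal (\<bar>T \<omega> x - f \<epsilon> x\<bar> powr p) \<partial>lborel) \<partial>sample_measure n (f \<epsilon>))"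
    proof (rule nn_integral_mono)
      fix \<omega> assume "\<omega> \<in> space (sample_measure n (f \<epsilon>))"
      then have \<omega>: "\<omega> \<in> space (\<Pi>\<^sub>M i\<in>{..<n}. lborel)"
        using sets_eq_imp_space_eq[OF sets_sample_measure] by metis
      have [measurable]: "T \<omega> \<in> borel_measurable borel" "f \<epsilon> \<in> borel_measurable borel"
        using measurable_Pair2[OF T \<omega>] fm[OF \<epsilon>] by simp_all
      have "(\<Sum>k\<in>K. a k \<epsilon> \<omega>) =
          (\<integral>\<^sup>+x. (\<Sum>k\<in>K. ennreal (\<bar>T \<omega> x - f \<epsilon> x\<bar> powr p) * indicator {x. g k x \<noteq> 0} x) \<partial>lborel)"
        unfolding a_def
      proof (rule nn_integral_sum[symmetric])
        fix k assume "k \<in> K"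
        then have [measurable]: "g k \<in> borel_measurable borel" by (rule gm)
        show "(\<lambda>x. ennreal (\<bar>T \<omega> x - f \<epsilon> x\<bar> powr p) * indicator {x. g k x \<noteq> 0} x) \<in> borel_measurable lborel"
          by measurable
      qed
      also have "\<dots> \<le> (\<integral>\<^sup>+x. ennreal (\<bar>T \<omega> x - f \<epsilon> x\<bar> powr p) \<partial>lborel)"
      proof (rule nn_integral_mono)
        fix x
        have "(\<Sum>k\<in>K. indicator {x. g k x \<noteq> 0} x) \<le> (1::ennreal)"
        proof (cases "\<exists>j\<in>K. g j x \<noteq> 0")
          case True
          then obtain j where j: "j \<in> K" "g j x \<noteq> 0" by blast
          have "(\<Sum>k\<in>K. indicator {x. g k x \<noteq> 0} x) = (\<Sum>k\<in>K. if k = j then 1 else 0 :: ennreal)"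
            using disj j by (intro sum.cong) auto
          then show ?thesis using K j by simp
        qed simp
        from mult_left_mono[OF this, of "ennreal (\<bar>T \<omega> x - f \<epsilon> x\<bar> powr p)"]
        show "(\<Sum>k\<in>K. ennreal (\<bar>T \<omega> x - f \<epsilon> x\<bar> powr p) * indicator {x. g k x \<noteq> 0} x) \<le> ennreal (\<bar>T \<omega> x - f \<epsilon> x\<bar> powr p)"
          by (simp add: sum_distrib_left)
      qed
      finally show "(\<Sum>k\<in>K. a k \<epsilon> \<omega>) \<le> (\<integral>\<^sup>+x. ennreal (\<bar>T \<omega> x - f \<epsilon> x\<bar> powr p) \<partial>lborel)" .
    qed
    also have "\<dots> = Lp_risk n p T (f \<epsilon>)" by (simp add: Lp_risk_def)
    also have "\<dots> \<le> S" unfolding S_def by (intro SUP_upper F \<epsilon>)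
    finally show ?thesis .
  qed
  have "(\<Sum>\<epsilon>\<in>Pow K. \<Sum>k\<in>K. A k \<epsilon>) \<le> (\<Sum>\<epsilon>\<in>Pow K. S)"
    by (intro sum_mono risk) auto
  also have "\<dots> = ennreal (2 ^ card K) * S" using K by (simp add: card_Pow ennreal_power[symmetric])
  finally have up: "(\<Sum>\<epsilon>\<in>Pow K. \<Sum>k\<in>K. A k \<epsilon>) \<le> ennreal (2 ^ card K) * S" .
  \<comment> \<open>There is one pair for each subset of \<open>K - {k}\<close>.\<close>
  have "ennreal (2 ^ (card K - 1)) * (\<delta> * ennreal (1 / 4)) \<le> (\<Sum>\<epsilon>\<in>Pow K. A k \<epsilon>)" if k: "k \<in> K" for k
  proof -
    have "ennreal (2 ^ (card K - 1)) * (\<delta> * ennreal (1 / 4)) = (\<Sum>\<epsilon>\<in>Pow (K - {k}). \<delta> * ennreal (1 / 4))"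
      using K k by (simp add: card_Pow ennreal_power[symmetric])
    also have "\<dots> \<le> (\<Sum>\<epsilon>\<in>Pow (K - {k}). A k \<epsilon> + A k (insert k \<epsilon>))"
      by (intro sum_mono pair k) auto
    finally show ?thesis by (simp add: sum_Pow_split[OF K k])
  qed
  then have "(\<Sum>k\<in>K. ennreal (2 ^ (card K - 1)) * (\<delta> * ennreal (1 / 4))) \<le> (\<Sum>k\<in>K. \<Sum>\<epsilon>\<in>Pow K. A k \<epsilon>)"
    by (rule sum_mono)
  also have "\<dots> \<le> ennreal (2 ^ card K) * S" using up by (subst sum.swap)
  finally have main: "(\<Sum>k\<in>K. ennreal (2 ^ (card K - 1)) * (\<delta> * ennreal (1 / 4))) \<le> ennreal (2 ^ card K) * S" .
  show "ennreal (real (card K) * \<Delta> * 2 powr (- p) / 4) \<le> S"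
  proof (cases "K = {}")
    case False
    then obtain m where m: "card K = Suc m" using K by (cases "card K") auto
    have "(\<Sum>k\<in>K. ennreal (2 ^ (card K - 1)) * (\<delta> * ennreal (1 / 4))) =
        ennreal (real (card K) * (2 ^ m * (2 powr (1 - p) * \<Delta> * (1 / 4))))"
      unfolding \<delta>_def using \<Delta>(1) by (simp add: m ennreal_mult[symmetric] ennreal_of_nat_eq_real_of_nat del: of_nat_Suc ennreal_plus)
    also have "real (card K) * (2 ^ m * (2 powr (1 - p) * \<Delta> * (1 / 4))) = 2 ^ card K * (real (card K) * \<Delta> * 2 powr (- p) / 4)"
      by (simp add: m powr_diff powr_minus field_simps)
    also have "ennreal \<dots> = ennreal (2 ^ card K) * ennreal (real (card K) * \<Delta> * 2 powr (- p) / 4)"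
      using \<Delta>(1) by (intro ennreal_mult) auto
    finally have "ennreal (2 ^ card K) * ennreal (real (card K) * \<Delta> * 2 powr (- p) / 4) \<le> ennreal (2 ^ card K) * S"
      using main by simp
    then show ?thesis
      by (subst (asm) ennreal_mult_le_mult_iff) auto
  qed simp
qed

section \<open>The perturbed densities\<close>

lemma integral_pos_if_pos_on_cbox:
  fixes f :: "real^'d::finite \<Rightarrow> real"
  assumes "integrable lborel f" "\<And>x. f x \<ge> 0" "\<And>i. a $ i < b $ i" "c > 0" "\<And>x. x \<in> cbox a b \<Longrightarrow> c \<le> f x"
  shows "0 < (\<integral>x. f x \<partial>lborel)"
proof -
  have "cbox a b \<noteq> {}" using less_imp_le[OF assms(3)] by (simp add: interval_ne_empty_cart)
  then have "0 < c * measure lborel (cbox a b)"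
    using assms(3,4) by (simp add: content_cbox_cart prod_pos)
  also have "\<dots> = (\<integral>x. c * indicator (cbox a b) x \<partial>lborel)" by simp
  also have "\<dots> \<le> (\<integral>x. f x \<partial>lborel)"
  proof (rule integral_mono)
    show "integrable lborel (\<lambda>x. c * indicator (cbox a b) x)"
      by (intro integrable_mult_right integrable_real_indicator) (simp_all add: emeasure_bounded_finite[OF bounded_cbox, simplified])
    show "c * indicator (cbox a b) x \<le> f x" for x
      using assms(2,5) by (simp split: split_indicator)
  qed fact
  finally show ?thesis .
qed

lemma bump_lower_bound:
  fixes a :: "real^'d::finite"
  assumes "\<And>i. a $ i < a' $ i" "\<And>i. a' $ i \<le> b' $ i" "\<And>i. b' $ i < b $ i"
  obtains c where "c > 0" "\<And>x. x \<in> cbox a' b' \<Longrightarrow> c \<le> bump 1 a b x"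
proof -
  have ne: "cbox a' b' \<noteq> {}" using assms(2) by (simp add: interval_ne_empty_cart)
  have "continuous_on (cbox a' b') (bump 1 a b)"
    using test_functionD(2)[OF test_function_bump, of 1] by (auto intro: continuous_on_subset)
  then obtain y where y: "y \<in> cbox a' b'" "\<And>x. x \<in> cbox a' b' \<Longrightarrow> bump 1 a b y \<le> bump 1 a b x"
    using continuous_attains_inf[OF compact_cbox ne] by blast
  have "y \<in> box a b" using y(1) assms unfolding mem_box_cart by (meson less_le_trans le_less_trans)
  then have "bump 1 a b y > 0" by (simp add: bump_pos_iff)
  then show ?thesis using y(2) that by blast
qed

text \<open>The profile \<open>G\<close> of the central density. Its box of side 3 contains the
  closed unit cube in the interior, so that \<open>G\<close> stays above a positive constant on the
  cube that carries the perturbations.\<close>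

definition base_density :: "real^'d::finite \<Rightarrow> real"
  where "base_density x = bump 1 (\<chi> i. -1) (\<chi> i. 2) x / (\<integral>x. bump 1 (\<chi> i. -1) (\<chi> i. 2) x \<partial>(lborel :: (real^'d) measure))"

lemma integral_bump_pos:
  fixes a :: "real^'d::finite"
  assumes "\<And>i. a $ i < b $ i"
  shows "0 < (\<integral>x. bump 1 a b x \<partial>lborel)"
proof -
  let ?a' = "\<chi> i. (3 * a $ i + b $ i) / 4" and ?b' = "\<chi> i. (a $ i + 3 * b $ i) / 4"
  have 1: "a $ i < ?a' $ i" "?a' $ i \<le> ?b' $ i" "?b' $ i < b $ i" "?a' $ i < ?b' $ i" for i
    using assms[of i] by simp_all
  obtain c where "c > 0" "\<And>x. x \<in> cbox ?a' ?b' \<Longrightarrow> c \<le> bump 1 a b x"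
    by (rule bump_lower_bound[of a ?a' ?b' b, OF 1(1-3)]) blast
  then show ?thesis using 1
    by (intro integral_pos_if_pos_on_cbox[of _ ?a' ?b' c] test_function_integrable test_function_bump) (auto simp: bump_nonneg)
qed

lemma base_density_nonneg: "0 \<le> base_density x"
  by (simp add: base_density_def bump_nonneg integral_nonneg_AE)

lemma test_function_base_density: "test_function base_density"
proof -
  have "test_function (\<lambda>x. (1 / (\<integral>x. bump 1 (\<chi> i. -1) (\<chi> i. 2) x \<partial>(lborel :: (real^'a) measure))) * bump 1 (\<chi> i. -1) (\<chi> i. 2) x)"
    by (intro test_function_cmult test_function_bump) simp
  then show ?thesis by (simp add: base_density_def[abs_def])
qed

lemma integral_base_density: "(\<integral>x. base_density x \<partial>(lborel :: (real^'d::finite) measure)) = 1"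
  using integral_bump_pos[of "(\<chi> i. -1) :: real^'d" "\<chi> i. 2"] by (simp add: base_density_def)

lemma base_density_lower_bound:
  obtains \<kappa> :: real where "\<kappa> > 0" "\<And>x :: real^'d::finite. (\<And>i. 0 \<le> x $ i \<and> x $ i \<le> 1) \<Longrightarrow> \<kappa> \<le> base_density x"
proof -
  let ?I = "\<integral>x. bump 1 (\<chi> i. -1) (\<chi> i. 2) x \<partial>(lborel :: (real^'d) measure)"
  have I: "?I > 0" by (rule integral_bump_pos) simp
  obtain c where c: "c > 0" "\<And>x :: real^'d. x \<in> cbox (\<chi> i. 0) (\<chi> i. 1) \<Longrightarrow> c \<le> bump 1 (\<chi> i. -1) (\<chi> i. 2) x"
    by (rule bump_lower_bound[of "\<chi> i. (-1 :: real)" "\<chi> i. 0" "\<chi> i. 1" "\<chi> i. 2"]) auto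
  show ?thesis
  proof (rule that[of "c / ?I"])
    show "c / ?I > 0" using c I by simp
    fix x :: "real^'d" assume "\<And>i. 0 \<le> x $ i \<and> x $ i \<le> 1"
    then have "c \<le> bump 1 (\<chi> i. -1) (\<chi> i. 2) x" by (intro c(2)) (simp add: mem_box_cart)
    then show "c / ?I \<le> base_density x" using I by (simp add: base_density_def divide_right_mono)
  qed
qed

text \<open>Subtracting a translate makes the mean zero. The two bumps sit in opposite corners of
  the unit cube, so they do not cancel anywhere. The margin of 1/8 to the faces of the cube
  separates the closed supports of neighbouring cells; closedness is what passes from the profile to
  its derivatives.\<close>

definition cell_profile :: "real^'d::finite \<Rightarrow> real"
  where "cell_profile x = bump 1 (\<chi> i. 1/8) (\<chi> i. 3/8) x - bump 1 (\<chi> i. 1/8) (\<chi> i. 3/8) (x - (\<chi> i. 1/2))"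

lemma test_function_cell_profile: "test_function cell_profile"
proof -
  let ?b = "bump 1 (\<chi> i. 1/8) (\<chi> i. 3/8) :: real^'a \<Rightarrow> real"
  have "test_function (\<lambda>x. ?b x + (-1) * ?b (1 *\<^sub>R x + - (\<chi> i. 1/2)))"
    by (intro test_function_add test_function_cmult test_function_affine test_function_bump) simp_all
  then show ?thesis by (simp add: cell_profile_def[abs_def])
qed

lemma integral_cell_profile: "(\<integral>x. cell_profile x \<partial>(lborel :: (real^'d::finite) measure)) = 0"
proof -
  let ?b = "bump 1 (\<chi> i. 1/8) (\<chi> i. 3/8) :: real^'d \<Rightarrow> real"
  have b: "test_function ?b" by (rule test_function_bump) simp
  have "integrable lborel (\<lambda>x. ?b (1 *\<^sub>R x + - (\<chi> i. 1/2)))"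
    by (intro test_function_integrable test_function_affine b) simp
  moreover have "(\<integral>x. ?b (1 *\<^sub>R x + - (\<chi> i. 1/2)) \<partial>lborel) = (\<integral>x. ?b x \<partial>lborel)"
    by (subst lborel_integral_affine) (simp_all add: test_function_measurable[OF b])
  ultimately show ?thesis using test_function_integrable[OF b] by (simp add: cell_profile_def)
qed

lemma cell_profile_support:
  fixes x :: "real^'d::finite"
  assumes "x \<notin> cbox (\<chi> i. 1/8) (\<chi> i. 7/8)" shows "cell_profile x = 0"
proof -
  have "\<not> x \<in> box (\<chi> i. 1/8) (\<chi> i. 3/8)" "\<not> x - (\<chi> i. 1/2) \<in> box (\<chi> i. 1/8) (\<chi> i. 3/8)"
  proof -
    obtain i where i: "\<not> (1/8 \<le> x $ i \<and> x $ i \<le> 7/8)" using assms by (auto simp: mem_box_cart)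
    show "\<not> x \<in> box (\<chi> i. 1/8) (\<chi> i. 3/8)"
    proof
      assume "x \<in> box (\<chi> i. 1/8) (\<chi> i. 3/8)"
      then have "1/8 < x $ i \<and> x $ i < 3/8" by (simp add: mem_box_cart)
      then show False using i by linarith
    qed
    show "\<not> x - (\<chi> i. 1/2) \<in> box (\<chi> i. 1/8) (\<chi> i. 3/8)"
    proof
      assume "x - (\<chi> i. 1/2) \<in> box (\<chi> i. 1/8) (\<chi> i. 3/8)"
      then have "1/8 < x $ i - 1/2 \<and> x $ i - 1/2 < 3/8" by (simp add: mem_box_cart)
      then show False using i by linarith
    qed
  qed
  then show ?thesis
    using bump_neq_0_iff[of 1 "\<chi> i. 1/8" "\<chi> i. 3/8" x] bump_neq_0_iff[of 1 "\<chi> i. 1/8" "\<chi> i. 3/8" "x - (\<chi> i. 1/2)"]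
    by (simp add: cell_profile_def)
qed

lemma integral_cell_profile_powr_pos:
  assumes "p > 0"
  shows "0 < (\<integral>x. \<bar>cell_profile x\<bar> powr p \<partial>(lborel :: (real^'d::finite) measure))"
proof -
  let ?b = "bump 1 (\<chi> i. 1/8) (\<chi> i. 3/8) :: real^'d \<Rightarrow> real"
  obtain c where c: "c > 0" "\<And>x. x \<in> cbox (\<chi> i. 3/16) (\<chi> i. 5/16) \<Longrightarrow> c \<le> ?b x"
    by (rule bump_lower_bound[of "\<chi> i. (1/8 :: real)" "\<chi> i. 3/16" "\<chi> i. 5/16" "\<chi> i. 3/8"]) auto
  show ?thesis
  proof (rule integral_pos_if_pos_on_cbox[where a = "\<chi> i. 3/16" and b = "\<chi> i. 5/16" and c = "c powr p"])
    fix x :: "real^'d" assume x: "x \<in> cbox (\<chi> i. 3/16) (\<chi> i. 5/16)"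
    have "x - (\<chi> i. 1/2) \<notin> box (\<chi> i. 1/8) (\<chi> i. 3/8)"
    proof
      assume "x - (\<chi> i. 1/2) \<in> box (\<chi> i. 1/8) (\<chi> i. 3/8)"
      \<comment> \<open>Any coordinate separates the two bumps; \<open>undefined\<close> just names
        one.\<close>
      then have "1/8 < x $ undefined - 1/2" by (simp add: mem_box_cart)
      moreover have "x $ undefined \<le> 5/16" using x by (simp add: mem_box_cart)
      ultimately show False by linarith
    qed
    then have "cell_profile x = ?b x"
      using bump_neq_0_iff[of 1 "\<chi> i. 1/8" "\<chi> i. 3/8" "x - (\<chi> i. 1/2)"] by (simp add: cell_profile_def)
    then show "c powr p \<le> \<bar>cell_profile x\<bar> powr p"
      using c(1) c(2)[OF x] assms by (intro powr_mono2) auto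
  qed (use c(1) assms in \<open>auto intro: test_function_integrable_powr test_function_cell_profile\<close>)
qed

lemma rev_deriv_cell_profile_support:
  assumes "x \<notin> cbox (\<chi> i. 1/8) (\<chi> i. 7/8)"
  shows "rev_deriv \<alpha> cell_profile x = 0"
  by (rule rev_deriv_eq_0[OF closed_cbox cell_profile_support assms])

lemma integral_abs_powr_affine:
  fixes f :: "real^'d::finite \<Rightarrow> real"
  assumes "f \<in> borel_measurable borel" "c \<ge> 0" "h > 0"
  shows "(\<integral>x. \<bar>c * f ((1 / h) *\<^sub>R x + a)\<bar> powr q \<partial>lborel) = c powr q * h ^ CARD('d) * (\<integral>x. \<bar>f x\<bar> powr q \<partial>lborel)"
proof -
  have "(\<integral>x. \<bar>c * f ((1 / h) *\<^sub>R x + a)\<bar> powr q \<partial>lborel) = c powr q * (\<integral>x. \<bar>f ((1 / h) *\<^sub>R x + a)\<bar> powr q \<partial>lborel)"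
    using assms(2) by (simp add: abs_mult powr_mult)
  also have "(\<integral>x. \<bar>f ((1 / h) *\<^sub>R x + a)\<bar> powr q \<partial>lborel) = (\<integral>x. \<bar>f x\<bar> powr q \<partial>lborel) / \<bar>1 / h\<bar> ^ CARD('d)"
    using lborel_integral_affine[of "1 / h" "\<lambda>x. \<bar>f x\<bar> powr q" a] assms by simp
  finally show ?thesis using assms(3) by (simp add: power_one_over)
qed

section \<open>Estimates for L^p norms\<close>

lemma Lp_norm_nonneg: "0 \<le> Lp_norm p f"
  by (simp add: Lp_norm_def)

lemma Lp_norm_powr:
  assumes "p > 0" shows "Lp_norm p f powr p = (\<integral>x. \<bar>f x\<bar> powr p \<partial>lborel)"
  using assms by (simp add: Lp_norm_def powr_powr integral_nonneg_AE)

lemma Lp_norm_leI: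
  assumes "p > 0" "B \<ge> 0" "(\<integral>x. \<bar>f x\<bar> powr p \<partial>lborel) \<le> B powr p"
  shows "Lp_norm p f \<le> B"
proof -
  have "Lp_norm p f \<le> (B powr p) powr (1 / p)"
    unfolding Lp_norm_def using assms by (intro powr_mono2) (auto intro: integral_nonneg_AE)
  then show ?thesis using assms by (simp add: powr_powr)
qed

text \<open>Each summand \<open>x\<close> is at most \<open>a + b\<close>, hence
  \<open>x powr p\<close> is at most \<open>x * (a + b) powr (p - 1)\<close>; add the two
  bounds.\<close>

lemma powr_superadditive:
  fixes a b p :: real
  assumes "a \<ge> 0" "b \<ge> 0" "p \<ge> 1"
  shows "a powr p + b powr p \<le> (a + b) powr p"
proof -
  have *: "x powr p \<le> x * (a + b) powr (p - 1)" if "0 \<le> x" "x \<le> a + b" for x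
  proof (cases "x = 0")
    case False
    have "x powr p = x * x powr (p - 1)" using that False by (simp add: powr_mult_base)
    also have "\<dots> \<le> x * (a + b) powr (p - 1)" using that assms by (intro mult_left_mono powr_mono2) auto
    finally show ?thesis .
  qed simp
  have "a powr p + b powr p \<le> a * (a + b) powr (p - 1) + b * (a + b) powr (p - 1)"
    using assms by (intro add_mono *) auto
  also have "\<dots> = (a + b) * (a + b) powr (p - 1)" by (simp add: distrib_right)
  also have "\<dots> = (a + b) powr p" using assms by (simp add: powr_mult_base)
  finally show ?thesis .
qed

text \<open>Minkowski's inequality up to a constant, which equals 1 in the only case \<open>p = 1\<close> where its value matters.\<close>

lemma Lp_norm_add_le:
  assumes p: "p \<ge> 1" and f: "test_function f" and g: "test_function g"
  shows "Lp_norm p (\<lambda>x. f x + g x) \<le> 2 powr (1 - 1 / p) * (Lp_norm p f + Lp_norm p g)"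
proof (rule Lp_norm_leI)
  have i: "integrable lborel (\<lambda>x. \<bar>u x\<bar> powr p)" if "test_function u" for u :: "real^'a \<Rightarrow> real"
    using that p by (intro test_function_integrable_powr) auto
  have "(\<integral>x. \<bar>f x + g x\<bar> powr p \<partial>lborel) \<le> (\<integral>x. 2 powr (p - 1) * (\<bar>f x\<bar> powr p + \<bar>g x\<bar> powr p) \<partial>lborel)"
    using i[OF test_function_add[OF f g]] i[OF f] i[OF g] by (intro integral_mono abs_add_powr_le p) auto
  also have "\<dots> = 2 powr (p - 1) * (Lp_norm p f powr p + Lp_norm p g powr p)"
    using i[OF f] i[OF g] p by (simp add: Lp_norm_powr)
  also have "\<dots> \<le> 2 powr (p - 1) * (Lp_norm p f + Lp_norm p g) powr p"
    using p by (intro mult_left_mono powr_superadditive) (auto simp: Lp_norm_nonneg)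
  also have "2 powr (p - 1) = (2 powr (1 - 1 / p)) powr p" using p by (simp add: powr_powr left_diff_distrib)
  finally show "(\<integral>x. \<bar>f x + g x\<bar> powr p \<partial>lborel) \<le> (2 powr (1 - 1 / p) * (Lp_norm p f + Lp_norm p g)) powr p"
    by (simp add: powr_mult Lp_norm_nonneg)
qed (use p in \<open>auto simp: Lp_norm_nonneg\<close>)

text \<open>The \<open>+ 0\<close> brings the argument into the affine form on which the rules for
  test functions, derivatives and integrals are stated.\<close>

definition scaled_base :: "real \<Rightarrow> real^'d::finite \<Rightarrow> real"
  where "scaled_base L x = 1 / L ^ CARD('d) * base_density ((1 / L) *\<^sub>R x + 0)"

definition cell :: "real \<Rightarrow> real \<Rightarrow> ('d::finite \<Rightarrow> nat) \<Rightarrow> real^'d \<Rightarrow> real"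
  where "cell \<gamma> h k x = \<gamma> * cell_profile ((1 / h) *\<^sub>R x + (\<chi> i. - real (k i)))"

definition grid :: "nat \<Rightarrow> ('d::finite \<Rightarrow> nat) set"
  where "grid M = {k. \<forall>i. k i < M}"

section \<open>The grid, the scaled density and the cells\<close>

lemma grid_eq_PiE: "grid M = (\<Pi>\<^sub>E i\<in>UNIV. {..<M})"
  by (auto simp: grid_def)

lemma finite_grid: "finite (grid M :: ('d::finite \<Rightarrow> nat) set)"
  unfolding grid_eq_PiE by (intro finite_PiE) auto

lemma card_grid: "card (grid M :: ('d::finite \<Rightarrow> nat) set) = M ^ CARD('d)"
  unfolding grid_eq_PiE by (simp add: card_PiE)

lemma test_function_scaled_base: "L > 0 \<Longrightarrow> test_function (scaled_base L)"
  unfolding scaled_base_def[abs_def]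
  by (intro test_function_cmult test_function_affine test_function_base_density) simp

lemma scaled_base_nonneg: "L > 0 \<Longrightarrow> 0 \<le> scaled_base L x"
  by (simp add: scaled_base_def base_density_nonneg)

lemma integral_scaled_base:
  assumes "L > 0"
  shows "(\<integral>x. scaled_base L x \<partial>(lborel :: (real^'d::finite) measure)) = 1"
proof -
  have "(\<integral>x. base_density ((1 / L) *\<^sub>R x + 0) \<partial>(lborel :: (real^'d) measure)) = 1 / \<bar>1 / L\<bar> ^ CARD('d)"
    using assms by (subst lborel_integral_affine) (simp_all add: integral_base_density test_function_measurable test_function_base_density)
  then show ?thesis using assms by (simp add: scaled_base_def power_one_over)
qed

lemma test_function_cell: "h > 0 \<Longrightarrow> test_function (cell \<gamma> h k)"
  unfolding cell_def[abs_def]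
  by (intro test_function_cmult test_function_affine test_function_cell_profile) simp

lemma integral_cell:
  assumes "h > 0"
  shows "(\<integral>x. cell \<gamma> h k x \<partial>(lborel :: (real^'d::finite) measure)) = 0"
proof -
  have "(\<integral>x. cell_profile ((1 / h) *\<^sub>R x + (\<chi> i. - real (k i))) \<partial>(lborel :: (real^'d) measure)) = 0"
    using assms by (subst lborel_integral_affine) (simp_all add: integral_cell_profile test_function_measurable test_function_cell_profile)
  then show ?thesis by (simp add: cell_def)
qed

lemma rev_deriv_cell:
  assumes "h > 0"
  shows "rev_deriv \<alpha> (cell \<gamma> h k) = (\<lambda>x. \<gamma> * (1 / h) ^ order_of \<alpha> * rev_deriv \<alpha> cell_profile ((1 / h) *\<^sub>R x + (\<chi> i. - real (k i))))"
proof -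
  have "test_function (\<lambda>x. cell_profile ((1 / h) *\<^sub>R x + (\<chi> i. - real (k i))))"
    by (intro test_function_affine test_function_cell_profile) (use assms in simp)
  then show ?thesis unfolding cell_def[abs_def]
    by (simp only: rev_deriv_cmult) (use assms in \<open>simp add: rev_deriv_affine[OF test_function_cell_profile] mult.assoc\<close>)
qed

text \<open>The margin of the profile makes the inequalities strict. Two cells that share a point
  then have integer corners differing by less than 1 in each coordinate, hence equal ones.\<close>

lemma in_cellD:
  fixes x :: "real^'d::finite"
  assumes "(1 / h) *\<^sub>R x + (\<chi> i. - real (k i)) \<in> cbox (\<chi> i. 1/8) (\<chi> i. 7/8)" "h > 0"
  shows "real (k i) * h < x $ i" "x $ i < (real (k i) + 1) * h"
proof -
  have "1/8 \<le> x $ i / h - real (k i)" "x $ i / h - real (k i) \<le> 7/8"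
    using assms(1) by (simp_all add: mem_box_cart)
  then have "real (k i) < x $ i / h" "x $ i / h < real (k i) + 1" by linarith+
  then show "real (k i) * h < x $ i" "x $ i < (real (k i) + 1) * h"
    using assms(2) by (simp_all add: field_simps)
qed

lemma cells_disjoint:
  fixes x :: "real^'d::finite"
  assumes "(1 / h) *\<^sub>R x + (\<chi> i. - real (j i)) \<in> cbox (\<chi> i. 1/8) (\<chi> i. 7/8)"
    "(1 / h) *\<^sub>R x + (\<chi> i. - real (k i)) \<in> cbox (\<chi> i. 1/8) (\<chi> i. 7/8)" "h > 0"
  shows "j = k"
proof
  fix i
  have "real (j i) * h < (real (k i) + 1) * h" "real (k i) * h < (real (j i) + 1) * h"
    using in_cellD[OF assms(1,3), of i] in_cellD[OF assms(2,3), of i] by linarith+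
  then show "j i = k i" using assms(3) by simp
qed

lemma cell_neq_0_in_cell:
  assumes "cell \<gamma> h k x \<noteq> 0"
  shows "(1 / h) *\<^sub>R x + (\<chi> i. - real (k i)) \<in> cbox (\<chi> i. 1/8) (\<chi> i. 7/8)"
  using assms cell_profile_support by (auto simp: cell_def)

lemma rev_deriv_cell_neq_0_in_cell:
  assumes "rev_deriv \<alpha> (cell \<gamma> h k) x \<noteq> 0" "h > 0"
  shows "(1 / h) *\<^sub>R x + (\<chi> i. - real (k i)) \<in> cbox (\<chi> i. 1/8) (\<chi> i. 7/8)"
  using assms rev_deriv_cell_profile_support by (auto simp: rev_deriv_cell)

text \<open>At most one term is nonzero, and \<open>0 powr p\<close> is 0 for every
  \<open>p\<close>.\<close>

lemma abs_sum_powr_disjoint: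
  fixes u :: "'k \<Rightarrow> real"
  assumes "finite K" "\<And>j k. j \<in> K \<Longrightarrow> k \<in> K \<Longrightarrow> u j \<noteq> 0 \<Longrightarrow> u k \<noteq> 0 \<Longrightarrow> j = k"
  shows "\<bar>\<Sum>k\<in>K. u k\<bar> powr p = (\<Sum>k\<in>K. \<bar>u k\<bar> powr p)"
proof (cases "\<exists>j\<in>K. u j \<noteq> 0")
  case True
  then obtain j where j: "j \<in> K" "u j \<noteq> 0" by blast
  have z: "u k = 0" if "k \<in> K" "k \<noteq> j" for k using assms(2)[of j k] j that by auto
  have "(\<Sum>k\<in>K. u k) = (\<Sum>k\<in>K. if k = j then u j else 0)"
    by (rule sum.cong) (auto simp: z)
  moreover have "(\<Sum>k\<in>K. \<bar>u k\<bar> powr p) = (\<Sum>k\<in>K. if k = j then \<bar>u j\<bar> powr p else 0)"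
    by (rule sum.cong) (auto simp: z)
  ultimately show ?thesis using assms(1) j by simp
qed simp

text \<open>Since the cells are disjoint, the \<open>L\<^sup>p\<close> norm of the sum is governed by the total volume \<open>L\<^sup>d\<close> of the grid.\<close>

lemma Lp_norm_rev_deriv_cells:
  fixes \<epsilon> :: "('d::finite \<Rightarrow> nat) set"
  assumes h: "h > 0" and \<gamma>: "\<gamma> \<ge> 0" and p: "p \<ge> 1" and \<epsilon>: "\<epsilon> \<subseteq> grid M"
  shows "Lp_norm p (rev_deriv \<alpha> (\<lambda>x. \<Sum>k\<in>\<epsilon>. cell \<gamma> h k x)) \<le>
    \<gamma> * (1 / h) ^ order_of \<alpha> * (h * real M) powr (real CARD('d) / p) * Lp_norm p (rev_deriv \<alpha> (cell_profile :: real^'d \<Rightarrow> real))"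
proof (rule Lp_norm_leI)
  let ?D = "rev_deriv \<alpha> (cell_profile :: real^'d \<Rightarrow> real)"
  let ?c = "\<gamma> * (1 / h) ^ order_of \<alpha>"
  have fin: "finite \<epsilon>" using \<epsilon> finite_grid by (rule finite_subset)
  have "(\<integral>x. \<bar>rev_deriv \<alpha> (\<lambda>x. \<Sum>k\<in>\<epsilon>. cell \<gamma> h k x) x\<bar> powr p \<partial>lborel) =
      (\<integral>x. (\<Sum>k\<in>\<epsilon>. \<bar>rev_deriv \<alpha> (cell \<gamma> h k) x\<bar> powr p) \<partial>lborel)"
    unfolding rev_deriv_sum[OF test_function_cell[OF h]]
    by (intro Bochner_Integration.integral_cong refl abs_sum_powr_disjoint fin)
      (rule cells_disjoint[OF rev_deriv_cell_neq_0_in_cell rev_deriv_cell_neq_0_in_cell h]; (assumption | rule h))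
  also have "\<dots> = (\<Sum>k\<in>\<epsilon>. \<integral>x. \<bar>rev_deriv \<alpha> (cell \<gamma> h k) x\<bar> powr p \<partial>lborel)"
    using p by (intro Bochner_Integration.integral_sum test_function_integrable_powr test_function_rev_deriv test_function_cell h) auto
  also have "\<dots> = (\<Sum>k\<in>\<epsilon>. ?c powr p * h ^ CARD('d) * (\<integral>x. \<bar>?D x\<bar> powr p \<partial>lborel))"
    unfolding rev_deriv_cell[OF h] using h \<gamma>
    by (intro sum.cong refl integral_abs_powr_affine test_function_measurable test_function_rev_deriv test_function_cell_profile) auto
  also have "\<dots> = real (card \<epsilon>) * (?c powr p * h ^ CARD('d) * (\<integral>x. \<bar>?D x\<bar> powr p \<partial>lborel))" by simp
  also have "\<dots> \<le> real (M ^ CARD('d)) * (?c powr p * h ^ CARD('d) * (\<integral>x. \<bar>?D x\<bar> powr p \<partial>lborel))"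
    using card_mono[OF finite_grid \<epsilon>] h by (intro mult_right_mono) (auto simp: card_grid integral_nonneg_AE simp del: of_nat_power)
  also have "\<dots> = ?c powr p * (h * real M) ^ CARD('d) * Lp_norm p ?D powr p"
    using p by (simp add: Lp_norm_powr power_mult_distrib)
  \<comment> \<open>The volume of the grid as a \<open>p\<close>-th power. Converting
    \<open>powr\<close> to a natural power needs a positive base, so \<open>M = 0\<close> is treated
    apart; both sides are then 0.\<close>
  also have "(h * real M) ^ CARD('d) = ((h * real M) powr (real CARD('d) / p)) powr p"
  proof (cases "M = 0")
    case False
    then show ?thesis using p h by (simp add: powr_powr powr_realpow)
  qed simp
  finally show "(\<integral>x. \<bar>rev_deriv \<alpha> (\<lambda>x. \<Sum>k\<in>\<epsilon>. cell \<gamma> h k x) x\<bar> powr p \<partial>lborel) \<le>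
      (?c * (h * real M) powr (real CARD('d) / p) * Lp_norm p ?D) powr p"
    using h \<gamma> by (simp add: powr_mult Lp_norm_nonneg)
qed (use p h \<gamma> in \<open>auto simp: Lp_norm_nonneg\<close>)

section \<open>Membership of the perturbed densities in the class\<close>

lemma sobolev_norm_cube_density:
  fixes \<epsilon> :: "('d::finite \<Rightarrow> nat) set"
  assumes h: "0 < h" "h \<le> 1" and \<gamma>: "\<gamma> \<ge> 0" and p: "p \<ge> 1" and \<epsilon>: "\<epsilon> \<subseteq> grid M" and L: "L > 0" "L = h * real M"
  shows "sobolev_norm s p (\<lambda>x. scaled_base L x + (\<Sum>k\<in>\<epsilon>. cell \<gamma> h k x)) \<le>
    2 powr (1 - 1 / p) * (sobolev_norm s p (scaled_base L :: real^'d \<Rightarrow> real) +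
      \<gamma> * (1 / h) ^ s * L powr (real CARD('d) / p) * sobolev_norm s p (cell_profile :: real^'d \<Rightarrow> real))"
proof -
  let ?P = "\<lambda>x. \<Sum>k\<in>\<epsilon>. cell \<gamma> h k x" and ?B = "scaled_base L :: real^'d \<Rightarrow> real"
  have tB: "test_function ?B" and tP: "test_function ?P"
    by (intro test_function_scaled_base L test_function_sum test_function_cell h)+
  have "sobolev_norm s p (\<lambda>x. ?B x + ?P x) = (\<Sum>\<alpha> | order_of \<alpha> \<le> s. Lp_norm p (\<lambda>x. rev_deriv \<alpha> ?B x + rev_deriv \<alpha> ?P x))"
    by (simp add: sobolev_norm_test_function test_function_add tB tP rev_deriv_add)
  also have "\<dots> \<le> (\<Sum>\<alpha> | order_of \<alpha> \<le> s. 2 powr (1 - 1 / p) * (Lp_norm p (rev_deriv \<alpha> ?B) +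
      \<gamma> * (1 / h) ^ s * L powr (real CARD('d) / p) * Lp_norm p (rev_deriv \<alpha> (cell_profile :: real^'d \<Rightarrow> real))))"
  proof (rule sum_mono)
    fix \<alpha> :: "'d \<Rightarrow> nat" assume "\<alpha> \<in> {\<alpha>. order_of \<alpha> \<le> s}"
    \<comment> \<open>As \<open>h\<close> is at most 1, the top order \<open>s\<close> is the most
      expensive, and its factor serves for all orders at once.\<close>
    then have ord: "(1 / h) ^ order_of \<alpha> \<le> (1 / h) ^ s" using h by (intro power_increasing) auto
    have "Lp_norm p (\<lambda>x. rev_deriv \<alpha> ?B x + rev_deriv \<alpha> ?P x) \<le> 2 powr (1 - 1 / p) * (Lp_norm p (rev_deriv \<alpha> ?B) + Lp_norm p (rev_deriv \<alpha> ?P))"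
      by (intro Lp_norm_add_le p test_function_rev_deriv tB tP)
    also have "Lp_norm p (rev_deriv \<alpha> ?P) \<le> \<gamma> * (1 / h) ^ order_of \<alpha> * L powr (real CARD('d) / p) * Lp_norm p (rev_deriv \<alpha> (cell_profile :: real^'d \<Rightarrow> real))"
      unfolding L(2) by (rule Lp_norm_rev_deriv_cells[OF h(1) \<gamma> p \<epsilon>])
    also have "\<dots> \<le> \<gamma> * (1 / h) ^ s * L powr (real CARD('d) / p) * Lp_norm p (rev_deriv \<alpha> (cell_profile :: real^'d \<Rightarrow> real))"
      using \<gamma> by (intro mult_right_mono mult_left_mono ord) (auto simp: Lp_norm_nonneg)
    finally show "Lp_norm p (\<lambda>x. rev_deriv \<alpha> ?B x + rev_deriv \<alpha> ?P x) \<le> 2 powr (1 - 1 / p) * (Lp_norm p (rev_deriv \<alpha> ?B) +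
      \<gamma> * (1 / h) ^ s * L powr (real CARD('d) / p) * Lp_norm p (rev_deriv \<alpha> (cell_profile :: real^'d \<Rightarrow> real)))"
      by simp
  qed
  also have "\<dots> = 2 powr (1 - 1 / p) * (sobolev_norm s p ?B +
      \<gamma> * (1 / h) ^ s * L powr (real CARD('d) / p) * sobolev_norm s p (cell_profile :: real^'d \<Rightarrow> real))"
    by (simp add: sobolev_norm_test_function tB test_function_cell_profile sum.distrib sum_distrib_left algebra_simps)
  finally show ?thesis .
qed

text \<open>The cells of the grid fill \<open>[0, L]^d\<close>, which the scaling by
  \<open>1 / L\<close> carries to the unit cube, where \<open>base_density\<close> is at least
  \<kappa>. This floor keeps the perturbed functions nonnegative and also bounds the chi-square
  distance.\<close>

lemma scaled_base_lower_bound: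
  fixes x :: "real^'d::finite"
  assumes \<kappa>: "\<And>x :: real^'d. (\<And>i. 0 \<le> x $ i \<and> x $ i \<le> 1) \<Longrightarrow> \<kappa> \<le> base_density x"
    and h: "h > 0" and L: "L > 0" "L = h * real M" and k: "k \<in> grid M" and nz: "cell \<gamma> h k x \<noteq> 0"
  shows "\<kappa> / L ^ CARD('d) \<le> scaled_base L x"
proof -
  have "0 \<le> ((1 / L) *\<^sub>R x + 0) $ i \<and> ((1 / L) *\<^sub>R x + 0) $ i \<le> 1" for i
  proof -
    note b = in_cellD[OF cell_neq_0_in_cell[OF nz] h, of i]
    have "0 \<le> real (k i) * h" using h by simp
    moreover have "k i + 1 \<le> M" using k by (simp add: grid_def Suc_leI)
    then have "real (k i) + 1 \<le> real M" by linarith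
    then have "(real (k i) + 1) * h \<le> L" using h by (simp add: L(2) mult.commute)
    ultimately have "0 \<le> x $ i" "x $ i \<le> L" using b by linarith+
    then show ?thesis using L(1) by simp
  qed
  from \<kappa>[OF this] show ?thesis using L(1) by (simp add: scaled_base_def divide_right_mono)
qed

text \<open>At each point at most one cell is active, and its amplitude is below the floor of the
  scaled density there.\<close>

lemma cube_density_nonneg:
  fixes x :: "real^'d::finite"
  assumes \<kappa>: "\<And>x :: real^'d. (\<And>i. 0 \<le> x $ i \<and> x $ i \<le> 1) \<Longrightarrow> \<kappa> \<le> base_density x"
    and h: "h > 0" and L: "L > 0" "L = h * real M" and \<epsilon>: "\<epsilon> \<subseteq> grid M"
    and amp: "\<gamma> \<ge> 0" "\<And>x :: real^'d. \<gamma> * \<bar>cell_profile x\<bar> \<le> \<kappa> / L ^ CARD('d)"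
  shows "0 \<le> scaled_base L x + (\<Sum>k\<in>\<epsilon>. cell \<gamma> h k x)"
proof (cases "\<exists>j\<in>\<epsilon>. cell \<gamma> h j x \<noteq> 0")
  case True
  then obtain j where j: "j \<in> \<epsilon>" "cell \<gamma> h j x \<noteq> 0" by blast
  have "cell \<gamma> h k x = (if k = j then cell \<gamma> h j x else 0)" for k
    using j(2) cells_disjoint[OF cell_neq_0_in_cell cell_neq_0_in_cell h, of \<gamma> j x \<gamma> k] by (cases "k = j") auto
  then have "(\<Sum>k\<in>\<epsilon>. cell \<gamma> h k x) = (\<Sum>k\<in>\<epsilon>. if k = j then cell \<gamma> h j x else 0)" by (intro sum.cong refl) metis
  also have "\<dots> = cell \<gamma> h j x" using j finite_subset[OF \<epsilon> finite_grid] by simp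
  finally have "(\<Sum>k\<in>\<epsilon>. cell \<gamma> h k x) = cell \<gamma> h j x" .
  moreover have "\<bar>cell \<gamma> h j x\<bar> \<le> \<kappa> / L ^ CARD('d)" using amp by (simp add: cell_def abs_mult)
  moreover have "\<kappa> / L ^ CARD('d) \<le> scaled_base L x"
    using j \<epsilon> by (intro scaled_base_lower_bound[OF \<kappa> h L, of j \<gamma>]) auto
  ultimately show ?thesis by linarith
next
  case False
  then have "(\<Sum>k\<in>\<epsilon>. cell \<gamma> h k x) = 0" by (intro sum.neutral) auto
  then show ?thesis using scaled_base_nonneg[OF L(1)] by simp
qed

lemma cube_density_in_class:
  fixes \<epsilon> :: "('d::finite \<Rightarrow> nat) set"
  assumes \<kappa>: "\<kappa> > 0" "\<And>x :: real^'d. (\<And>i. 0 \<le> x $ i \<and> x $ i \<le> 1) \<Longrightarrow> \<kappa> \<le> base_density x"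
    and h: "0 < h" "h \<le> 1" and L: "L > 0" "L = h * real M" and \<epsilon>: "\<epsilon> \<subseteq> grid M" and p: "p \<ge> 1"
    and amp: "\<gamma> \<ge> 0" "\<And>x :: real^'d. \<gamma> * \<bar>cell_profile x\<bar> \<le> \<kappa> / L ^ CARD('d)"
    and sob: "2 powr (1 - 1 / p) * (sobolev_norm s p (scaled_base L :: real^'d \<Rightarrow> real) +
      \<gamma> * (1 / h) ^ s * L powr (real CARD('d) / p) * sobolev_norm s p (cell_profile :: real^'d \<Rightarrow> real)) \<le> r"
    and R: "\<And>x :: real^'d. x \<notin> cball 0 \<rho> \<Longrightarrow> base_density x = 0" "L * \<rho> \<le> R"
  shows "(\<lambda>x. scaled_base L x + (\<Sum>k\<in>\<epsilon>. cell \<gamma> h k x)) \<in> density_class s p r R"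
proof -
  let ?f = "\<lambda>x. scaled_base L x + (\<Sum>k\<in>\<epsilon>. cell \<gamma> h k x)"
  have t: "test_function ?f"
    by (intro test_function_add test_function_scaled_base L test_function_sum test_function_cell h)
  have nn: "0 \<le> ?f x" for x by (rule cube_density_nonneg[OF \<kappa>(2) h(1) L \<epsilon> amp])
  have iB: "integrable lborel (scaled_base L :: real^'d \<Rightarrow> real)"
    by (intro test_function_integrable test_function_scaled_base L)
  have i: "integrable lborel (\<lambda>x. \<Sum>k\<in>\<epsilon>. cell \<gamma> h k x)"
    by (intro test_function_integrable test_function_sum test_function_cell h)
  have "(\<integral>x. (\<Sum>k\<in>\<epsilon>. cell \<gamma> h k x) \<partial>lborel) = (\<Sum>k\<in>\<epsilon>. \<integral>x. cell \<gamma> h k x \<partial>lborel)"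
    by (intro Bochner_Integration.integral_sum test_function_integrable test_function_cell h)
  then have "(\<integral>x. ?f x \<partial>lborel) = 1"
    using i iB by (simp add: integral_scaled_base[OF L(1)] integral_cell[OF h(1)])
  then have dens: "prob_density ?f"
    unfolding prob_density_def using nn test_function_measurable[OF t] test_function_integrable[OF t]
    by (auto simp: nn_integral_eq_integral)
  have "?f \<in> sobolev_densities s p r"
    unfolding sobolev_densities_def sobolev_ball_def
    using sobolev_norm_cube_density[OF h amp(1) p \<epsilon> L, of s] sob test_function_in_sobolev_space[OF t, of p s] p dens
    by auto
  moreover have "?f x = 0" if "x \<notin> cball 0 R" for x
  proof -
    have "scaled_base L x = 0"
    proof -
      have "L * \<rho> < norm x" using that R(2) by simp
      then have "(1 / L) *\<^sub>R x + 0 \<notin> cball 0 \<rho>" using L(1) by (simp add: field_simps)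
      then show ?thesis by (simp add: scaled_base_def R(1))
    qed
    \<comment> \<open>No geometry of the ball is required: a cell can be nonzero only where the
      scaled density is positive, so its support lies in that of the scaled density.\<close>
    moreover have "cell \<gamma> h k x = 0" if "k \<in> \<epsilon>" for k
    proof (rule ccontr)
      assume "cell \<gamma> h k x \<noteq> 0"
      then have "\<kappa> / L ^ CARD('d) \<le> scaled_base L x"
        using that \<epsilon> by (intro scaled_base_lower_bound[OF \<kappa>(2) h(1) L, of k \<gamma>]) auto
      moreover have "0 < \<kappa> / L ^ CARD('d)" using \<kappa>(1) L(1) by simp
      ultimately show False using \<open>scaled_base L x = 0\<close> by simp
    qed
    ultimately show ?thesis by simp
  qed
  ultimately show ?thesis
    by (auto simp: density_class_def sobolev_densities_supp_def intro!: exI[of _ 0])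
qed

text \<open>Assouad's bound for the \<open>M^d\<close> cells of side \<open>h\<close>, where the
  number of cells times the volume of one is \<open>L^d\<close>. In the chi-square condition the
  factor \<open>L^d\<close> comes from the floor \<open>\<kappa> / L^d\<close> of the scaled
  density.\<close>

lemma minimax_risk_lower_bound:
  fixes M n :: nat
  assumes \<kappa>: "\<kappa> > 0" "\<And>x :: real^'d::finite. (\<And>i. 0 \<le> x $ i \<and> x $ i \<le> 1) \<Longrightarrow> \<kappa> \<le> base_density x"
    and h: "0 < h" "h \<le> 1" and L: "L > 0" "L = h * real M" and p: "p \<ge> 1"
    and amp: "\<gamma> \<ge> 0" "\<And>x :: real^'d. \<gamma> * \<bar>cell_profile x\<bar> \<le> \<kappa> / L ^ CARD('d)"
    and sob: "2 powr (1 - 1 / p) * (sobolev_norm s p (scaled_base L :: real^'d \<Rightarrow> real) +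
      \<gamma> * (1 / h) ^ s * L powr (real CARD('d) / p) * sobolev_norm s p (cell_profile :: real^'d \<Rightarrow> real)) \<le> r"
    and R: "\<And>x :: real^'d. x \<notin> cball 0 \<rho> \<Longrightarrow> base_density x = 0" "L * \<rho> \<le> R"
    and chi: "real n * (\<gamma>\<^sup>2 * h ^ CARD('d) * (\<integral>x. (cell_profile x)\<^sup>2 \<partial>(lborel :: (real^'d) measure)) * L ^ CARD('d) / \<kappa>) \<le> 1 / 4"
  shows "ennreal (L ^ CARD('d) * \<gamma> powr p * (\<integral>x. \<bar>cell_profile x\<bar> powr p \<partial>(lborel :: (real^'d) measure)) * 2 powr (- p) / 4)
    \<le> minimax_risk n p (density_class s p r R :: (real^'d \<Rightarrow> real) set)"
proof -
  let ?I = "\<integral>x. \<bar>cell_profile x\<bar> powr p \<partial>(lborel :: (real^'d) measure)"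
  let ?\<Delta> = "\<gamma> powr p * h ^ CARD('d) * ?I"
  have tc: "test_function (cell \<gamma> h k)" for k :: "'d \<Rightarrow> nat" using h(1) by (rule test_function_cell)
  have sq: "(\<integral>x. (cell \<gamma> h k x)\<^sup>2 \<partial>lborel) = \<gamma>\<^sup>2 * h ^ CARD('d) * (\<integral>x. (cell_profile x)\<^sup>2 \<partial>(lborel :: (real^'d) measure))" for k :: "'d \<Rightarrow> nat"
    using integral_abs_powr_affine[OF test_function_measurable[OF test_function_cell_profile] amp(1) h(1), of "\<chi> i. - real (k i)" 2] amp(1)
    by (simp add: cell_def)
  have "ennreal (real (card (grid M :: ('d \<Rightarrow> nat) set)) * ?\<Delta> * 2 powr (- p) / 4) \<le> minimax_risk n p (density_class s p r R :: (real^'d \<Rightarrow> real) set)"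
  proof (rule assouad[where ?f0.0 = "scaled_base L" and g = "cell \<gamma> h" and \<kappa> = "\<kappa> / L ^ CARD('d)"])
    show "(\<lambda>x. scaled_base L x + (\<Sum>k\<in>\<epsilon>. cell \<gamma> h k x)) \<in> density_class s p r R" if "\<epsilon> \<subseteq> grid M" for \<epsilon> :: "('d \<Rightarrow> nat) set"
      by (rule cube_density_in_class[OF \<kappa> h L that p amp sob R])
    show "0 \<le> scaled_base L x + (\<Sum>k\<in>\<epsilon>. cell \<gamma> h k x)" if "\<epsilon> \<subseteq> grid M" for \<epsilon> :: "('d \<Rightarrow> nat) set" and x
      by (rule cube_density_nonneg[OF \<kappa>(2) h(1) L that amp])
    show "cell \<gamma> h k x = 0" if "j \<noteq> k" "cell \<gamma> h j x \<noteq> 0" for j k :: "'d \<Rightarrow> nat" and x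
      using cells_disjoint[OF cell_neq_0_in_cell cell_neq_0_in_cell h(1), of \<gamma> j x \<gamma> k] that by auto
    show "\<kappa> / L ^ CARD('d) \<le> scaled_base L x" if "k \<in> grid M" "cell \<gamma> h k x \<noteq> 0" for k :: "'d \<Rightarrow> nat" and x
      by (rule scaled_base_lower_bound[OF \<kappa>(2) h(1) L that])
    show "integrable lborel (\<lambda>x. (cell \<gamma> h k x)\<^sup>2)" for k :: "'d \<Rightarrow> nat"
      using test_function_integrable[OF test_function_mult[OF tc tc], of k] by (simp add: power2_eq_square)
    show "ennreal ?\<Delta> \<le> (\<integral>\<^sup>+x. ennreal (\<bar>cell \<gamma> h k x\<bar> powr p) \<partial>lborel)" for k :: "'d \<Rightarrow> nat"
    proof -
      have "(\<integral>x. \<bar>cell \<gamma> h k x\<bar> powr p \<partial>lborel) = ?\<Delta>"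
        unfolding cell_def
        by (rule integral_abs_powr_affine[OF test_function_measurable[OF test_function_cell_profile] amp(1) h(1)])
      moreover have "integrable lborel (\<lambda>x. \<bar>cell \<gamma> h k x\<bar> powr p)"
        using p by (intro test_function_integrable_powr tc) auto
      ultimately show ?thesis by (simp add: nn_integral_eq_integral)
    qed
    show "real n * ((\<integral>x. (cell \<gamma> h k x)\<^sup>2 \<partial>lborel) / (\<kappa> / L ^ CARD('d))) \<le> 1 / 4" for k :: "'d \<Rightarrow> nat"
      using chi by (simp add: sq)
    show "0 \<le> ?\<Delta>" using h(1) by (simp add: integral_nonneg_AE)
  qed (use \<kappa>(1) L(1) h(1) p in \<open>simp_all add: finite_grid test_function_integrable test_function_scaled_base integral_scaled_base tc integral_cell\<close>)
  moreover have "real (card (grid M :: ('d \<Rightarrow> nat) set)) * ?\<Delta> = L ^ CARD('d) * \<gamma> powr p * ?I"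
    by (simp add: card_grid L(2) power_mult_distrib)
  ultimately show ?thesis by simp
qed

section \<open>The rate\<close>

lemma sobolev_norm_nonneg: "0 \<le> sobolev_norm s p f"
  by (simp add: sobolev_norm_def sum_nonneg Lp_norm_nonneg)

text \<open>Three effects of scaling: the normalisation contributes \<open>L^(-d)\<close>, each
  derivative a factor \<open>1 / L\<close>, and the change of variables in the \<open>p\<close>-th
  power integral \<open>L^(d/p)\<close>.\<close>

lemma Lp_norm_rev_deriv_scaled_base:
  assumes L: "L > 0" and p: "p \<ge> 1"
  shows "Lp_norm p (rev_deriv \<alpha> (scaled_base L :: real^'d::finite \<Rightarrow> real)) =
    L powr (real CARD('d) / p - real CARD('d)) * (1 / L) ^ order_of \<alpha> * Lp_norm p (rev_deriv \<alpha> (base_density :: real^'d \<Rightarrow> real))"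
proof -
  let ?D = "rev_deriv \<alpha> (base_density :: real^'d \<Rightarrow> real)"
  let ?c = "1 / L ^ CARD('d) * (1 / L) ^ order_of \<alpha>"
  have t: "test_function (\<lambda>x. base_density ((1 / L) *\<^sub>R x + 0))"
    by (intro test_function_affine test_function_base_density) (use L in simp)
  have "rev_deriv \<alpha> (scaled_base L :: real^'d \<Rightarrow> real) = (\<lambda>x. ?c * ?D ((1 / L) *\<^sub>R x + 0))"
    unfolding scaled_base_def[abs_def] rev_deriv_cmult[OF t]
    using L by (subst rev_deriv_affine[OF test_function_base_density]) (auto simp: mult.assoc)
  then have "(\<integral>x. \<bar>rev_deriv \<alpha> (scaled_base L :: real^'d \<Rightarrow> real) x\<bar> powr p \<partial>lborel) = ?c powr p * L ^ CARD('d) * (\<integral>x. \<bar>?D x\<bar> powr p \<partial>lborel)"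
    using L by (simp only:) (intro integral_abs_powr_affine test_function_measurable test_function_rev_deriv test_function_base_density; simp)
  then have "Lp_norm p (rev_deriv \<alpha> (scaled_base L :: real^'d \<Rightarrow> real)) = (?c powr p * L ^ CARD('d) * (\<integral>x. \<bar>?D x\<bar> powr p \<partial>lborel)) powr (1 / p)"
    by (simp add: Lp_norm_def)
  also have "\<dots> = (?c powr p) powr (1 / p) * (L powr real CARD('d)) powr (1 / p) * Lp_norm p ?D"
    using L by (simp add: powr_mult Lp_norm_def integral_nonneg_AE powr_realpow)
  also have "(?c powr p) powr (1 / p) = ?c" using L p by (simp add: powr_powr)
  also have "(L powr real CARD('d)) powr (1 / p) = L powr (real CARD('d) / p)" by (simp add: powr_powr)
  also have "?c * L powr (real CARD('d) / p) = L powr (real CARD('d) / p - real CARD('d)) * (1 / L) ^ order_of \<alpha>"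
    using L by (simp add: powr_diff powr_realpow)
  finally show ?thesis .
qed

lemma rev_deriv_order_0: "order_of \<alpha> = 0 \<Longrightarrow> rev_deriv \<alpha> f = f"
proof -
  assume "order_of \<alpha> = 0"
  then have "\<alpha> i = 0" for i by (simp add: order_of_def)
  then have "derivs_along xs \<alpha> f = f" for xs by (induction xs) (simp_all add: derivs_along_simps)
  then show ?thesis by (simp add: rev_deriv_def)
qed

text \<open>For \<open>p > 1\<close> all terms of the norm tend to 0 like a negative power of
  \<open>L\<close>. For \<open>p = 1\<close> this power is \<open>L^0\<close>: the term of order 0
  remains equal to 1 and only the derivatives decay. Half of \<open>r_star\<close> is left free for
  the perturbation.\<close>

lemma ex_scale_sobolev_norm_base:
  assumes p: "p \<ge> 1" and r: "r > 0" "p = 1 \<Longrightarrow> r > 1"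
  shows "\<exists>L\<ge>1. 2 powr (1 - 1 / p) * sobolev_norm s p (scaled_base L :: real^'d::finite \<Rightarrow> real) \<le> r - r_star p r / 2"
proof -
  let ?G = "base_density :: real^'d \<Rightarrow> real"
  define C where "C = sobolev_norm s p ?G"
  have C: "C = (\<Sum>\<alpha> | order_of \<alpha> \<le> s. Lp_norm p (rev_deriv \<alpha> ?G))"
    by (simp add: C_def sobolev_norm_test_function test_function_base_density)
  have N: "sobolev_norm s p (scaled_base L :: real^'d \<Rightarrow> real) =
      (\<Sum>\<alpha> | order_of \<alpha> \<le> s. L powr (real CARD('d) / p - real CARD('d)) * (1 / L) ^ order_of \<alpha> * Lp_norm p (rev_deriv \<alpha> ?G))"
    if "L > 0" for L
    using that p by (simp add: sobolev_norm_test_function test_function_scaled_base Lp_norm_rev_deriv_scaled_base)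
  show ?thesis
  proof (cases "p = 1")
    case True
    have one: "Lp_norm 1 ?G = 1"
      by (simp add: Lp_norm_def base_density_nonneg integral_base_density)
    have bd: "sobolev_norm s p (scaled_base L :: real^'d \<Rightarrow> real) \<le> 1 + C / L" if L: "L \<ge> 1" for L
    proof -
      let ?z = "(\<lambda>_. 0) :: 'd \<Rightarrow> nat"
      have z: "order_of ?z = 0" by (simp add: order_of_def)
      have nz: "order_of \<alpha> \<noteq> 0" if "\<alpha> \<noteq> ?z" for \<alpha> :: "'d \<Rightarrow> nat" using that by (auto simp: order_of_def)
      have "sobolev_norm s p (scaled_base L :: real^'d \<Rightarrow> real) = (\<Sum>\<alpha> | order_of \<alpha> \<le> s. (1 / L) ^ order_of \<alpha> * Lp_norm p (rev_deriv \<alpha> ?G))"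
        using N[of L] L True by simp
      also have "\<dots> = 1 + (\<Sum>\<alpha>\<in>{\<alpha>. order_of \<alpha> \<le> s} - {?z}. (1 / L) ^ order_of \<alpha> * Lp_norm p (rev_deriv \<alpha> ?G))"
        by (subst sum.remove[of _ ?z]) (use z True one in \<open>simp_all add: finite_order_le rev_deriv_order_0\<close>)
      also have "\<dots> \<le> 1 + (\<Sum>\<alpha>\<in>{\<alpha>. order_of \<alpha> \<le> s} - {?z}. (1 / L) * Lp_norm p (rev_deriv \<alpha> ?G))"
      proof (intro add_left_mono sum_mono mult_right_mono Lp_norm_nonneg)
        fix \<alpha> :: "'d \<Rightarrow> nat" assume "\<alpha> \<in> {\<alpha>. order_of \<alpha> \<le> s} - {?z}"
        then have "1 \<le> order_of \<alpha>" using nz[of \<alpha>] by simp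
        then show "(1 / L) ^ order_of \<alpha> \<le> 1 / L"
          using power_decreasing[of 1 "order_of \<alpha>" "1 / L"] L by simp
      qed
      also have "\<dots> \<le> 1 + (\<Sum>\<alpha> | order_of \<alpha> \<le> s. (1 / L) * Lp_norm p (rev_deriv \<alpha> ?G))"
        using L by (intro add_left_mono sum_mono2 finite_order_le) (auto simp: Lp_norm_nonneg)
      also have "\<dots> = 1 + C / L" by (simp add: C sum_divide_distrib)
      finally show ?thesis .
    qed
    \<comment> \<open>Large enough for the derivatives, which contribute at most
      \<open>C / L\<close>, to use only half of \<open>r - 1\<close>.\<close>
    define L where "L = max 1 (2 * C / (r - 1))"
    have "r > 1" using r True by simp
    then have "2 * C / (r - 1) \<le> L" "L \<ge> 1" by (simp_all add: L_def)
    then have "C / L \<le> (r - 1) / 2" using \<open>r > 1\<close> by (simp add: field_simps)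
    then have "sobolev_norm s p (scaled_base L :: real^'d \<Rightarrow> real) \<le> 1 + (r - 1) / 2"
      using bd[OF \<open>L \<ge> 1\<close>] by linarith
    moreover have "r - r_star p r / 2 = 1 + (r - 1) / 2" using True by (simp add: r_star_def field_simps)
    ultimately show ?thesis using \<open>L \<ge> 1\<close> True by auto
  next
    case False
    then have p1: "p > 1" using p by simp
    define e where "e = real CARD('d) / p - real CARD('d)"
    have e: "e < 0" using p1 by (simp add: e_def field_simps)
    have bd: "sobolev_norm s p (scaled_base L :: real^'d \<Rightarrow> real) \<le> L powr e * C" if L: "L \<ge> 1" for L
    proof -
      have "(1 / L) ^ order_of \<alpha> \<le> 1" for \<alpha> :: "'d \<Rightarrow> nat" using L by (intro power_le_one) auto
      then have "sobolev_norm s p (scaled_base L :: real^'d \<Rightarrow> real) \<le> (\<Sum>\<alpha> | order_of \<alpha> \<le> s. L powr e * 1 * Lp_norm p (rev_deriv \<alpha> ?G))"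
        using L unfolding e_def by (subst N) (auto intro!: sum_mono mult_right_mono mult_left_mono simp: Lp_norm_nonneg)
      then show ?thesis by (simp add: C sum_distrib_left)
    qed
    have "((\<lambda>L. 2 powr (1 - 1 / p) * (L powr e * C)) \<longlongrightarrow> 2 powr (1 - 1 / p) * (0 * C)) at_top"
      by (intro tendsto_intros tendsto_neg_powr e filterlim_ident)
    then have "eventually (\<lambda>L. 2 powr (1 - 1 / p) * (L powr e * C) < r / 2) at_top"
      using r by (intro order_tendstoD(2)[of _ 0]) auto
    then have "eventually (\<lambda>L. 2 powr (1 - 1 / p) * (L powr e * C) < r / 2 \<and> L \<ge> 1) at_top"
      by (intro eventually_conj eventually_ge_at_top)
    then obtain L where L: "2 powr (1 - 1 / p) * (L powr e * C) < r / 2" "L \<ge> 1"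
      using eventually_happens'[OF trivial_limit_at_top_linorder] by blast
    have "2 powr (1 - 1 / p) * sobolev_norm s p (scaled_base L :: real^'d \<Rightarrow> real) \<le> 2 powr (1 - 1 / p) * (L powr e * C)"
      by (intro mult_left_mono bd L) simp
    also have "\<dots> \<le> r - r_star p r / 2" using L(1) False by (simp add: r_star_def)
    finally show ?thesis using L(2) by blast
  qed
qed

text \<open>The cells have side length \<open>h \<approx> \<eta>\<close>, where \<open>n \<rho>\<^sup>2 L\<^bsup>d - 2d/p\<^esup> \<eta>\<^bsup>2s + d\<^esup> = 1\<close> balances the smoothness constraint
  against the indistinguishability of neighbouring hypotheses.\<close>

lemma minimax_risk_rate:
  fixes s :: nat and p :: real
  assumes s: "s \<ge> 1" and p: "p \<ge> 1"
  defines "d \<equiv> real CARD('d::finite)"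
  defines "q \<equiv> real s * p / (2 * real s + d)"
  shows "\<exists>c>0. \<exists>K>0. \<forall>L>0. \<forall>\<rho>>0. \<forall>r R.
    2 powr (1 - 1 / p) * sobolev_norm s p (scaled_base L :: real^'d \<Rightarrow> real) + \<rho> / 2 \<le> r \<longrightarrow> L * K \<le> R \<longrightarrow>
    (\<forall>\<^sub>F n in sequentially. ennreal (c * L powr ((2 / p - 1) * d * q) * (\<rho> powr (d / real s) / real n) powr q)
      \<le> minimax_risk n p (density_class s p r R :: (real^'d \<Rightarrow> real) set))"
proof -
  obtain \<kappa> :: real where \<kappa>: "\<kappa> > 0" "\<And>x :: real^'d. (\<And>i. 0 \<le> x $ i \<and> x $ i \<le> 1) \<Longrightarrow> \<kappa> \<le> base_density x"
    using base_density_lower_bound[where 'd = 'd] by blast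
  obtain K where K: "K > 0" "\<And>x :: real^'d. x \<notin> cball 0 K \<Longrightarrow> base_density x = 0"
    using test_function_bounded_support[OF test_function_base_density] by blast
  obtain B where B: "B > 0" "\<And>x :: real^'d. \<bar>cell_profile x\<bar> \<le> B"
    using test_function_bounded[OF test_function_cell_profile] by blast
  define I where "I = (\<integral>x. \<bar>cell_profile x\<bar> powr p \<partial>(lborel :: (real^'d) measure))"
  define J where "J = (\<integral>x. (cell_profile x)\<^sup>2 \<partial>(lborel :: (real^'d) measure))"
  define C where "C = 2 powr (1 - 1 / p) * sobolev_norm s p (cell_profile :: real^'d \<Rightarrow> real)"
  \<comment> \<open>A small amplitude: the first entry gives \<open>a^2\<close> at most
    \<open>a\<close>, the second keeps the Sobolev norm of the cells within \<rho>/2, and the third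
    keeps \<open>n\<close> times the chi-square distance below 1/4. The summands 1 keep the
    denominators positive.\<close>
  define a where "a = min 1 (min (1 / (2 * (C + 1))) (\<kappa> / (4 * (J + 1))))"
  \<comment> \<open>The factor \<open>2 powr (- (real s * p))\<close> pays for rounding the side
    length, which may drop to half of \<eta>; the final \<open>2 powr (- p) / 4\<close> is the
    constant of Assouad's lemma.\<close>
  define c where "c = a powr p * 2 powr (- (real s * p)) * I * 2 powr (- p) / 4"
  have I: "I > 0" unfolding I_def using p by (intro integral_cell_profile_powr_pos) simp
  have J: "J \<ge> 0" by (simp add: J_def integral_nonneg_AE)
  have C: "C \<ge> 0" by (simp add: C_def sobolev_norm_nonneg)
  have a: "a > 0" "a \<le> 1" "a \<le> 1 / (2 * (C + 1))" "a \<le> \<kappa> / (4 * (J + 1))"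
    using C J \<kappa>(1) by (simp_all add: a_def)
  have aC: "a * C \<le> 1 / 2"
  proof -
    have "a * C \<le> 1 / (2 * (C + 1)) * C" using a C by (intro mult_right_mono) auto
    also have "\<dots> \<le> 1 / 2" using C by (simp add: field_simps)
    finally show ?thesis .
  qed
  have aJ: "a\<^sup>2 * J / \<kappa> \<le> 1 / 4"
  proof -
    have "a\<^sup>2 * J \<le> a * J" using a J by (intro mult_right_mono) (auto simp: power2_eq_square mult_left_le)
    also have "\<dots> \<le> \<kappa> / (4 * (J + 1)) * J" using a J by (intro mult_right_mono) auto
    also have "\<dots> \<le> \<kappa> / 4" using J \<kappa>(1) by (simp add: field_simps)
    finally show ?thesis using \<kappa>(1) by (simp add: field_simps)
  qed
  have c: "c > 0" using a I by (simp add: c_def)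
  have d: "d > 0" by (simp add: d_def)
  have Q: "2 * real s + d > 0" using d by simp
  show ?thesis
  proof (rule exI[of _ c], intro conjI c, rule exI[of _ K], intro conjI K(1) allI impI)
    fix L \<rho> r R :: real
    assume L: "L > 0" and \<rho>: "\<rho> > 0" and r: "2 powr (1 - 1 / p) * sobolev_norm s p (scaled_base L :: real^'d \<Rightarrow> real) + \<rho> / 2 \<le> r"
      and R: "L * K \<le> R"
    define X where "X n = real n * (\<rho>\<^sup>2 * L powr (d - 2 * d / p))" for n
    define \<eta> where "\<eta> n = X n powr (- (1 / (2 * real s + d)))" for n
    \<comment> \<open>The largest value of \<open>h ^ s\<close> for which the amplitude stays below
      the floor of the scaled density. It does not depend on \<open>n\<close>, whereas \<eta> tends
      to 0.\<close>
    define e where "e = \<kappa> / L ^ CARD('d) / (a * \<rho> * L powr (- d / p) * B)"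
    have e: "e > 0" using \<kappa>(1) L a \<rho> B by (simp add: e_def)
    have "filterlim X at_top sequentially"
      unfolding X_def using \<rho> L
      by (intro filterlim_at_top_mult_tendsto_pos[OF tendsto_const] filterlim_real_sequentially) auto
    then have "\<eta> \<longlonglongrightarrow> 0"
      unfolding \<eta>_def using Q by (intro tendsto_neg_powr) auto
    then have "eventually (\<lambda>n. \<eta> n < min 1 (min L e)) sequentially"
      using L e by (intro order_tendstoD(2)[of _ 0]) auto
    then show "\<forall>\<^sub>F n in sequentially. ennreal (c * L powr ((2 / p - 1) * d * q) * (\<rho> powr (d / real s) / real n) powr q)
      \<le> minimax_risk n p (density_class s p r R :: (real^'d \<Rightarrow> real) set)"
      using eventually_ge_at_top[of 1]
    proof eventually_elim
      case (elim n)
      have X: "X n > 0" using elim \<rho> L by (simp add: X_def)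
      have \<eta>: "\<eta> n > 0" "\<eta> n \<le> 1" "\<eta> n \<le> L" "\<eta> n \<le> e" using elim X by (simp_all add: \<eta>_def)
      \<comment> \<open>Rounding up makes \<open>L\<close> an exact multiple of the side length. As
        \<open>L\<close> is at least \<eta>, rounding at most doubles the quotient, so
        \<open>h\<close> stays between \<eta>/2 and \<eta>.\<close>
      define M where "M = nat \<lceil>L / \<eta> n\<rceil>"
      define h where "h = L / real M"
      define \<gamma> where "\<gamma> = a * \<rho> * h ^ s * L powr (- d / p)"
      have L\<eta>: "L / \<eta> n \<ge> 1" using \<eta> by simp
      have M: "L / \<eta> n \<le> real M" "real M \<le> 2 * (L / \<eta> n)" "real M > 0"
        using L\<eta> unfolding M_def by linarith+
      have h: "h > 0" "L = h * real M" using M L by (simp_all add: h_def)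
      have h\<eta>: "h \<le> \<eta> n" "\<eta> n / 2 \<le> h" using M \<eta> L by (simp_all add: h_def field_simps)
      have h1: "h \<le> 1" using h\<eta> \<eta> by linarith
      have \<gamma>: "\<gamma> \<ge> 0" using a \<rho> h by (simp add: \<gamma>_def)
      have amp: "\<gamma> * \<bar>cell_profile x\<bar> \<le> \<kappa> / L ^ CARD('d)" for x :: "real^'d"
      proof -
        have "h ^ s \<le> h" using power_decreasing[OF s, of h] h h1 by simp
        then have "h ^ s \<le> e" using h\<eta> \<eta> by linarith
        then have "\<gamma> * \<bar>cell_profile x\<bar> \<le> (a * \<rho> * e * L powr (- d / p)) * B"
          unfolding \<gamma>_def using a \<rho> h e B by (intro mult_mono) auto
        also have "\<dots> = e * (a * \<rho> * L powr (- d / p) * B)" by (simp only: mult_ac)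
        also have "\<dots> = \<kappa> / L ^ CARD('d)"
        proof -
          have "a * \<rho> * L powr (- d / p) * B \<noteq> 0" using a \<rho> L B by simp
          moreover have "y / w * w = y" if "w \<noteq> 0" for y w :: real using that by simp
          ultimately show ?thesis unfolding e_def by blast
        qed
        finally show ?thesis .
      qed
      have sob: "2 powr (1 - 1 / p) * (sobolev_norm s p (scaled_base L :: real^'d \<Rightarrow> real) +
          \<gamma> * (1 / h) ^ s * L powr (real CARD('d) / p) * sobolev_norm s p (cell_profile :: real^'d \<Rightarrow> real)) \<le> r"
      proof -
        \<comment> \<open>The powers of \<open>h\<close> and \<open>L\<close> in \<gamma> are chosen
          to cancel here: the cells add at most \<open>a * C * \<rho>\<close> to the norm, which is
          within the free \<rho>/2.\<close>
        have "h ^ s * (1 / h) ^ s = 1" using h by (simp add: power_one_over)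
        moreover have "L powr (- d / p) * L powr (d / p) = 1" using L by (simp add: powr_add[symmetric])
        moreover have "\<gamma> * (1 / h) ^ s * L powr (real CARD('d) / p) =
            a * \<rho> * (h ^ s * (1 / h) ^ s) * (L powr (- d / p) * L powr (d / p))"
          unfolding \<gamma>_def d_def[symmetric] by (simp only: mult_ac)
        ultimately have "\<gamma> * (1 / h) ^ s * L powr (real CARD('d) / p) = a * \<rho>" by simp
        moreover have "a * C * \<rho> \<le> 1 / 2 * \<rho>" using aC \<rho> by (intro mult_right_mono) auto
        ultimately show ?thesis using r by (simp add: C_def algebra_simps)
      qed
      have hQ: "X n * h ^ (2 * s + CARD('d)) \<le> 1"
      proof -
        have "h ^ (2 * s + CARD('d)) \<le> \<eta> n ^ (2 * s + CARD('d))" using h h\<eta> by (intro power_mono) auto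
        also have "\<dots> = \<eta> n powr (2 * real s + d)" using \<eta> by (simp add: powr_realpow[symmetric] d_def)
        also have "\<dots> = X n powr (- (1 / (2 * real s + d)) * (2 * real s + d))"
          by (simp only: \<eta>_def powr_powr)
        also have "- (1 / (2 * real s + d)) * (2 * real s + d) = - 1" using Q by simp
        also have "X n powr - 1 = 1 / X n" using X by (simp add: powr_neg_one)
        finally show ?thesis using X by (simp add: field_simps)
      qed
      have chi: "real n * (\<gamma>\<^sup>2 * h ^ CARD('d) * (\<integral>x. (cell_profile x)\<^sup>2 \<partial>(lborel :: (real^'d) measure)) * L ^ CARD('d) / \<kappa>) \<le> 1 / 4"
      proof -
        have LL: "(L powr (- d / p))\<^sup>2 * L ^ CARD('d) = L powr (d - 2 * d / p)"
          using L by (simp add: power2_eq_square powr_add[symmetric] powr_realpow[symmetric] d_def[symmetric])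
        have "\<gamma>\<^sup>2 = a\<^sup>2 * \<rho>\<^sup>2 * h ^ (2 * s) * (L powr (- d / p))\<^sup>2"
          unfolding \<gamma>_def by (simp add: power_mult_distrib power_even_eq)
        then have "real n * (\<gamma>\<^sup>2 * h ^ CARD('d) * J * L ^ CARD('d) / \<kappa>) =
            real n * (a\<^sup>2 * \<rho>\<^sup>2 * h ^ (2 * s) * h ^ CARD('d) * J * ((L powr (- d / p))\<^sup>2 * L ^ CARD('d)) / \<kappa>)"
          by (simp only: mult.assoc mult.commute mult.left_commute)
        also have "\<dots> = real n * (a\<^sup>2 * \<rho>\<^sup>2 * h ^ (2 * s) * h ^ CARD('d) * J * L powr (d - 2 * d / p) / \<kappa>)"
          by (simp only: LL)
        also have "\<dots> = (a\<^sup>2 * J / \<kappa>) * (X n * h ^ (2 * s + CARD('d)))"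
          unfolding X_def power_add by simp
        also have "\<dots> \<le> (1 / 4) * 1"
          using hQ aJ X h a J \<kappa>(1) by (intro mult_mono) auto
        finally show ?thesis by (simp add: J_def)
      qed
      have low: "c * L powr ((2 / p - 1) * d * q) * (\<rho> powr (d / real s) / real n) powr q \<le> L ^ CARD('d) * \<gamma> powr p * I * 2 powr (- p) / 4"
      proof -
        have Lp: "L ^ CARD('d) * (L powr (- d / p)) powr p = 1"
          using L p by (simp add: powr_powr powr_realpow[symmetric] powr_add[symmetric] d_def[symmetric])
        have "\<gamma> powr p = a powr p * \<rho> powr p * (h ^ s) powr p * (L powr (- d / p)) powr p"
          unfolding \<gamma>_def using a \<rho> h by (simp add: powr_mult)
        moreover have "(h ^ s) powr p = h powr (real s * p)"
          using h by (simp add: powr_powr powr_realpow[symmetric])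
        ultimately have "L ^ CARD('d) * \<gamma> powr p = (L ^ CARD('d) * (L powr (- d / p)) powr p) * (a powr p * \<rho> powr p * h powr (real s * p))"
          by (simp only: mult_ac)
        then have \<gamma>p: "L ^ CARD('d) * \<gamma> powr p = a powr p * \<rho> powr p * h powr (real s * p)"
          by (simp only: Lp mult_1)
        \<comment> \<open>Raising the balance equation for \<eta> to the power that occurs in the
          risk produces the rate in \<open>n\<close> together with the power of
          \<open>L\<close>.\<close>
        have "\<eta> n powr (real s * p) = X n powr (- q)"
          by (simp add: \<eta>_def powr_powr q_def)
        also have "\<dots> = real n powr (- q) * ((\<rho>\<^sup>2) powr (- q) * (L powr (d - 2 * d / p)) powr (- q))"
          unfolding X_def using \<rho> by (simp add: powr_mult)
        also have "(\<rho>\<^sup>2) powr (- q) = \<rho> powr (- 2 * q)"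
          using \<rho> powr_powr[of \<rho> 2 "- q"] by simp
        also have "(L powr (d - 2 * d / p)) powr (- q) = L powr ((d - 2 * d / p) * (- q))"
          by (rule powr_powr)
        also have "(d - 2 * d / p) * (- q) = (2 / p - 1) * d * q"
          by (simp add: left_diff_distrib)
        finally have \<eta>q: "\<rho> powr p * \<eta> n powr (real s * p) =
            real n powr (- q) * L powr ((2 / p - 1) * d * q) * (\<rho> powr p * \<rho> powr (- 2 * q))" by simp
        \<comment> \<open>The direct factor \<open>\<rho> powr p\<close> and the factor
          \<open>\<rho> powr (- 2 * q)\<close> hidden in \<eta> combine to the exponent of the
          radius in the rate.\<close>
        have "p - 2 * q = d / real s * q"
          using s Q by (simp add: q_def field_simps)
        then have "\<rho> powr p * \<rho> powr (- 2 * q) = \<rho> powr (d / real s * q)"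
          by (simp add: powr_add[symmetric])
        moreover have "(\<rho> powr (d / real s) / real n) powr q = \<rho> powr (d / real s * q) * real n powr (- q)"
          using \<rho> by (simp add: powr_divide powr_powr powr_minus_divide)
        ultimately have eq: "\<rho> powr p * \<eta> n powr (real s * p) = L powr ((2 / p - 1) * d * q) * (\<rho> powr (d / real s) / real n) powr q"
          using \<eta>q by simp
        have "(\<eta> n / 2) powr (real s * p) \<le> h powr (real s * p)"
          using \<eta> h\<eta> p by (intro powr_mono2) auto
        then have hp: "\<eta> n powr (real s * p) * 2 powr (- (real s * p)) \<le> h powr (real s * p)"
          using \<eta> by (simp add: powr_divide powr_minus_divide)
        have "c * L powr ((2 / p - 1) * d * q) * (\<rho> powr (d / real s) / real n) powr q = c * (\<rho> powr p * \<eta> n powr (real s * p))"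
          by (simp add: eq)
        also have "\<dots> = (a powr p * \<rho> powr p * I * 2 powr (- p) / 4) * (\<eta> n powr (real s * p) * 2 powr (- (real s * p)))"
          by (simp add: c_def)
        also have "\<dots> \<le> (a powr p * \<rho> powr p * I * 2 powr (- p) / 4) * h powr (real s * p)"
          using I by (intro mult_left_mono hp) auto
        also have "\<dots> = (L ^ CARD('d) * \<gamma> powr p) * I * 2 powr (- p) / 4" by (simp add: \<gamma>p)
        finally show ?thesis .
      qed
      show ?case
        using order_trans[OF ennreal_leI[OF low] minimax_risk_lower_bound[OF \<kappa> h(1) h1 L h(2) p \<gamma> amp sob K(2) R chi, folded I_def]] .
    qed
  qed
qed

section \<open>Passage to the limit inferior\<close>

lemma liminf_rate:
  fixes X :: "nat \<Rightarrow> ennreal"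
  assumes "c \<ge> 0" "v > 0" "\<forall>\<^sub>F n in sequentially. ennreal (c * (v / real n) powr q) \<le> X n"
  shows "ennreal c \<le> liminf (\<lambda>n. ennreal ((v / real n) powr (- q)) * X n)"
proof (rule Liminf_bounded)
  show "\<forall>\<^sub>F n in sequentially. ennreal c \<le> ennreal ((v / real n) powr (- q)) * X n"
    using assms(3) eventually_ge_at_top[of 1]
  proof eventually_elim
    case (elim n)
    have "v / real n > 0" using elim assms(2) by simp
    then have "(v / real n) powr (- q) * (v / real n) powr q = 1"
      by (simp only: powr_add[symmetric]) (use elim assms(2) in auto)
    then have "c = (v / real n) powr (- q) * (c * (v / real n) powr q)"
      by (metis mult.left_commute mult.right_neutral)
    then have "ennreal c = ennreal ((v / real n) powr (- q)) * ennreal (c * (v / real n) powr q)"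
      using assms(1) by (metis ennreal_mult mult_nonneg_nonneg powr_ge_zero)
    also have "\<dots> \<le> ennreal ((v / real n) powr (- q)) * X n"
      by (intro mult_left_mono elim) simp
    finally show ?case .
  qed
qed

theorem theorem6p2:
  fixes s :: nat and p r0 :: real
  assumes "s \<ge> 1" and "p \<ge> 1"
    and "r0 \<ge> 0" and "p > 2 \<Longrightarrow> r0 > 0"
  shows "\<exists>c>0. \<forall>r::real. r > 0 \<and> (p = 1 \<longrightarrow> r > 1) \<and> r \<ge> r0 \<longrightarrow>
    (\<exists>R0>0. \<forall>R\<ge>R0.
      ennreal c \<le> liminf (\<lambda>n.
        ennreal ((r_star p r powr (real CARD('d) / real s) / real n)
                   powr (- (real s * p / (2 * real s + real CARD('d)))))
        * minimax_risk n p (density_class s p r R :: (real^'d::finite \<Rightarrow> real) set)))"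
proof -
  define d where "d = real CARD('d)"
  define q where "q = real s * p / (2 * real s + d)"
  define \<theta> where "\<theta> = (2 / p - 1) * d * q"
  let ?N = "\<lambda>L. 2 powr (1 - 1 / p) * sobolev_norm s p (scaled_base L :: real^'d \<Rightarrow> real)"
  obtain c K where c: "c > 0" "K > 0" and rate: "\<forall>L>0. \<forall>\<rho>>0. \<forall>r R. ?N L + \<rho> / 2 \<le> r \<longrightarrow> L * K \<le> R \<longrightarrow>
    (\<forall>\<^sub>F n in sequentially. ennreal (c * L powr \<theta> * (\<rho> powr (d / real s) / real n) powr q)
      \<le> minimax_risk n p (density_class s p r R :: (real^'d \<Rightarrow> real) set))"
    using minimax_risk_rate[OF assms(1,2), where 'd = 'd] unfolding \<theta>_def q_def d_def by (elim exE conjE) blast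
  have rs: "r_star p r > 0" if "r > 0" "p = 1 \<longrightarrow> r > 1" for r using that by (simp add: r_star_def)
  have *: "\<exists>R0>0. \<forall>R\<ge>R0. ennreal c' \<le> liminf (\<lambda>n. ennreal ((r_star p r powr (d / real s) / real n) powr (- q))
      * minimax_risk n p (density_class s p r R :: (real^'d \<Rightarrow> real) set))"
    if r: "r > 0" "p = 1 \<longrightarrow> r > 1" and L: "L \<ge> 1" "?N L \<le> r - r_star p r / 2" and c': "c' \<le> c * L powr \<theta>" for r L c'
  \<comment> \<open>\<open>L * K\<close> bounds the support of the scaled density, since
    \<open>K\<close> bounds that of \<open>base_density\<close>. It depends on \<open>r\<close> only
    through \<open>L\<close>.\<close>
  proof (intro exI[of _ "L * K"] conjI allI impI)
    show "L * K > 0" using L c by simp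
    fix R assume R: "L * K \<le> R"
    have "ennreal (c * L powr \<theta>) \<le> liminf (\<lambda>n. ennreal ((r_star p r powr (d / real s) / real n) powr (- q))
      * minimax_risk n p (density_class s p r R :: (real^'d \<Rightarrow> real) set))"
    proof (rule liminf_rate)
      have "?N L + r_star p r / 2 \<le> r" "L > 0" using L by linarith+
      with rate R rs[OF r] show "\<forall>\<^sub>F n in sequentially. ennreal (c * L powr \<theta> * (r_star p r powr (d / real s) / real n) powr q)
          \<le> minimax_risk n p (density_class s p r R :: (real^'d \<Rightarrow> real) set)"
        by blast
      show "0 \<le> c * L powr \<theta>" using c by simp
      show "0 < r_star p r powr (d / real s)" using rs[OF r] by simp
    qed
    then show "ennreal c' \<le> liminf (\<lambda>n. ennreal ((r_star p r powr (d / real s) / real n) powr (- q))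
      * minimax_risk n p (density_class s p r R :: (real^'d \<Rightarrow> real) set))"
      by (rule order_trans[OF ennreal_leI[OF c']])
  qed
  show ?thesis unfolding d_def[symmetric] q_def[symmetric]
  proof (cases "p \<le> 2")
    case True
    have \<theta>: "\<theta> \<ge> 0" using True assms(2) by (simp add: \<theta>_def q_def d_def)
    show "\<exists>c>0. \<forall>r. r > 0 \<and> (p = 1 \<longrightarrow> r > 1) \<and> r \<ge> r0 \<longrightarrow> (\<exists>R0>0. \<forall>R\<ge>R0. ennreal c \<le>
        liminf (\<lambda>n. ennreal ((r_star p r powr (d / real s) / real n) powr (- q)) * minimax_risk n p (density_class s p r R :: (real^'d \<Rightarrow> real) set)))"
    proof (rule exI[of _ c], intro conjI c(1) allI impI)
      fix r assume r: "r > 0 \<and> (p = 1 \<longrightarrow> r > 1) \<and> r \<ge> r0"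
      then obtain L where L: "L \<ge> 1" "?N L \<le> r - r_star p r / 2"
        using ex_scale_sobolev_norm_base[OF assms(2), of r s, where 'd = 'd] by auto
      have "c * 1 \<le> c * L powr \<theta>" using c L \<theta> by (intro mult_left_mono ge_one_powr_ge_zero) auto
      then show "\<exists>R0>0. \<forall>R\<ge>R0. ennreal c \<le>
        liminf (\<lambda>n. ennreal ((r_star p r powr (d / real s) / real n) powr (- q)) * minimax_risk n p (density_class s p r R :: (real^'d \<Rightarrow> real) set))"
        using r L by (intro *[of r L]) simp_all
    qed
  next
    case False
    then have r0: "r0 > 0" using assms(4) by simp
    \<comment> \<open>The factor \<open>L powr \<theta>\<close> now decreases in \<open>L\<close>
      and is absorbed into the constant; hence \<open>L\<close> is fixed by \<open>r0\<close>
      alone.\<close>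
    obtain L where L: "L \<ge> 1" "?N L \<le> r0 - r_star p r0 / 2"
      using ex_scale_sobolev_norm_base[OF assms(2) r0, of s, where 'd = 'd] False by auto
    show "\<exists>c>0. \<forall>r. r > 0 \<and> (p = 1 \<longrightarrow> r > 1) \<and> r \<ge> r0 \<longrightarrow> (\<exists>R0>0. \<forall>R\<ge>R0. ennreal c \<le>
        liminf (\<lambda>n. ennreal ((r_star p r powr (d / real s) / real n) powr (- q)) * minimax_risk n p (density_class s p r R :: (real^'d \<Rightarrow> real) set)))"
    proof (rule exI[of _ "c * L powr \<theta>"], intro conjI allI impI)
      show "c * L powr \<theta> > 0" using c L by simp
      fix r assume r: "r > 0 \<and> (p = 1 \<longrightarrow> r > 1) \<and> r \<ge> r0"
      \<comment> \<open>Here \<open>r_star p r = r\<close>, so the bound is \<open>r / 2\<close>,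
        which increases with \<open>r\<close>: the scale chosen for \<open>r0\<close> suits every
        larger radius.\<close>
      have "?N L \<le> r - r_star p r / 2" using L(2) r False by (simp add: r_star_def)
      then show "\<exists>R0>0. \<forall>R\<ge>R0. ennreal (c * L powr \<theta>) \<le>
        liminf (\<lambda>n. ennreal ((r_star p r powr (d / real s) / real n) powr (- q)) * minimax_risk n p (density_class s p r R :: (real^'d \<Rightarrow> real) set))"
        using r L by (intro *[of r L]) simp_all
    qed
  qed
qed

end
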